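(* Let $G$ be a finitely generated group acting on a CAT(0) cube complex $X$ by elliptic isometries (i.e. every element of $G$ acts as an elliptic isometry). If $X$ has no infinite cube, then $G$ has a global fixed point in $X$.
   Context: Actions on cube complexes are by automorphisms of the cube complex. $X$ is not assumed finite-dimensional or locally finite. An isometry is elliptic if it fixes a point of $X$. An infinite cube in $X$ is the union of an infinite increasing sequence $C^0\subset C^1\subset C^2\subset\cdots$ of cubes of $X$, where each $C^n$ is a combinatorial unit cube with $2^n$ vertices. *)

theory Defs
  imports "HOL-Analysis.Analysis" "HOL-Algebra.Group_Action" "HOL-Algebra.Generated_Groups"
begin

section \<open>Unit cubes\<close>

(* The unit cube [0,1]^n, with points of R^n encoded as functions nat => real vanishing at
   all indices >= n. The product topology on nat => real induces the Euclidean topology on it.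
   The metric is given explicitly by cube_dist, because the type-class metric on
   nat => real is not the Euclidean one. *)
definition unit_cube :: "nat \<Rightarrow> (nat \<Rightarrow> real) set" where
  "unit_cube n = {x. (\<forall>i<n. 0 \<le> x i \<and> x i \<le> 1) \<and> (\<forall>i\<ge>n. x i = 0)}"

definition cube_dist :: "nat \<Rightarrow> (nat \<Rightarrow> real) \<Rightarrow> (nat \<Rightarrow> real) \<Rightarrow> real" where
  "cube_dist n x y = L2_set (\<lambda>i. x i - y i) {..<n}"

(* F is a (nonempty, closed) k-dimensional face of [0,1]^n: the coordinates in J are fixed
   to values 0 or 1, the remaining k coordinates are free. *)
definition is_cube_face :: "nat \<Rightarrow> nat \<Rightarrow> (nat \<Rightarrow> real) set \<Rightarrow> bool" where
  "is_cube_face n k F \<longleftrightarrow>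
     (\<exists>J a. J \<subseteq> {..<n} \<and> card J + k = n \<and> (\<forall>i\<in>J. a i \<in> {0, 1}) \<and>
            F = {x \<in> unit_cube n. \<forall>i\<in>J. x i = a i})"

definition cube_isometry ::
  "nat \<Rightarrow> (nat \<Rightarrow> real) set \<Rightarrow> nat \<Rightarrow> (nat \<Rightarrow> real) set \<Rightarrow> ((nat \<Rightarrow> real) \<Rightarrow> (nat \<Rightarrow> real)) \<Rightarrow> bool"
where
  "cube_isometry n F m F' h \<longleftrightarrow>
     bij_betw h F F' \<and> (\<forall>x\<in>F. \<forall>y\<in>F. cube_dist m (h x) (h y) = cube_dist n x y)"


section \<open>Cube complexes\<close>

(* Cubical complexes in the sense of Bridson and Haefliger, "Metric spaces of non-positive
   curvature", Definition I.7.32, with the quotient of the disjoint union of unit cubes presented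
   as a set X together with the family A of characteristic maps p : [0,1]^n -> X (stored as pairs
   (n, p)). Each p is injective, and if two of the cubes meet, then they are glued along a
   single isometry between faces of them. No bound is imposed on the dimensions n or on the
   number of cubes meeting at a point. *)
definition cubical_complex :: "'a set \<Rightarrow> (nat \<times> ((nat \<Rightarrow> real) \<Rightarrow> 'a)) set \<Rightarrow> bool" where
  "cubical_complex X A \<longleftrightarrow>
     X = (\<Union>(n, p)\<in>A. p ` unit_cube n) \<and>
     (\<forall>(n, p)\<in>A. inj_on p (unit_cube n)) \<and>
     (\<forall>(n, p)\<in>A. \<forall>(m, q)\<in>A. p ` unit_cube n \<inter> q ` unit_cube m \<noteq> {} \<longrightarrow>
        (\<exists>k l F F' h. is_cube_face n k F \<and> is_cube_face m l F' \<and> cube_isometry n F m F' h \<and>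
           (\<forall>x\<in>unit_cube n. \<forall>y\<in>unit_cube m. p x = q y \<longleftrightarrow> x \<in> F \<and> y = h x)))"

(* The k-dimensional (closed) cubes of X; they include all faces of the characteristic cubes. *)
definition cubes :: "(nat \<times> ((nat \<Rightarrow> real) \<Rightarrow> 'a)) set \<Rightarrow> nat \<Rightarrow> 'a set set" where
  "cubes A k = {p ` F | n p F. (n, p) \<in> A \<and> is_cube_face n k F}"

definition cc_vertices :: "(nat \<times> ((nat \<Rightarrow> real) \<Rightarrow> 'a)) set \<Rightarrow> 'a set" where
  "cc_vertices A = {v. {v} \<in> cubes A 0}"

(* The weak (quotient, CW) topology on X. *)
definition cc_topology ::
  "'a set \<Rightarrow> (nat \<times> ((nat \<Rightarrow> real) \<Rightarrow> 'a)) set \<Rightarrow> 'a topology" where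
  "cc_topology X A = topology (\<lambda>U. U \<subseteq> X \<and>
     (\<forall>(n, p)\<in>A. openin (top_of_set (unit_cube n)) {x \<in> unit_cube n. p x \<in> U}))"

lemma openin_cc_topology:
  "openin (cc_topology X A) U \<longleftrightarrow> U \<subseteq> X \<and>
     (\<forall>(n, p)\<in>A. openin (top_of_set (unit_cube n)) {x \<in> unit_cube n. p x \<in> U})"
proof -
  have "istopology (\<lambda>U. U \<subseteq> X \<and>
     (\<forall>(n, p)\<in>A. openin (top_of_set (unit_cube n)) {x \<in> unit_cube n. p x \<in> U}))"
    (is "istopology ?P")
    unfolding istopology_def
  proof (intro conjI allI impI)
    fix S T assume S: "?P S" and T: "?P T"
    have "openin (top_of_set (unit_cube n)) {x \<in> unit_cube n. p x \<in> S \<inter> T}"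
      if "(n, p) \<in> A" for n p
    proof -
      have "{x \<in> unit_cube n. p x \<in> S \<inter> T}
              = {x \<in> unit_cube n. p x \<in> S} \<inter> {x \<in> unit_cube n. p x \<in> T}"
        by blast
      with S T that show ?thesis by (auto simp only: intro!: openin_Int)
    qed
    with S show "S \<inter> T \<subseteq> X" "\<forall>(n, p)\<in>A. openin (top_of_set (unit_cube n)) {x \<in> unit_cube n. p x \<in> S \<inter> T}"
      by blast+
  next
    fix K assume K: "\<forall>U\<in>K. ?P U"
    then show "\<Union>K \<subseteq> X" by blast
    have "openin (top_of_set (unit_cube n)) {x \<in> unit_cube n. p x \<in> \<Union>K}"
      if "(n, p) \<in> A" for n p
    proof -
      have "{x \<in> unit_cube n. p x \<in> \<Union>K} = (\<Union>U\<in>K. {x \<in> unit_cube n. p x \<in> U})"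
        by blast
      moreover have "openin (top_of_set (unit_cube n)) {x \<in> unit_cube n. p x \<in> U}" if "U \<in> K" for U
        using K \<open>(n, p) \<in> A\<close> that by blast
      ultimately show ?thesis by (auto simp only: intro!: openin_Union)
    qed
    then show "\<forall>(n, p)\<in>A. openin (top_of_set (unit_cube n)) {x \<in> unit_cube n. p x \<in> \<Union>K}"
      by blast
  qed
  then show ?thesis
    by (simp only: cc_topology_def topology_inverse')
qed


section \<open>CAT(0) cube complexes\<close>

definition simply_connected_space :: "'a topology \<Rightarrow> bool" where
  "simply_connected_space T \<longleftrightarrow>
     path_connected_space T \<and>
     (\<forall>g. pathin T g \<and> g 1 = g 0 \<longrightarrow>
        homotopic_with (\<lambda>h. h 0 = g 0 \<and> h 1 = g 0) (top_of_set {0..1}) T g (\<lambda>_. g 0))"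

(* The link of the vertex v, as a family of simplices. Its vertices are the edges of X at v,
   and every cube C of positive dimension containing v contributes the simplex formed by the
   edges of C at v. Since cubes meet along single faces, distinct cubes give distinct simplices. *)
definition cc_link :: "(nat \<times> ((nat \<Rightarrow> real) \<Rightarrow> 'a)) set \<Rightarrow> 'a \<Rightarrow> 'a set set set" where
  "cc_link A v = {{e \<in> cubes A 1. v \<in> e \<and> e \<subseteq> C} | C k. C \<in> cubes A k \<and> k > 0 \<and> v \<in> C}"

(* K is the family of nonempty simplices of a simplicial complex. The case e = f of the
   hypothesis says that {e} is a simplex, i.e. that e is a vertex of the complex. *)
definition flag_complex :: "'b set set \<Rightarrow> bool" where
  "flag_complex K \<longleftrightarrow>
     (\<forall>\<sigma>. finite \<sigma> \<and> \<sigma> \<noteq> {} \<and> (\<forall>e\<in>\<sigma>. \<forall>f\<in>\<sigma>. {e, f} \<in> K) \<longrightarrow> \<sigma> \<in> K)"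

(* Gromov's definition, as usual for complexes that may be infinite-dimensional or not locally
   finite: simply connected with flag vertex links. *)
definition CAT0_cube_complex :: "'a set \<Rightarrow> (nat \<times> ((nat \<Rightarrow> real) \<Rightarrow> 'a)) set \<Rightarrow> bool" where
  "CAT0_cube_complex X A \<longleftrightarrow>
     cubical_complex X A \<and>
     simply_connected_space (cc_topology X A) \<and>
     (\<forall>v\<in>cc_vertices A. flag_complex (cc_link A v))"

definition infinite_cube :: "(nat \<times> ((nat \<Rightarrow> real) \<Rightarrow> 'a)) set \<Rightarrow> 'a set \<Rightarrow> bool" where
  "infinite_cube A Q \<longleftrightarrow>
     (\<exists>C :: nat \<Rightarrow> 'a set. (\<forall>n. C n \<in> cubes A n \<and> C n \<subset> C (Suc n)) \<and> Q = (\<Union>n. C n))"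


section \<open>Actions\<close>

definition cubical_map :: "(nat \<times> ((nat \<Rightarrow> real) \<Rightarrow> 'a)) set \<Rightarrow> ('a \<Rightarrow> 'a) \<Rightarrow> bool" where
  "cubical_map A f \<longleftrightarrow>
     (\<forall>(n, p)\<in>A. \<exists>(m, q)\<in>A. \<exists>k F h. is_cube_face m k F \<and> cube_isometry n (unit_cube n) m F h \<and>
        (\<forall>x\<in>unit_cube n. f (p x) = q (h x)))"

definition cc_automorphism ::
  "'a set \<Rightarrow> (nat \<times> ((nat \<Rightarrow> real) \<Rightarrow> 'a)) set \<Rightarrow> ('a \<Rightarrow> 'a) \<Rightarrow> bool" where
  "cc_automorphism X A f \<longleftrightarrow>
     bij_betw f X X \<and> cubical_map A f \<and> cubical_map A (inv_into X f)"

definition cc_action ::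
  "('g, 'm) monoid_scheme \<Rightarrow> 'a set \<Rightarrow> (nat \<times> ((nat \<Rightarrow> real) \<Rightarrow> 'a)) set \<Rightarrow> ('g \<Rightarrow> 'a \<Rightarrow> 'a) \<Rightarrow> bool"
where
  "cc_action G X A \<phi> \<longleftrightarrow>
     group_action G X \<phi> \<and> (\<forall>g\<in>carrier G. cc_automorphism X A (\<phi> g))"

definition elliptic :: "'a set \<Rightarrow> ('a \<Rightarrow> 'a) \<Rightarrow> bool" where
  "elliptic X f \<longleftrightarrow> (\<exists>x\<in>X. f x = x)"

definition finitely_generated_group :: "('g, 'm) monoid_scheme \<Rightarrow> bool" where
  "finitely_generated_group G \<longleftrightarrow>
     group G \<and> (\<exists>S. finite S \<and> S \<subseteq> carrier G \<and> generate G S = carrier G)"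

end

theory Submission
  imports Defs
begin

text \<open>Flagness of the links makes edge paths modulo square flips cancellative, so that reduced paths from a
  base vertex form a local system on the \<open>1\<close>-skeleton. Simple connectivity trivialises its monodromy: reduced
  paths are the geodesics, and any two geodesics with the same ends differ by square flips. It follows that the
  \<open>1\<close>-skeleton is bipartite and satisfies the quadrangle condition; hence hyperplanes cut it into convex
  halfspaces and medians exist.

  Since every group element has a periodic vertex, none maps a halfspace strictly into itself. Finite generation
  gives an invariant convex set \<open>Y\<close> crossed by finitely many orbits of halfspaces; choose one crossed by the
  fewest. Halfspaces that are minimal in \<open>Y\<close> and contain a vertex \<open>v\<close> are adjacent to \<open>v\<close> and pairwise span
  squares, so there are finitely many of them by the absence of infinite cubes. A minimal halfspace with a
  non-minimal complement could be cut off together with its translates, so all halfspaces crossing \<open>Y\<close> are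
  minimal, and \<open>Y\<close> spans a finite invariant cube, whose centre is fixed.\<close>

section \<open>Paths up to squares\<close>

text \<open>The CAT(0) metric never appears; the argument lives on vertices and halfspaces. Topology
  enters once: a null homotopy is compact, so a fine grid puts each cell into the open star of one
  vertex, and a local system compares fibres at any two corners of a cube. Flagness is needed in
  full for finite cliques of edges, but for three edges alone it is the diamond that makes square
  flips confluent.

  Without bounds on dimension or valence, finiteness has three sources: a path has finitely many
  edges, so finitely many halfspaces separate two vertices; finitely many generators bound the
  orbits of halfspaces; and the absence of infinite cubes bounds the minimal halfspaces at one
  vertex.

  An elliptic element may fix no vertex. Its fixed point lies in the open stars of finitely many
  vertices, the corners of one cube, and powers of the element keep such a vertex among them;
  pigeonhole makes it periodic.

  The delicate point of cutting off an orbit is that something must remain. A vertex lies in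
  finitely many of the translates and can leave them one at a time: entering a new one would make it
  the complement of the one just left.\<close>

text \<open>A covering of the square complex, given by fibres and edge transports. Going along an
  edge and back cancels, and the second clause says that squares have no holonomy, so that transport
  is unchanged by square flips of a path.\<close>

definition local_system ::
  "('a \<Rightarrow> 'a \<Rightarrow> bool) \<Rightarrow> ('a \<Rightarrow> 'a \<Rightarrow> 'a \<Rightarrow> 'a \<Rightarrow> bool) \<Rightarrow> ('a \<Rightarrow> 'b set) \<Rightarrow> ('a \<Rightarrow> 'a \<Rightarrow> 'b \<Rightarrow> 'b) \<Rightarrow> bool"
where
  "local_system adj sq R T \<longleftrightarrow>
     (\<forall>u v s. adj u v \<longrightarrow> s \<in> R u \<longrightarrow> T u v s \<in> R v \<and> T v u (T u v s) = s) \<and>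
     (\<forall>a b c d s. sq a b c d \<longrightarrow> s \<in> R a \<longrightarrow> T b c (T a b s) = T d c (T a d s))"

fun transport :: "('a \<Rightarrow> 'a \<Rightarrow> 'b \<Rightarrow> 'b) \<Rightarrow> 'a list \<Rightarrow> 'b \<Rightarrow> 'b" where
  "transport T (x # y # xs) s = transport T (y # xs) (T x y s)"
| "transport T xs s = s"

definition walk :: "('a \<Rightarrow> 'a \<Rightarrow> bool) \<Rightarrow> 'a list \<Rightarrow> 'a \<Rightarrow> 'a \<Rightarrow> bool" where
  "walk adj xs u v \<longleftrightarrow> xs \<noteq> [] \<and> successively adj xs \<and> hd xs = u \<and> last xs = v"

lemma transport_snoc:
  "xs \<noteq> [] \<Longrightarrow> transport T (xs @ [y]) s = T (last xs) y (transport T xs s)"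
  by (induction T xs s rule: transport.induct) auto

lemma transport_in:
  "local_system adj sq R T \<Longrightarrow> walk adj xs u v \<Longrightarrow> s \<in> R u \<Longrightarrow> transport T xs s \<in> R v"
proof (induction T xs s arbitrary: u rule: transport.induct)
  case (1 T x y xs s)
  have "adj x y" "x = u" "walk adj (y # xs) y v" using 1(3) by (auto simp: walk_def)
  then show ?case using 1 by (auto simp: local_system_def)
qed (auto simp: walk_def)

text \<open>The combinatorial interface to the complex: \<open>sq a b c d\<close> lists the corners
  of a square in cyclic order. \<open>sq_unique\<close> reflects that cubes meet in a single face;
  \<open>sq_cube\<close> is the flag condition for three edges at \<open>v\<close>, with
  \<open>t\<close> the corner opposite to \<open>v\<close>.\<close>

locale square_graph =
  fixes V :: "'a set" and adj :: "'a \<Rightarrow> 'a \<Rightarrow> bool" and sq :: "'a \<Rightarrow> 'a \<Rightarrow> 'a \<Rightarrow> 'a \<Rightarrow> bool"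
  assumes adj_sym: "adj u v \<Longrightarrow> adj v u"
    and adj_irrefl: "\<not> adj u u"
    and adj_V: "adj u v \<Longrightarrow> u \<in> V"
    and sq_rot: "sq a b c d \<Longrightarrow> sq b c d a"
    and sq_refl: "sq a b c d \<Longrightarrow> sq a d c b"
    and sq_adj: "sq a b c d \<Longrightarrow> adj a b"
    and sq_neq: "sq a b c d \<Longrightarrow> b \<noteq> d"
    and sq_unique: "sq a b c d \<Longrightarrow> sq a b c d' \<Longrightarrow> d = d'"
    and sq_cube: "sq v a x b \<Longrightarrow> sq v b y c \<Longrightarrow> sq v c z a \<Longrightarrow> \<exists>t. sq b x t y \<and> sq c y t z \<and> sq a z t x"
begin

text \<open>Paths are stored with their end point at the head of the list.\<close>

inductive feq :: "'a list \<Rightarrow> 'a list \<Rightarrow> bool" where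
  feq_refl: "feq p p"
| feq_sq: "sq a b c b' \<Longrightarrow> feq (c # b # a # xs) (c # b' # a # xs)"
| feq_Cons: "feq p q \<Longrightarrow> feq (x # p) (x # q)"
| feq_trans: "feq p q \<Longrightarrow> feq q r \<Longrightarrow> feq p r"

lemma feq_sym: "feq p q \<Longrightarrow> feq q p"
  by (induction rule: feq.induct) (auto intro: feq.intros sq_refl)

lemma feq_length: "feq p q \<Longrightarrow> length p = length q"
  by (induction rule: feq.induct) auto

lemma feq_hd: "feq p q \<Longrightarrow> hd p = hd q"
  by (induction rule: feq.induct) auto

lemma feq_last: "feq p q \<Longrightarrow> last p = last q"
proof (induction rule: feq.induct)
  case (feq_Cons p q x)
  then show ?case using feq_length[of p q] by auto
qed auto

text \<open>The transitivity step uses the induction hypothesis for shorter paths, and the cube condition.\<close>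

lemma feq_exchange_aux:
  assumes "feq p p'" "length p = n" "p \<noteq> []"
  shows "feq (tl p) (tl p') \<or>
    (\<exists>a b a' r. sq (hd p) a b a' \<and> feq (tl p) (a # b # r) \<and> feq (tl p') (a' # b # r))"
  using assms
proof (induction n arbitrary: p p' rule: less_induct)
  case (less n)
  from less.prems show ?case
  proof (induction rule: feq.induct)
    case (feq_refl p)
    then show ?case by (auto intro: feq.intros)
  next
    case (feq_sq a b c b' xs)
    then have "sq c b a b'" by (metis sq_rot sq_refl)
    then have "feq (b # a # xs) (b # a # xs) \<and> feq (b' # a # xs) (b' # a # xs)" by (simp add: feq_refl)
    with \<open>sq c b a b'\<close> show ?case unfolding list.sel by blast
  next
    case (feq_Cons p q x)
    then show ?case by auto
  next
    case (feq_trans p q r)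
    have lq: "length q = n" "q \<noteq> []" "hd q = hd p"
      using feq_trans feq_length[of p q] feq_hd[of p q] by auto
    from feq_trans.IH(1)[OF feq_trans.prems] feq_trans.IH(2)[OF lq(1,2)]
    show ?case
    proof (elim disjE exE conjE)
      assume "feq (tl p) (tl q)" "feq (tl q) (tl r)"
      then show ?thesis using feq.feq_trans by blast
    next
      fix a b a' s assume "feq (tl p) (tl q)" "sq (hd q) a b a'" "feq (tl q) (a # b # s)" "feq (tl r) (a' # b # s)"
      then show ?thesis using feq.feq_trans lq(3) by metis
    next
      fix a b a' s assume "sq (hd p) a b a'" "feq (tl p) (a # b # s)" "feq (tl q) (a' # b # s)" "feq (tl q) (tl r)"
      then show ?thesis using feq.feq_trans feq_sym by metis
    next
      \<comment> \<open>Both equivalences change the edge at the head. The two squares at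
        \<open>v\<close> share the edge to \<open>a1\<close>, and the induction hypothesis applies
        to the tails at \<open>a1\<close>, which are one vertex shorter.\<close>
      fix a b a1 s a1' b' a2 s'
      assume 1: "sq (hd p) a b a1" "feq (tl p) (a # b # s)" "feq (tl q) (a1 # b # s)"
        and 2: "sq (hd q) a1' b' a2" "feq (tl q) (a1' # b' # s')" "feq (tl r) (a2 # b' # s')"
      define v where "v = hd p"
      have [simp]: "a1' = a1" using feq_hd[OF 1(3)] feq_hd[OF 2(2)] by simp
      have e: "feq (a1 # b # s) (a1 # b' # s')" using 1 2 feq_sym feq.feq_trans by (metis \<open>a1' = a1\<close>)
      have "length (a1 # b # s) < n" using feq_length[OF 1(3)] lq(1,2) by (cases q) auto
      from less.IH[OF this e] have
        "feq (b # s) (b' # s') \<or> (\<exists>a b'' a' r. sq a1 a b'' a' \<and> feq (b # s) (a # b'' # r) \<and> feq (b' # s') (a' # b'' # r))"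
        by simp
      then show ?thesis
      proof (elim disjE exE conjE)
        assume f: "feq (b # s) (b' # s')"
        then have [simp]: "b' = b" using feq_hd by force
        have "sq a1 b a2 v" "sq a1 b a v" 
          using 1(1) 2(1) lq(3) unfolding v_def by (metis sq_rot sq_refl \<open>a1' = a1\<close> \<open>b' = b\<close>)+
        have "sq b a1 v a2" "sq b a1 v a" 
          using 1(1) 2(1) lq(3) unfolding v_def by (metis sq_rot sq_refl \<open>a1' = a1\<close> \<open>b' = b\<close>)+
        then have "a = a2" using sq_unique by blast
        have "feq (a # b # s) (a # b' # s')" using f by (rule feq.feq_Cons)
        then have "feq (tl p) (tl r)" using 1(2) 2(3) \<open>a = a2\<close> feq.feq_trans feq_sym by blast
        then show ?thesis by simp
      next
        fix x c x' t
        assume 3: "sq a1 x c x'" "feq (b # s) (x # c # t)" "feq (b' # s') (x' # c # t)"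
        have [simp]: "x = b" "x' = b'" using feq_hd[OF 3(2)] feq_hd[OF 3(3)] by auto
        have "sq a1 v a b" using 1(1) unfolding v_def by (metis sq_rot)
        moreover have "sq a1 b c b'" using 3(1) by simp
        moreover have "sq a1 b' a2 v" using 2(1) lq(3) unfolding v_def by (metis sq_rot \<open>a1' = a1\<close>)
        \<comment> \<open>The neighbours \<open>v\<close>, \<open>b\<close> and \<open>b'\<close> of
          \<open>a1\<close> span squares pairwise. The corner \<open>z\<close> opposite to
          \<open>a1\<close> in the resulting cube reroutes both outer tails, and \<open>v\<close>,
          \<open>a\<close>, \<open>z\<close>, \<open>a2\<close> is the required square.\<close>
        ultimately obtain z where z: "sq b a z c" "sq b' c z a2" "sq v a2 z a"
          using sq_cube by blast
        have "feq (tl p) (a # b # c # t)"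
          using 1(2) 3(2) feq.feq_Cons feq.feq_trans by (metis \<open>x = b\<close>)
        moreover have "feq (a # b # c # t) (a # z # c # t)"
          using z(1) by (intro feq.feq_sq) (metis sq_rot)
        ultimately have A: "feq (tl p) (a # z # c # t)" using feq.feq_trans by blast
        have "feq (tl r) (a2 # b' # c # t)"
          using 2(3) 3(3) feq.feq_Cons feq.feq_trans by (metis \<open>x' = b'\<close>)
        moreover have "feq (a2 # b' # c # t) (a2 # z # c # t)"
          using z(2) by (intro feq.feq_sq) (metis sq_rot sq_refl)
        ultimately have B: "feq (tl r) (a2 # z # c # t)" using feq.feq_trans by blast
        have "sq (hd p) a z a2" using z(3) sq_refl v_def by blast
        with A B show ?thesis by blast
      qed
    qed
  qed
qed

lemma feq_exchange:
  assumes "feq (v # a # q) (v # a' # q')"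
  shows "a = a' \<and> feq (a # q) (a # q') \<or>
    (\<exists>b r. sq v a b a' \<and> feq (a # q) (a # b # r) \<and> feq (a' # q') (a' # b # r))"
proof -
  have "feq (a # q) (a' # q') \<or>
    (\<exists>x b y r. sq v x b y \<and> feq (a # q) (x # b # r) \<and> feq (a' # q') (y # b # r))"
    using feq_exchange_aux[OF assms refl] by simp
  then show ?thesis
  proof (elim disjE exE conjE)
    assume f: "feq (a # q) (a' # q')"
    then show ?thesis using feq_hd[OF f] by simp
  next
    fix x b y r assume f: "sq v x b y" "feq (a # q) (x # b # r)" "feq (a' # q') (y # b # r)"
    then show ?thesis using feq_hd[OF f(2)] feq_hd[OF f(3)] by auto
  qed
qed

text \<open>The second alternative of \<open>feq_exchange\<close> would be a square with equal
  neighbours \<open>a\<close> and \<open>a\<close> of \<open>v\<close>.\<close>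

lemma feq_cancel: "feq (v # a # q) (v # a # q') \<Longrightarrow> feq (a # q) (a # q')"
  using feq_exchange sq_neq by blast

text \<open>Reduced up to flips: prepending \<open>u\<close> is forbidden as soon as any path
  equivalent to the tail arrives from \<open>u\<close>, not only if the tail itself does.\<close>

fun red :: "'a list \<Rightarrow> bool" where
  "red [] = False"
| "red [x] = (x \<in> V)"
| "red (u # v # p) = (adj u v \<and> red (v # p) \<and> (\<nexists>q. feq (v # p) (v # u # q)))"

text \<open>Only a flip at the head needs work. A backtrack that becomes possible after the flip is
  carried through the square, by flipping again or by \<open>feq_exchange\<close>, to a backtrack
  that was possible before.\<close>

lemma red_feq: "feq p q \<Longrightarrow> red p \<Longrightarrow> red q"
proof (induction rule: feq.induct)
  case (feq_sq a b c b' xs)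
  then have r: "adj c b" "adj b a" "red (a # xs)" "\<nexists>q. feq (a # xs) (a # b # q)"
    "\<nexists>q. feq (b # a # xs) (b # c # q)" by auto
  have "adj c b'" "adj b' a" using feq_sq(1) by (metis sq_rot sq_adj)+
  moreover have "\<nexists>q. feq (a # xs) (a # b' # q)"
  proof
    assume "\<exists>q. feq (a # xs) (a # b' # q)"
    then obtain q where "feq (a # xs) (a # b' # q)" by blast
    then have "feq (b # a # xs) (b # a # b' # q)" by (rule feq_Cons)
    moreover have "feq (b # a # b' # q) (b # c # b' # q)"
      using feq_sq(1) by (intro feq.feq_sq) (metis sq_rot)
    ultimately show False using r(5) feq_trans by blast
  qed
  moreover have "\<nexists>q. feq (b' # a # xs) (b' # c # q)"
  proof
    assume "\<exists>q. feq (b' # a # xs) (b' # c # q)"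
    then obtain q where "feq (b' # a # xs) (b' # c # q)" by blast
    from feq_exchange[OF this] show False
    proof (elim disjE exE conjE)
      assume "a = c"
      then show False using feq_sq(1) sq_neq sq_rot by metis
    next
      fix d s assume "sq b' a d c" "feq (a # xs) (a # d # s)"
      then have "sq a b' c d" "sq a b' c b" using feq_sq(1) by (metis sq_rot sq_refl)+
      then show False using r(4) sq_unique \<open>feq (a # xs) (a # d # s)\<close> by blast
    qed
  qed
  ultimately show ?case using r by simp
next
  case (feq_Cons p q x)
  show ?case
  proof (cases p)
    case Nil
    then show ?thesis using feq_Cons feq_length[OF feq_Cons(1)] by simp
  next
    case (Cons v p')
    then obtain q' where q: "q = v # q'"
      using feq_hd[OF feq_Cons(1)] feq_length[OF feq_Cons(1)] by (cases q) auto
    have "\<nexists>r. feq q (v # x # r)" using feq_Cons(1,3) Cons feq_trans by (metis red.simps(3))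
    then show ?thesis using feq_Cons Cons q by simp
  qed
qed auto

lemma red_walk: "red p \<Longrightarrow> successively adj p"
  by (induction p rule: red.induct) auto

section \<open>The local system of classes of reduced paths\<close>

context
  fixes v0 :: 'a
  assumes v0: "v0 \<in> V"
begin

definition cls :: "'a list \<Rightarrow> 'a list set" where "cls p = {q. feq p q}"

lemma cls_eq: "cls p = cls q \<longleftrightarrow> feq p q"
  unfolding cls_def by (auto intro: feq.intros feq_sym)

definition fibre :: "'a \<Rightarrow> 'a list set set" where
  "fibre v = {cls p | p. red p \<and> hd p = v \<and> last p = v0}"

text \<open>Edge transport in the universal cover: cancel the last edge if some representative has
  come from \<open>u\<close>, and append the edge to \<open>u\<close> otherwise. Working with whole
  classes avoids a choice of representatives.\<close>

definition lift :: "'a \<Rightarrow> 'a \<Rightarrow> 'a list set \<Rightarrow> 'a list set" where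
  "lift v u c = (if \<exists>q. v # u # q \<in> c then {r. \<exists>q. v # u # q \<in> c \<and> feq (u # q) r}
              else {r. \<exists>p\<in>c. feq (u # p) r})"

lemma lift_cancel:
  assumes "feq p (v # u # q)" shows "lift v u (cls p) = cls (u # q)"
proof -
  have "feq (u # q) (u # q')" if "feq p (v # u # q')" for q'
    using that assms feq_cancel feq_sym feq_trans by meson
  then show ?thesis using assms unfolding lift_def cls_def by (auto intro: feq_trans)
qed

lemma lift_extend:
  assumes "\<nexists>q. feq p (v # u # q)" shows "lift v u (cls p) = cls (u # p)"
  using assms unfolding lift_def cls_def by (auto intro: feq_trans feq_refl feq_Cons)

text \<open>Cancelling and appending undo each other. The length clause is kept because it later
  yields bipartiteness.\<close>

lemma lift_in_fibre:
  assumes "adj v u" "red p" "hd p = v" "last p = v0"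
  obtains r where "red r" "hd r = u" "last r = v0" "lift v u (cls p) = cls r" "lift u v (cls r) = cls p"
    "length r = Suc (length p) \<or> length p = Suc (length r)"
proof (cases "\<exists>q. feq p (v # u # q)")
  case True
  then obtain q where q: "feq p (v # u # q)" by blast
  have r: "red (v # u # q)" using red_feq[OF q assms(2)] .
  have "lift u v (cls (u # q)) = cls p"
    using lift_extend[of "u # q" u v] r cls_eq q feq_sym by auto
  then show ?thesis
    using that[of "u # q"] lift_cancel[OF q] r feq_last[OF q] assms feq_length[OF q] by auto
next
  case False
  obtain p' where [simp]: "p = v # p'" using assms by (cases p) auto
  show ?thesis
    using that[of "u # p"] lift_extend[OF False] lift_cancel[OF feq_refl, of u v p'] False assms adj_sym by auto
qed

text \<open>The cases are whether the class can be shortened towards \<open>u\<close> and towards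
  \<open>w\<close>. If both, \<open>feq_exchange\<close> puts \<open>x\<close> next on either route;
  if one, a flip interchanges cancelling and appending; if neither, nothing cancels at
  \<open>x\<close> and the two extensions differ by one flip.\<close>

lemma lift_square:
  assumes s: "sq v u x w" and p: "red p" "hd p = v"
  shows "lift u x (lift v u (cls p)) = lift w x (lift v w (cls p))"
proof -
  obtain p' where [simp]: "p = v # p'" using p by (cases p) auto
  have asym: "lift u x (lift v u (cls p)) = lift w x (lift v w (cls p))"
    if s: "sq v u x w" and q: "feq p (v # u # q)" and n: "\<nexists>q. feq p (v # w # q)" for u w q
  proof -
    have "\<nexists>r. feq (u # q) (u # x # r)"
    proof
      assume "\<exists>r. feq (u # q) (u # x # r)"
      then obtain r where "feq (u # q) (u # x # r)" by blast
      then have "feq p (v # u # x # r)" using q feq_Cons feq_trans by blast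
      moreover have "feq (v # u # x # r) (v # w # x # r)"
        using s by (intro feq_sq) (metis sq_rot sq_refl)
      ultimately show False using n feq_trans by blast
    qed
    then have 1: "lift u x (lift v u (cls p)) = cls (x # u # q)"
      using lift_cancel[OF q] lift_extend by auto
    have "feq (w # p) (w # v # u # q)" using q feq_Cons by blast
    moreover have "feq (w # v # u # q) (w # x # u # q)"
      using s by (intro feq_sq) (metis sq_rot sq_refl)
    ultimately have "feq (w # p) (w # x # u # q)" using feq_trans by blast
    then show ?thesis using 1 lift_extend[OF n] lift_cancel by auto
  qed
  have s': "sq v w x u" using s sq_refl by blast
  consider "\<exists>q. feq p (v # u # q)" "\<nexists>q. feq p (v # w # q)"
    | "\<exists>q. feq p (v # w # q)" "\<nexists>q. feq p (v # u # q)"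
    | "\<exists>q. feq p (v # w # q)" "\<exists>q. feq p (v # u # q)"
    | "\<nexists>q. feq p (v # w # q)" "\<nexists>q. feq p (v # u # q)" by blast
  then show ?thesis
  proof cases
    case 1
    then show ?thesis using asym[OF s] by blast
  next
    case 2
    then show ?thesis using asym[OF s'] by metis
  next
    case 3
    then obtain q q' where q: "feq p (v # u # q)" "feq p (v # w # q')" by blast
    then have "feq (v # u # q) (v # w # q')" using feq_trans feq_sym by blast
    from feq_exchange[OF this] obtain b r where b: "sq v u b w" "feq (u # q) (u # b # r)" "feq (w # q') (w # b # r)"
      using sq_neq[OF s] by blast
    have "sq u v w b" "sq u v w x" using b(1) s by (metis sq_rot sq_refl)+
    then have [simp]: "b = x" using sq_unique by blast
    show ?thesis using lift_cancel[OF q(1)] lift_cancel[OF q(2)] lift_cancel[OF b(2)] lift_cancel[OF b(3)] by simp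
  next
    case 4
    have no: "\<nexists>q. feq (u # p) (u # x # q)" if s: "sq v u x w" and n: "\<nexists>q. feq p (v # w # q)" for u w
    proof
      assume "\<exists>q. feq (u # p) (u # x # q)"
      then obtain q where "feq (u # v # p') (u # x # q)" by auto
      from feq_exchange[OF this] show False
      proof (elim disjE exE conjE)
        assume "v = x" then show False using s sq_neq sq_rot by metis
      next
        fix b r assume b: "sq u v b x" "feq (v # p') (v # b # r)"
        have "sq v u x b" using b(1) by (metis sq_rot sq_refl)
        then have "b = w" using s sq_unique by blast
        then show False using n b(2) by auto
      qed
    qed
    have "feq (x # u # v # p') (x # w # v # p')" using s by (rule feq_sq)
    then show ?thesis using lift_extend[OF 4(1)] lift_extend[OF 4(2)] lift_extend[OF no[OF s 4(1)]] lift_extend[OF no[OF s' 4(2)]]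
      by (simp add: cls_eq)
  qed
qed

lemma lift_local_system: "local_system adj sq fibre lift"
  unfolding local_system_def
proof (intro conjI allI impI)
  fix u v s assume "adj u v" "s \<in> fibre u"
  then obtain p where p: "red p" "hd p = u" "last p = v0" "s = cls p" unfolding fibre_def by blast
  obtain r where "red r" "hd r = v" "last r = v0" "lift u v (cls p) = cls r" "lift v u (cls r) = cls p"
    by (rule lift_in_fibre[OF \<open>adj u v\<close> p(1-3)])
  then show "lift u v s \<in> fibre v" "lift v u (lift u v s) = s"
    unfolding fibre_def p(4) by auto
next
  fix a b c d s assume "sq a b c d" "s \<in> fibre a"
  then show "lift b c (lift a b s) = lift d c (lift a d s)" using lift_square unfolding fibre_def by blast
qed

text \<open>Along a reduced path every transport appends, so the trivial class is carried to the
  class of the path itself.\<close>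

lemma transport_red:
  "red p \<Longrightarrow> last p = v0 \<Longrightarrow> transport lift (rev p) (cls [v0]) = cls p"
proof (induction p rule: induct_list012)
  case (3 x y zs)
  have "transport lift (rev (x # y # zs)) (cls [v0]) = lift y x (cls (y # zs))"
    using 3 transport_snoc[of "rev (y # zs)" lift x] by simp
  also have "\<dots> = cls (x # y # zs)" by (rule lift_extend) (use 3 in auto)
  finally show ?case .
qed auto

end

end

section \<open>Distance, bipartiteness and the quadrangle condition\<close>

definition gdist :: "('a \<Rightarrow> 'a \<Rightarrow> bool) \<Rightarrow> 'a \<Rightarrow> 'a \<Rightarrow> nat" where
  "gdist adj u v = (LEAST n. \<exists>xs. walk adj xs u v \<and> length xs = Suc n)"

text \<open>Simple connectivity as path independence of transport. A locale assumption cannot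
  quantify over types, so fibre elements are fixed to be sets of vertex lists, which is the type
  that \<open>fibre\<close> needs.\<close>

locale simply_connected_square_graph = square_graph V adj sq
  for V :: "'a set" and adj sq +
  assumes connected: "u \<in> V \<Longrightarrow> v \<in> V \<Longrightarrow> \<exists>xs. walk adj xs u v"
    and monodromy: "\<And>(R :: 'a \<Rightarrow> 'a list set set) T xs ys u v s. local_system adj sq R T \<Longrightarrow>
      walk adj xs u v \<Longrightarrow> walk adj ys u v \<Longrightarrow> u \<in> V \<Longrightarrow> s \<in> R u \<Longrightarrow> transport T xs s = transport T ys s"
begin

abbreviation "d \<equiv> gdist adj"

lemma walk_rev: "walk adj xs u v \<Longrightarrow> walk adj (rev xs) v u"
  unfolding walk_def using adj_sym by (auto simp: successively_rev hd_rev last_rev elim: successively_mono)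

lemma d_le: "walk adj xs u v \<Longrightarrow> d u v < length xs"
proof -
  assume w: "walk adj xs u v"
  then have "length xs = Suc (length xs - 1)" by (cases xs) (auto simp: walk_def)
  then have "d u v \<le> length xs - 1" unfolding gdist_def using w by (intro Least_le) auto
  then show ?thesis using \<open>length xs = Suc (length xs - 1)\<close> by linarith
qed

lemma d_walk:
  assumes "u \<in> V" "v \<in> V"
  obtains xs where "walk adj xs u v" "length xs = Suc (d u v)"
proof -
  obtain xs where "walk adj xs u v" using connected assms by blast
  moreover then have "length xs = Suc (length xs - 1)" by (cases xs) (auto simp: walk_def)
  ultimately have "\<exists>n. \<exists>xs. walk adj xs u v \<and> length xs = Suc n" by blast
  from LeastI_ex[OF this] show ?thesis using that unfolding gdist_def by blast
qed

lemma d_sym: "u \<in> V \<Longrightarrow> v \<in> V \<Longrightarrow> d u v = d v u"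
proof -
  have "d u v \<le> d v u" if V: "u \<in> V" "v \<in> V" for u v
  proof -
    obtain xs where "walk adj xs v u" "length xs = Suc (d v u)" using d_walk V by blast
    then show ?thesis using d_le[OF walk_rev] by fastforce
  qed
  then show "u \<in> V \<Longrightarrow> v \<in> V \<Longrightarrow> d u v = d v u" by (simp add: le_antisym)
qed

lemma d_triangle:
  assumes "u \<in> V" "v \<in> V" "w \<in> V" shows "d u w \<le> d u v + d v w"
proof -
  obtain xs where xs: "walk adj xs u v" "length xs = Suc (d u v)" using d_walk assms by blast
  obtain ys where ys: "walk adj ys v w" "length ys = Suc (d v w)" using d_walk assms by blast
  have "walk adj (xs @ tl ys) u w"
  proof (cases "tl ys")
    case Nil
    then show ?thesis using xs ys by (cases ys) (auto simp: walk_def)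
  next
    case (Cons y zs)
    then show ?thesis using xs ys by (cases ys) (auto simp: walk_def successively_append_iff)
  qed
  then show ?thesis using d_le[of "xs @ tl ys" u w] xs ys by simp
qed

lemma d_0_iff: "u \<in> V \<Longrightarrow> v \<in> V \<Longrightarrow> d u v = 0 \<longleftrightarrow> u = v"
proof
  assume V: "u \<in> V" "v \<in> V" "d u v = 0"
  then obtain xs where "walk adj xs u v" "length xs = Suc 0" using d_walk by metis
  then show "u = v" by (cases xs) (auto simp: walk_def)
next
  assume "u \<in> V" "v \<in> V" "u = v"
  then show "d u v = 0" using d_le[of "[u]" u v] by (simp add: walk_def)
qed

lemma d_adj: "adj u v \<Longrightarrow> d u v = 1"
proof -
  assume a: "adj u v"
  then have "d u v \<le> 1" using d_le[of "[u, v]" u v] by (simp add: walk_def)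
  moreover have "d u v \<noteq> 0" using a d_0_iff adj_V adj_sym adj_irrefl by metis
  ultimately show ?thesis by simp
qed

lemma d_pred:
  assumes "u \<in> V" "v \<in> V" "d u v = Suc n"
  obtains w where "adj w v" "d u w = n"
proof -
  obtain xs where xs: "walk adj xs v u" "length xs = Suc (Suc n)"
    using d_walk[of v u] assms d_sym by metis
  then obtain w ys where [simp]: "xs = v # w # ys" by (cases xs; cases "tl xs") (auto simp: walk_def)
  have w: "walk adj (w # ys) w u" "adj v w" using xs by (auto simp: walk_def)
  have wV: "w \<in> V" using w adj_sym adj_V by blast
  have "d w u \<le> n" using d_le[OF w(1)] xs by simp
  moreover have "d u v \<le> d u w + d w v" using d_triangle assms wV by blast
  ultimately have "d u w = n" using d_adj[OF w(2)] d_sym[of w v] d_sym[of w u] assms wV by simp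
  then show ?thesis using that w(2) adj_sym by blast
qed

text \<open>If flips could create a backtrack, deleting it would leave a walk between the same ends
  that is shorter by two.\<close>

lemma geodesic_red:
  assumes "u \<in> V" "v \<in> V" "walk adj p v u" "length p = Suc (d u v)"
  shows "red p"
  using assms
proof (induction p arbitrary: v rule: induct_list012)
  case (3 x y zs)
  have [simp]: "x = v" using 3 by (auto simp: walk_def)
  have w: "walk adj (y # zs) y u" "adj v y" "y \<in> V" using 3 adj_V adj_sym by (auto simp: walk_def)
  have "d u v \<le> d u y + 1" using d_triangle[of u y v] d_adj[of y v] w 3 adj_sym by auto
  moreover have "d u y < length (y # zs)" using d_le[OF w(1)] d_sym[of u y] 3 w by simp
  ultimately have l: "length (y # zs) = Suc (d u y)" using 3 by simp
  then have "red (y # zs)" using "3.IH"(2)[OF \<open>u \<in> V\<close> w(3,1)] by simp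
  moreover have "\<nexists>q. feq (y # zs) (y # v # q)"
  proof
    assume "\<exists>q. feq (y # zs) (y # v # q)"
    then obtain q where q: "feq (y # zs) (y # v # q)" by blast
    then have "red (y # v # q)" using red_feq \<open>red (y # zs)\<close> by blast
    then have "walk adj (v # q) v u"
      using red_walk feq_last[OF q] 3 by (auto simp: walk_def)
    then have "d u v < length (v # q)" using d_le d_sym 3 by metis
    then show False using feq_length[OF q] 3 by simp
  qed
  ultimately show ?case using w by simp
qed (auto simp: walk_def)

text \<open>Traversed from their common base vertex, both paths transport the trivial class to their
  own class; trivial monodromy makes the results equal.\<close>

lemma red_unique:
  assumes "red p" "red q" "hd p = hd q" "last p = last q" shows "feq p q"
proof -
  let ?v = "last p"
  have V: "?v \<in> V" using assms(1)
    by (induction p rule: red.induct) auto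
  have "p \<noteq> []" "q \<noteq> []" using assms(1,2) by auto
  then have "walk adj p (hd p) ?v" "walk adj q (hd p) ?v"
    using assms red_walk by (auto simp: walk_def)
  then have w: "walk adj (rev p) ?v (hd p)" "walk adj (rev q) ?v (hd p)"
    by (auto intro: walk_rev)
  have "cls [?v] \<in> fibre ?v ?v" unfolding fibre_def[OF V] using V by (auto intro!: exI[of _ "[?v]"])
  from monodromy[OF lift_local_system[OF V] w V this]
  show ?thesis using transport_red[OF V assms(1)] transport_red[OF V assms(2)] assms(4) cls_eq[OF V] by simp
qed

text \<open>Lifting a geodesic along the edge gives a reduced path whose length differs by exactly
  one. By \<open>red_unique\<close> it is as long as a geodesic to \<open>v\<close>.\<close>

lemma bipartite:
  assumes "x \<in> V" "adj u v" shows "d x u = Suc (d x v) \<or> d x v = Suc (d x u)"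
proof -
  have V: "u \<in> V" "v \<in> V" using assms adj_V adj_sym by blast+
  obtain p where p: "walk adj p u x" "length p = Suc (d x u)" using d_walk[OF V(1) assms(1)] d_sym V assms by metis
  have rp: "red p" using geodesic_red assms V p by blast
  have hp: "hd p = u" "last p = x" using p by (auto simp: walk_def)
  from lift_in_fibre[OF assms(1,2) rp hp] obtain r where
    r: "red r" "hd r = v" "last r = x" "length r = Suc (length p) \<or> length p = Suc (length r)" by metis
  obtain q where q: "walk adj q v x" "length q = Suc (d x v)" using d_walk[OF V(2) assms(1)] d_sym V assms by metis
  have "red q" using geodesic_red assms V q by blast
  then have "length q = length r" using red_unique[of q r] r q feq_length by (simp add: walk_def)
  then show ?thesis using r p q by auto
qed

text \<open>Geodesics through \<open>a\<close> and through \<open>a'\<close> extend to two geodesics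
  ending at \<open>v\<close>. They are equivalent by \<open>red_unique\<close> and end with
  different edges, so \<open>feq_exchange\<close> produces the square.\<close>

lemma quadrangle:
  assumes x: "x \<in> V" and a: "adj v a" "adj v a'" "a \<noteq> a'"
    and d: "d x v = Suc n" "d x a = n" "d x a' = n"
  obtains b where "sq v a b a'" "Suc (d x b) = n"
proof -
  have V: "v \<in> V" "a \<in> V" "a' \<in> V" using a adj_V adj_sym by blast+
  obtain p where p: "walk adj p a x" "length p = Suc n" using d_walk[OF V(2) x] d_sym V x d by metis
  obtain p' where p': "walk adj p' a' x" "length p' = Suc n" using d_walk[OF V(3) x] d_sym V x d by metis
  have w: "walk adj (v # p) v x" "walk adj (v # p') v x" using p p' a by (auto simp: walk_def successively_Cons)
  have r: "red (v # p)" "red (v # p')" using geodesic_red[OF x V(1)] w p p' d by auto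
  have f: "feq (v # p) (v # p')" by (rule red_unique[OF r]) (use p p' in \<open>auto simp: walk_def\<close>)
  obtain q q' where [simp]: "p = a # q" "p' = a' # q'"
    using p p' by (cases p; cases p') (auto simp: walk_def)
  from feq_exchange[of v a q a' q'] f a obtain b s where b: "sq v a b a'" "feq (a # q) (a # b # s)" by auto
  have "red (a # b # s)" using red_feq[OF b(2)] r(1) by simp
  then have "walk adj (b # s) b x" using red_walk feq_last[OF b(2)] p by (auto simp: walk_def)
  then have "d x b < length (b # s)" using d_le d_sym x sq_adj[OF sq_rot[OF sq_rot[OF b(1)]]] adj_V by metis
  then have "Suc (d x b) \<le> n" using feq_length[OF b(2)] p by simp
  moreover have "d x a = Suc (d x b) \<or> d x b = Suc (d x a)"
    using bipartite[OF x] sq_adj[OF sq_rot[OF b(1)]] by blast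
  ultimately show ?thesis using that b(1) d by force
qed

end

section \<open>Halfspaces\<close>

context simply_connected_square_graph
begin

definition half :: "'a \<Rightarrow> 'a \<Rightarrow> 'a set" where
  "half a b = {x \<in> V. d x a < d x b}"

definition halves :: "'a set set" where
  "halves = {half a b | a b. adj a b}"

lemma adj_V2: "adj u v \<Longrightarrow> v \<in> V"
  using adj_sym adj_V by blast

lemma half_sub: "half a b \<subseteq> V"
  unfolding half_def by auto

lemma halves_sub: "h \<in> halves \<Longrightarrow> h \<subseteq> V"
  unfolding halves_def using half_sub by auto

lemma compl_half: "adj a b \<Longrightarrow> V - half a b = half b a"
  unfolding half_def using bipartite[of _ a b] by force

lemma compl_halves: "h \<in> halves \<Longrightarrow> V - h \<in> halves"
  unfolding halves_def using compl_half adj_sym by blast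

lemma half_base:
  assumes a: "adj a b"
  shows "a \<in> half a b" "b \<notin> half a b"
proof -
  have "a \<in> V" "b \<in> V" "d a a = 0" "d b b = 0" "d a b = 1" "d b a = 1"
    using a adj_V adj_V2 d_0_iff d_adj adj_sym by auto
  then show "a \<in> half a b" "b \<notin> half a b" unfolding half_def by auto
qed

lemma sq_variants:
  assumes "sq a b c e"
  shows "sq b c e a" "sq c e a b" "sq e a b c" "sq a e c b" "sq e c b a" "sq c b a e" "sq b a e c"
    "adj a b" "adj b c" "adj c e" "adj e a"
proof -
  show 1: "sq b c e a" using assms sq_rot by simp
  show 2: "sq c e a b" using 1 sq_rot by simp
  show 3: "sq e a b c" using 2 sq_rot by simp
  show "sq a e c b" "sq e c b a" "sq c b a e" "sq b a e c"
    using assms 1 2 3 sq_refl by simp_all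
  show "adj a b" "adj b c" "adj c e" "adj e a" using assms 1 2 3 sq_adj by simp_all
qed

text \<open>A vertex \<open>x\<close> in the first halfspace but not in the second is nearer to both
  \<open>a\<close> and \<open>c\<close> than to \<open>b\<close>. The quadrangle condition at
  \<open>b\<close> then gives a fourth corner nearer to \<open>x\<close> than \<open>a\<close>; it
  must be \<open>e\<close>, which is farther.\<close>

lemma half_sq_subset:
  assumes "sq a b c e" shows "half a b \<subseteq> half e c"
proof
  fix x assume "x \<in> half a b"
  have adj: "adj a b" "adj b c" "adj c e" "adj e a" using sq_variants[OF assms] by simp_all
  have x: "x \<in> V" "d x a < d x b" using \<open>x \<in> half a b\<close> unfolding half_def by auto
  show "x \<in> half e c"
  proof (rule ccontr)
    assume "x \<notin> half e c"
    then have "\<not> d x e < d x c" using x unfolding half_def by auto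
    then have n: "d x b = Suc (d x a)" "d x c = d x a" "d x e = Suc (d x a)"
      using x(2) bipartite[OF x(1) adj(1)] bipartite[OF x(1) adj(2)] bipartite[OF x(1) adj(3)] bipartite[OF x(1) adj(4)]
      by arith+
    have "a \<noteq> c" using sq_neq[OF sq_variants(1)[OF assms]] by simp
    obtain f where f: "sq b a f c" "Suc (d x f) = d x a"
      using quadrangle[OF x(1) adj_sym[OF adj(1)] adj(2) \<open>a \<noteq> c\<close> n(1) refl n(2)] by metis
    have "sq a b c f" using sq_variants[OF f(1)] by simp
    then have "f = e" using assms sq_unique by blast
    then show False using f n by simp
  qed
qed

lemma half_sq: "sq a b c e \<Longrightarrow> half a b = half e c"
  using half_sq_subset sq_variants(5) by (metis subset_antisym)

text \<open>Induction on the distance from \<open>c\<close> to \<open>a\<close>. Step from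
  \<open>e\<close> to \<open>e'\<close> on a geodesic towards \<open>b\<close>; the quadrangle
  condition seen from \<open>a\<close> completes \<open>c\<close>, \<open>e\<close>,
  \<open>e'\<close> to a square, whose opposite edge from \<open>f\<close> to \<open>e'\<close>
  crosses the same boundary closer to the edge from \<open>a\<close> to \<open>b\<close>.\<close>

lemma half_edge:
  assumes "adj a b" "adj c e" "c \<in> half a b" "e \<notin> half a b"
  shows "half c e = half a b"
  using assms
proof (induction "d c a" arbitrary: c e)
  case (0 c e)
  have V: "a \<in> V" "b \<in> V" "c \<in> V" "e \<in> V" using 0 adj_V adj_V2 by blast+
  have "c = a" using 0 d_0_iff V by simp
  have "d e b < d e a" using 0 bipartite[OF V(4) \<open>adj a b\<close>] V unfolding half_def by auto
  then have "d e b = 0" using d_adj[of c e] d_sym[of e c] \<open>c = a\<close> V \<open>adj c e\<close> by simp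
  then show ?case using \<open>c = a\<close> d_0_iff V by simp
next
  case (Suc m c e)
  have V: "a \<in> V" "b \<in> V" "c \<in> V" "e \<in> V" using Suc.prems adj_V adj_V2 by blast+
  have ca: "d a c = Suc m" using Suc.hyps(2) d_sym V by simp
  have cb: "d b c = Suc (Suc m)"
    using Suc.prems(3) bipartite[OF V(3) \<open>adj a b\<close>] Suc.hyps(2) d_sym[of b c] V unfolding half_def by auto
  have "d e b < d e a" using Suc.prems(4) bipartite[OF V(4) \<open>adj a b\<close>] V unfolding half_def by auto
  then have e: "d a e = Suc (Suc m)" "d b e = Suc m"
    using bipartite[OF V(4) \<open>adj a b\<close>] bipartite[OF V(1) \<open>adj c e\<close>] bipartite[OF V(2) \<open>adj c e\<close>] ca cb
      d_sym[OF V(4,1)] d_sym[OF V(4,2)] by arith+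
  obtain e' where e': "adj e' e" "d b e' = m" using d_pred[OF V(2,4) e(2)] by metis
  have V': "e' \<in> V" using e' adj_V by blast
  have "d a e' \<le> Suc m" using d_triangle[OF V(1,2) V'] d_adj[OF \<open>adj a b\<close>] e'(2) by simp
  then have ae': "d a e' = Suc m" using bipartite[OF V(1) e'(1)] e by auto
  have "c \<noteq> e'" using e' cb by auto
  obtain f where f: "sq e c f e'" "d a f = m"
    using quadrangle[OF V(1) adj_sym[OF \<open>adj c e\<close>] adj_sym[OF e'(1)] \<open>c \<noteq> e'\<close> e(1) ca ae'] by auto
  have adj: "adj f e'" "adj c f" using sq_variants[OF f(1)] by simp_all
  have Vf: "f \<in> V" using adj adj_V by blast
  have "f \<in> half a b"
    using bipartite[OF V(2) adj(2)] cb f(2) Vf V d_sym unfolding half_def by auto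
  moreover have "e' \<notin> half a b" using ae' e' V V' d_sym unfolding half_def by auto
  moreover have "m = d f a" using f(2) d_sym V Vf by simp
  ultimately have "half f e' = half a b" using Suc.hyps(1) adj(1) \<open>adj a b\<close> by blast
  moreover have "sq c e e' f" using sq_variants[OF f(1)] by simp
  ultimately show ?case using half_sq by blast
qed

lemma halves_boundary: "h \<in> halves \<Longrightarrow> adj c e \<Longrightarrow> c \<in> h \<Longrightarrow> e \<notin> h \<Longrightarrow> h = half c e"
  unfolding halves_def using half_edge by blast

lemma walk_cross:
  "walk adj xs u v \<Longrightarrow> u \<in> h \<Longrightarrow> v \<notin> h \<Longrightarrow>
    \<exists>c e. adj c e \<and> c \<in> set xs \<and> e \<in> set xs \<and> c \<in> h \<and> e \<notin> h"
proof (induction xs arbitrary: u rule: induct_list012)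
  case (3 x y zs)
  then have "adj x y" "x = u" "walk adj (y # zs) y v" by (auto simp: walk_def)
  then show ?case using 3 by (cases "y \<in> h") (auto, blast)
qed (auto simp: walk_def)

text \<open>Every separating halfspace is bounded by an edge of one fixed path between the vertices,
  and that edge determines it.\<close>

lemma finite_separating:
  assumes "u \<in> V" "v \<in> V" shows "finite {h \<in> halves. (u \<in> h) \<noteq> (v \<in> h)}"
proof -
  have "finite {h \<in> halves. u \<in> h \<and> v \<notin> h}" if V: "u \<in> V" "v \<in> V" for u v
  proof -
    obtain xs where "walk adj xs u v" using connected V by blast
    have "h \<in> (\<lambda>(c, e). half c e) ` (set xs \<times> set xs)" if h: "h \<in> halves" "u \<in> h" "v \<notin> h" for h
    proof -
      obtain c e where "adj c e" "c \<in> set xs" "e \<in> set xs" "c \<in> h" "e \<notin> h"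
        using walk_cross[OF \<open>walk adj xs u v\<close> h(2,3)] by blast
      then show ?thesis using halves_boundary[OF h(1)] by (intro image_eqI[of _ _ "(c, e)"]) auto
    qed
    then have "{h \<in> halves. u \<in> h \<and> v \<notin> h} \<subseteq> (\<lambda>(c, e). half c e) ` (set xs \<times> set xs)" by blast
    then show ?thesis by (rule finite_subset) auto
  qed
  from this[OF assms] this[OF assms(2,1)] have "finite ({h \<in> halves. u \<in> h \<and> v \<notin> h} \<union> {h \<in> halves. v \<in> h \<and> u \<notin> h})"
    by blast
  then show ?thesis by (rule rev_finite_subset) auto
qed

lemma geodesic_cross:
  assumes "x \<in> V" "z \<in> V" "x \<in> h" "z \<notin> h"
  shows "\<exists>c e. adj c e \<and> c \<in> h \<and> e \<notin> h \<and> d x c + 1 + d e z = d x z"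
  using assms
proof (induction "d x z" arbitrary: z)
  case 0
  then show ?case using d_0_iff by auto
next
  case (Suc n)
  obtain w where w: "adj w z" "d x w = n" using d_pred Suc by metis
  have wV: "w \<in> V" using w adj_V by blast
  show ?case
  proof (cases "w \<in> h")
    case True
    then show ?thesis using w Suc d_0_iff by (intro exI[of _ w] exI[of _ z]) auto
  next
    case False
    then obtain c e where ce: "adj c e" "c \<in> h" "e \<notin> h" "d x c + 1 + d e w = d x w"
      using Suc(1)[of w] w wV Suc by blast
    have V: "c \<in> V" "e \<in> V" using ce adj_V adj_V2 by blast+
    have "d e z \<le> d e w + 1" using d_triangle[OF V(2) wV \<open>z \<in> V\<close>] d_adj[OF w(1)] by simp
    moreover have "d x z \<le> d x c + d c z" "d c z \<le> 1 + d e z"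
      using d_triangle d_adj[OF ce(1)] V Suc by metis+
    ultimately show ?thesis using ce w Suc(2) by (intro exI[of _ c] exI[of _ e]) auto
  qed
qed

section \<open>Convexity, medians and gates\<close>

definition conv :: "'a set \<Rightarrow> bool" where
  "conv Y \<longleftrightarrow> Y \<subseteq> V \<and> (\<forall>x\<in>Y. \<forall>y\<in>Y. \<forall>z\<in>V. d x z + d z y = d x y \<longrightarrow> z \<in> Y)"

lemma conv_sub: "conv Y \<Longrightarrow> Y \<subseteq> V"
  unfolding conv_def by (rule conjunct1)

lemma conv_D: "conv Y \<Longrightarrow> x \<in> Y \<Longrightarrow> y \<in> Y \<Longrightarrow> z \<in> V \<Longrightarrow> d x z + d z y = d x y \<Longrightarrow> z \<in> Y"
  unfolding conv_def by blast

lemma conv_Int: "conv Y \<Longrightarrow> conv Z \<Longrightarrow> conv (Y \<inter> Z)"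
  unfolding conv_def by blast

text \<open>If \<open>z\<close> between \<open>x\<close> and \<open>y\<close> were outside
  \<open>h\<close>, a geodesic from \<open>x\<close> to \<open>z\<close> would leave
  \<open>h\<close> by an edge from \<open>c\<close> to \<open>e\<close>. As \<open>y\<close> is
  nearer to \<open>c\<close> than to \<open>e\<close>, a route from \<open>c\<close> straight to
  \<open>y\<close> would beat the geodesic through \<open>z\<close>.\<close>

lemma conv_halves:
  assumes "h \<in> halves" shows "conv h"
  unfolding conv_def
proof (intro conjI ballI impI)
  show "h \<subseteq> V" using assms halves_sub by blast
  fix x y z assume x: "x \<in> h" "y \<in> h" "z \<in> V" "d x z + d z y = d x y"
  then have V: "x \<in> V" "y \<in> V" using \<open>h \<subseteq> V\<close> by auto
  show "z \<in> h"
  proof (rule ccontr)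
    assume "z \<notin> h"
    then obtain c e where ce: "adj c e" "c \<in> h" "e \<notin> h" "d x c + 1 + d e z = d x z"
      using geodesic_cross[OF V(1) x(3) x(1)] by blast
    have V': "c \<in> V" "e \<in> V" using ce adj_V adj_V2 by blast+
    have "y \<in> half c e" using halves_boundary[OF assms ce(1-3)] x by simp
    then have "d y c < d y e" unfolding half_def by simp
    moreover have "d x y \<le> d x c + d c y" "d e y \<le> d e z + d z y" using d_triangle V V' x by auto
    ultimately show False using ce(4) x(4) d_sym[of y c] d_sym[of y e] V V' by simp
  qed
qed

text \<open>Step from \<open>v\<close> to a neighbour \<open>w\<close> towards \<open>y\<close>;
  this moves away from \<open>x\<close>. A common descent \<open>a\<close> at \<open>w\<close> would
  give, by the quadrangle condition seen from \<open>x\<close>, a common descent \<open>b\<close> at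
  \<open>v\<close>. So the hypothesis passes on to \<open>w\<close>, until \<open>y\<close> is
  reached.\<close>

lemma between_if_no_common_descent:
  assumes "x \<in> V" "y \<in> V" "v \<in> V" "\<And>a. adj a v \<Longrightarrow> \<not> (d x a < d x v \<and> d y a < d y v)"
  shows "d x y = d x v + d v y"
  using assms(3,4)
proof (induction "d y v" arbitrary: v)
  case 0
  then show ?case using d_0_iff assms by auto
next
  case (Suc m)
  obtain w where w: "adj w v" "d y w = m" using d_pred[OF assms(2) Suc(3)] Suc(2) by metis
  have wV: "w \<in> V" using w adj_V by blast
  have xw: "d x w = Suc (d x v)" using bipartite[OF assms(1) w(1)] Suc w by fastforce
  have "d x y = d x w + d w y"
  proof (rule Suc(1)[OF w(2)[symmetric] wV])
    fix a assume a: "adj a w"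
    show "\<not> (d x a < d x w \<and> d y a < d y w)"
    proof
      assume l: "d x a < d x w \<and> d y a < d y w"
      then have "a \<noteq> v" using w Suc by auto
      have xa: "d x a = d x v" using bipartite[OF assms(1) a] l xw by auto
      obtain b where b: "sq w a b v" "Suc (d x b) = d x v"
        using quadrangle[OF assms(1) adj_sym[OF a] w(1) \<open>a \<noteq> v\<close> xw xa refl] by blast
      have adj: "adj b v" "adj a b" using sq_variants[OF b(1)] by simp_all
      have V: "a \<in> V" "b \<in> V" using adj adj_V by blast+
      have "d y b \<le> d y a + 1" using d_triangle[OF assms(2) V] d_adj[OF adj(2)] by simp
      then have "d y b < d y v" using l w Suc by simp
      then show False using Suc(4)[OF adj(1)] b by simp
    qed
  qed
  then show ?case using xw w Suc(2) d_sym assms wV Suc(3) by simp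
qed

text \<open>Descend from \<open>v\<close> as long as some neighbour is nearer to both
  \<open>x\<close> and \<open>y\<close>. Each step follows geodesics to both, and where descent
  stops the previous lemma applies.\<close>

lemma median:
  assumes "x \<in> V" "y \<in> V" "v \<in> V"
  shows "\<exists>m\<in>V. d v m + d m x = d v x \<and> d v m + d m y = d v y \<and> d x m + d m y = d x y"
  using \<open>v \<in> V\<close>
proof (induction "d v x" arbitrary: v rule: less_induct)
  case less
  show ?case
  proof (cases "\<exists>a. adj a v \<and> d x a < d x v \<and> d y a < d y v")
    case False
    then have "d x y = d x v + d v y" using between_if_no_common_descent[OF assms(1,2) less(2)] by blast
    then show ?thesis using less(2) d_0_iff[of v v] by (intro bexI[of _ v]) auto
  next
    case True
    then obtain a where a: "adj a v" "d x a < d x v" "d y a < d y v" by blast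
    have aV: "a \<in> V" using a adj_V by blast
    have "d a x < d v x" using a(2) d_sym[OF assms(1) aV] d_sym[OF assms(1) less(2)] by simp
    from less(1)[OF this aV] obtain m where m: "m \<in> V" "d a m + d m x = d a x" "d a m + d m y = d a y" "d x m + d m y = d x y"
      by (elim bexE conjE)
    have "d v m \<le> 1 + d a m" using d_triangle[OF less(2) aV m(1)] d_adj[OF adj_sym[OF a(1)]] by simp
    moreover have "d v x \<le> d v m + d m x" "d v y \<le> d v m + d m y" using d_triangle assms less(2) m(1) by auto
    moreover have "d v x = Suc (d a x)"
      using bipartite[OF assms(1) a(1)] a(2) d_sym[OF assms(1) aV] d_sym[OF assms(1) less(2)] by simp
    moreover have "d v y = Suc (d a y)"
      using bipartite[OF assms(2) a(1)] a(3) d_sym[OF assms(2) aV] d_sym[OF assms(2) less(2)] by simp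
    ultimately have "d v m + d m x = d v x \<and> d v m + d m y = d v y" using m by linarith
    then show ?thesis using m by blast
  qed
qed

text \<open>The median of \<open>v\<close>, \<open>x\<close> and \<open>y\<close> lies in
  \<open>K\<close> by convexity and on a geodesic from \<open>v\<close> to \<open>x\<close>. Since
  \<open>x\<close> is nearest to \<open>v\<close>, the median is \<open>x\<close>.\<close>

lemma gate:
  assumes "conv K" "v \<in> V" "x \<in> K" "\<And>z. z \<in> K \<Longrightarrow> d v x \<le> d v z" "y \<in> K"
  shows "d v y = d v x + d x y"
proof -
  have V: "x \<in> V" "y \<in> V" using conv_sub[OF assms(1)] assms(3,5) by blast+
  from median[OF V assms(2)] obtain m where m: "m \<in> V" "d v m + d m x = d v x" "d v m + d m y = d v y" "d x m + d m y = d x y"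
    by (elim bexE conjE)
  have "d v x \<le> d v m" by (rule assms(4)[OF conv_D[OF assms(1,3,5) m(1,4)]])
  then have "d m x = 0" using m(2) by linarith
  then have "m = x" using d_0_iff[OF m(1) V(1)] by simp
  then show ?thesis using m(3) by simp
qed

text \<open>Let \<open>x\<close> be a vertex of \<open>Y\<close> outside \<open>h\<close> nearest to
  \<open>v\<close>, and \<open>w\<close> the first step from \<open>v\<close> towards it. If
  \<open>w\<close> is outside \<open>h\<close>, this step crosses the boundary of \<open>h\<close>.
  Otherwise \<open>half v w\<close> is the smaller halfspace: by \<open>gate\<close>, all vertices
  of \<open>Y\<close> outside \<open>h\<close> are reached from \<open>v\<close> through
  \<open>x\<close>, hence are nearer to \<open>w\<close>, while \<open>w\<close> itself lies in
  \<open>h\<close>.\<close>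

lemma adjacent_or_smaller:
  assumes Y: "conv Y" and v: "v \<in> Y" "v \<in> h" and h: "h \<in> halves" "\<not> Y \<subseteq> h"
  obtains x where "x \<in> Y" "adj v x" "h = half v x"
    | k where "k \<in> halves" "v \<in> k" "k \<inter> Y \<subset> h \<inter> Y" "\<not> Y \<subseteq> k"
proof -
  have YV: "Y \<subseteq> V" using Y conv_def by auto
  define K where "K = Y \<inter> (V - h)"
  have K: "conv K" unfolding K_def using Y h conv_Int conv_halves compl_halves by blast
  have "\<exists>z. z \<in> K" using h YV unfolding K_def by auto
  then obtain x where x: "x \<in> K" "\<And>z. z \<in> K \<Longrightarrow> d v x \<le> d v z"
    using ex_has_least_nat[of "\<lambda>z. z \<in> K" _ "d v"] by blast
  have V: "v \<in> V" "x \<in> V" "x \<in> Y" "x \<notin> h" using v YV x K_def by auto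
  have "x \<noteq> v" using V v by auto
  then obtain n where n: "d x v = Suc n" using d_0_iff V by (cases "d x v") auto
  obtain w where w: "adj w v" "d x w = n" using d_pred[OF V(2,1) n] by blast
  have wV: "w \<in> V" using w adj_V by blast
  have "d x w + d w v = d x v" using w n d_adj[OF w(1)] by simp
  then have "w \<in> Y" using conv_D[OF Y V(3) v(1) wV] by simp
  show thesis
  proof (cases "w \<in> h")
    case False
    then have "h = half v w" using halves_boundary h w adj_sym v by blast
    then show ?thesis using that(1)[OF \<open>w \<in> Y\<close>] w adj_sym by blast
  next
    case True
    have wk: "w \<notin> half v w" "v \<in> half v w" using half_base adj_sym w by blast+
    have "half v w \<inter> Y \<subseteq> h \<inter> Y"
    proof (rule ccontr)
      assume "\<not> half v w \<inter> Y \<subseteq> h \<inter> Y"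
      then obtain y where y: "y \<in> half v w" "y \<in> K" using YV unfolding K_def by blast
      have yV: "y \<in> V" using y half_sub by blast
      have "d v y = d v x + d x y" using gate[OF K V(1) x y(2)] .
      moreover have "d w y \<le> d w x + d x y" using d_triangle wV V yV by blast
      moreover have "d y v < d y w" using y(1) unfolding half_def by simp
      ultimately show False using n w(2) d_sym[OF V(1,2)] d_sym[OF wV V(2)] d_sym[OF yV V(1)] d_sym[OF yV wV] by linarith
    qed
    moreover have "half v w \<in> halves" unfolding halves_def using w adj_sym by blast
    ultimately show ?thesis using that(2)[of "half v w"] True wk \<open>w \<in> Y\<close> by blast
  qed
qed

end

section \<open>Group actions without descending halfspaces\<close>

text \<open>The hypotheses of the theorem as seen by vertices: \<open>periodic\<close> is what
  remains of ellipticity when the fixed point is not a vertex, and \<open>no_infinite_clique\<close>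
  is the absence of infinite cubes at \<open>v\<close>.\<close>

locale square_graph_action = simply_connected_square_graph V adj sq + group G
  for V :: "'a set" and adj sq and G :: "('g, 'm) monoid_scheme" (structure) +
  fixes \<phi> :: "'g \<Rightarrow> 'a \<Rightarrow> 'a"
  assumes act_V: "g \<in> carrier G \<Longrightarrow> x \<in> V \<Longrightarrow> \<phi> g x \<in> V"
    and act_mult: "g \<in> carrier G \<Longrightarrow> k \<in> carrier G \<Longrightarrow> x \<in> V \<Longrightarrow> \<phi> (g \<otimes> k) x = \<phi> g (\<phi> k x)"
    and act_one: "x \<in> V \<Longrightarrow> \<phi> \<one> x = x"
    and act_adj: "g \<in> carrier G \<Longrightarrow> adj x y \<Longrightarrow> adj (\<phi> g x) (\<phi> g y)"
    and V_nonempty: "V \<noteq> {}"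
    and periodic: "g \<in> carrier G \<Longrightarrow> \<exists>u\<in>V. \<exists>n>0. \<phi> (g [^] (n::nat)) u = u"
    and no_infinite_clique: "v \<in> V \<Longrightarrow> (\<And>a. a \<in> N \<Longrightarrow> adj v a) \<Longrightarrow>
      (\<And>a b. a \<in> N \<Longrightarrow> b \<in> N \<Longrightarrow> a \<noteq> b \<Longrightarrow> \<exists>c. sq v a c b) \<Longrightarrow> finite N"
    and finitely_generated: "\<exists>S. finite S \<and> S \<subseteq> carrier G \<and> generate G S = carrier G"
begin

lemma act_inv [simp]:
  assumes "g \<in> carrier G" "x \<in> V"
  shows "\<phi> g (\<phi> (inv g) x) = x" "\<phi> (inv g) (\<phi> g x) = x"
  using act_mult[of g "inv g" x] act_mult[of "inv g" g x] assms act_one[OF assms(2)] by simp_all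

lemma act_inj: "g \<in> carrier G \<Longrightarrow> inj_on (\<phi> g) V"
  by (rule inj_on_inverseI) (rule act_inv(2))

lemma act_walk:
  assumes "g \<in> carrier G" "walk adj xs u v" shows "walk adj (map (\<phi> g) xs) (\<phi> g u) (\<phi> g v)"
proof -
  have "successively (\<lambda>x y. adj (\<phi> g x) (\<phi> g y)) xs"
    by (rule successively_mono[of adj]) (use assms(2) act_adj[OF assms(1)] in \<open>auto simp: walk_def\<close>)
  then show ?thesis using assms(2) by (auto simp: walk_def successively_map hd_map last_map)
qed

lemma act_d:
  assumes g: "g \<in> carrier G" and V: "x \<in> V" "y \<in> V" shows "d (\<phi> g x) (\<phi> g y) = d x y"
proof -
  have le: "d (\<phi> g x) (\<phi> g y) \<le> d x y" if g: "g \<in> carrier G" and V: "x \<in> V" "y \<in> V" for g x y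
  proof -
    obtain xs where xs: "walk adj xs x y" "length xs = Suc (d x y)" using d_walk V by blast
    show ?thesis using d_le[OF act_walk[OF g xs(1)]] xs by simp
  qed
  have "d x y \<le> d (\<phi> g x) (\<phi> g y)"
    using le[of "inv g" "\<phi> g x" "\<phi> g y"] act_V[OF g] act_inv(2)[OF g] g V by simp
  with le[OF g V] show ?thesis by simp
qed

lemma act_image_mult:
  assumes "g \<in> carrier G" "k \<in> carrier G" "h \<subseteq> V" shows "\<phi> g ` \<phi> k ` h = \<phi> (g \<otimes> k) ` h"
proof -
  have "\<phi> (g \<otimes> k) x = \<phi> g (\<phi> k x)" if "x \<in> h" for x using act_mult assms that by blast
  then show ?thesis by (auto simp: image_image)
qed

lemma act_image_sub: "g \<in> carrier G \<Longrightarrow> h \<subseteq> V \<Longrightarrow> \<phi> g ` h \<subseteq> V"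
  using act_V by blast

lemma act_image_inv:
  assumes "g \<in> carrier G" "h \<subseteq> V" shows "\<phi> (inv g) ` \<phi> g ` h = h" "\<phi> g ` \<phi> (inv g) ` h = h"
proof -
  have "\<phi> \<one> ` h = id ` h" using act_one assms(2) by (intro image_cong) auto
  then show "\<phi> (inv g) ` \<phi> g ` h = h" "\<phi> g ` \<phi> (inv g) ` h = h"
    using act_image_mult[of "inv g" g h] act_image_mult[of g "inv g" h] assms by simp_all
qed

lemma act_mem: "g \<in> carrier G \<Longrightarrow> h \<subseteq> V \<Longrightarrow> x \<in> V \<Longrightarrow> \<phi> g x \<in> \<phi> g ` h \<longleftrightarrow> x \<in> h"
  using act_inj inj_on_image_mem_iff by metis

lemma act_mem_inv: "g \<in> carrier G \<Longrightarrow> h \<subseteq> V \<Longrightarrow> x \<in> V \<Longrightarrow> x \<in> \<phi> (inv g) ` h \<longleftrightarrow> \<phi> g x \<in> h"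
  using act_mem[of "inv g" h "\<phi> g x"] act_V[of g x] act_inv(2)[of g x] by simp

lemma act_image_V: "g \<in> carrier G \<Longrightarrow> \<phi> g ` V = V"
  using act_image_sub[of g V] act_image_sub[of "inv g" V] act_image_inv(2)[of g V] by blast

lemma act_compl: "g \<in> carrier G \<Longrightarrow> h \<subseteq> V \<Longrightarrow> \<phi> g ` (V - h) = V - \<phi> g ` h"
  using inj_on_image_set_diff[OF act_inj, of g V h] act_image_V[of g] by simp

lemma act_image_Int: "g \<in> carrier G \<Longrightarrow> h \<subseteq> V \<Longrightarrow> k \<subseteq> V \<Longrightarrow> \<phi> g ` (h \<inter> k) = \<phi> g ` h \<inter> \<phi> g ` k"
  using inj_on_image_Int[OF act_inj] by blast

lemma act_half:
  assumes g: "g \<in> carrier G" and a: "adj a b" shows "\<phi> g ` half a b = half (\<phi> g a) (\<phi> g b)"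
proof -
  have V: "a \<in> V" "b \<in> V" using a adj_V adj_V2 by blast+
  have "x \<in> \<phi> g ` half a b \<longleftrightarrow> x \<in> half (\<phi> g a) (\<phi> g b)" if x: "x \<in> V" for x
  proof -
    define y where "y = \<phi> (inv g) x"
    have y: "y \<in> V" "x = \<phi> g y" unfolding y_def using x g act_V by auto
    show ?thesis unfolding y(2) act_mem[OF g half_sub y(1)] unfolding half_def
      using act_d[OF g y(1)] V act_V[OF g y(1)] y(1) by simp
  qed
  then show ?thesis using half_sub act_image_sub[OF g half_sub] by blast
qed

lemma act_halves: "g \<in> carrier G \<Longrightarrow> h \<in> halves \<Longrightarrow> \<phi> g ` h \<in> halves"
proof -
  assume g: "g \<in> carrier G" and "h \<in> halves"
  then obtain a b where "adj a b" "h = half a b" unfolding halves_def by auto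
  then have "adj (\<phi> g a) (\<phi> g b)" "\<phi> g ` h = half (\<phi> g a) (\<phi> g b)" using act_adj act_half g by auto
  then show ?thesis unfolding halves_def by auto
qed

section \<open>Halfspaces crossing an invariant convex set\<close>

definition invariant :: "'a set \<Rightarrow> bool" where
  "invariant Y \<longleftrightarrow> (\<forall>g\<in>carrier G. \<phi> g ` Y = Y)"

definition crossing :: "'a set \<Rightarrow> 'a set set" where
  "crossing Y = {h \<in> halves. h \<inter> Y \<noteq> {} \<and> \<not> Y \<subseteq> h}"

definition minimal :: "'a set \<Rightarrow> 'a set \<Rightarrow> bool" where
  "minimal Y h \<longleftrightarrow> h \<in> crossing Y \<and> (\<forall>k\<in>crossing Y. \<not> k \<inter> Y \<subset> h \<inter> Y)"

definition orb :: "'a set \<Rightarrow> 'a set set" where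
  "orb h = (\<lambda>g. \<phi> g ` h) ` carrier G"

lemma invariantI:
  assumes "Y \<subseteq> V" "\<And>g x. g \<in> carrier G \<Longrightarrow> x \<in> Y \<Longrightarrow> \<phi> g x \<in> Y" shows "invariant Y"
  unfolding invariant_def
proof
  fix g assume g: "g \<in> carrier G"
  have "Y = \<phi> g ` \<phi> (inv g) ` Y" using act_image_inv(2)[OF g assms(1)] by simp
  also have "\<dots> \<subseteq> \<phi> g ` Y" using assms(2)[of "inv g"] g by (intro image_mono) auto
  finally show "\<phi> g ` Y = Y" using assms(2)[OF g] by blast
qed

lemma crossing_halves: "h \<in> crossing Y \<Longrightarrow> h \<in> halves"
  unfolding crossing_def by simp

lemma crossing_sub: "h \<in> crossing Y \<Longrightarrow> h \<subseteq> V"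
  using crossing_halves halves_sub by blast

lemma crossing_compl: "Y \<subseteq> V \<Longrightarrow> h \<in> crossing Y \<Longrightarrow> V - h \<in> crossing Y"
  unfolding crossing_def using compl_halves by blast

lemma act_trace:
  assumes "Y \<subseteq> V" "invariant Y" "g \<in> carrier G" "h \<subseteq> V" shows "\<phi> g ` h \<inter> Y = \<phi> g ` (h \<inter> Y)"
  using act_image_Int[OF assms(3,4,1)] assms unfolding invariant_def by simp

lemma act_crossing:
  assumes Y: "Y \<subseteq> V" "invariant Y" and g: "g \<in> carrier G" and h: "h \<in> crossing Y"
  shows "\<phi> g ` h \<in> crossing Y"
proof -
  have "\<phi> g ` h \<in> halves" using act_halves g crossing_halves[OF h] by blast
  moreover have "h \<inter> Y \<noteq> {}" using h unfolding crossing_def by blast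
  then have "\<phi> g ` h \<inter> Y \<noteq> {}" using act_trace[OF Y g crossing_sub[OF h]] by simp
  moreover have "\<not> Y \<subseteq> \<phi> g ` h"
  proof
    assume "Y \<subseteq> \<phi> g ` h"
    then have "Y \<subseteq> \<phi> g ` (h \<inter> Y)" using act_trace[OF Y g crossing_sub[OF h]] by blast
    then have "\<phi> g ` Y \<subseteq> \<phi> g ` (h \<inter> Y)" using Y(2) g unfolding invariant_def by simp
    moreover have "h \<inter> Y \<subseteq> V" using Y(1) by auto
    ultimately have "Y \<subseteq> h \<inter> Y"
      using inj_on_image_subset_iff[OF act_inj[OF g] Y(1), of "h \<inter> Y"] by simp
    then show False using h unfolding crossing_def by blast
  qed
  ultimately show ?thesis unfolding crossing_def by blast
qed

lemma act_psubset:
  assumes "g \<in> carrier G" "A \<subset> B" "B \<subseteq> V" shows "\<phi> g ` A \<subset> \<phi> g ` B"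
  using image_strict_mono[OF inj_on_subset[OF act_inj[OF assms(1)] assms(3)] assms(2)] .

lemma act_minimal:
  assumes Y: "Y \<subseteq> V" "invariant Y" and g: "g \<in> carrier G" and h: "minimal Y h"
  shows "minimal Y (\<phi> g ` h)"
proof -
  have hc: "h \<in> crossing Y" using h unfolding minimal_def by simp
  have "\<not> k \<inter> Y \<subset> \<phi> g ` h \<inter> Y" if k: "k \<in> crossing Y" for k
  proof
    assume "k \<inter> Y \<subset> \<phi> g ` h \<inter> Y"
    moreover have "\<phi> g ` h \<inter> Y \<subseteq> V" using Y(1) by auto
    ultimately have "\<phi> (inv g) ` (k \<inter> Y) \<subset> \<phi> (inv g) ` (\<phi> g ` h \<inter> Y)"
      by (intro act_psubset inv_closed g)
    then have "\<phi> (inv g) ` k \<inter> Y \<subset> \<phi> (inv g) ` \<phi> g ` h \<inter> Y"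
      unfolding act_trace[OF Y inv_closed[OF g] crossing_sub[OF k]]
        act_trace[OF Y inv_closed[OF g] act_image_sub[OF g crossing_sub[OF hc]]] .
    then have "\<phi> (inv g) ` k \<inter> Y \<subset> h \<inter> Y"
      using act_image_inv(1)[OF g crossing_sub[OF hc]] by simp
    moreover have "\<phi> (inv g) ` k \<in> crossing Y" using act_crossing[OF Y _ k] g by simp
    ultimately show False using h unfolding minimal_def by blast
  qed
  then show ?thesis using act_crossing[OF Y g hc] unfolding minimal_def by blast
qed

lemma act_pow_fixed:
  assumes g: "g \<in> carrier G" and u: "u \<in> V" "\<phi> (g [^] (n::nat)) u = u"
  shows "\<phi> (g [^] (n * k)) u = u"
proof (induction k)
  case 0
  then show ?case using u act_one by simp
next
  case (Suc k)
  have "g [^] (n * Suc k) = g [^] (n * k) \<otimes> g [^] n" using g by (simp add: nat_pow_mult add.commute)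
  then show ?case using Suc u g act_mult by simp
qed

text \<open>An element with a periodic vertex cannot push a halfspace strictly into itself: the iterates
  would be infinitely many halfspaces separating two vertices.\<close>

lemma no_descent_aux:
  assumes Y: "conv Y" "invariant Y" and g: "g \<in> carrier G" and h: "h \<in> crossing Y"
    and u: "u \<in> h" "\<phi> (g [^] (n::nat)) u = u" "n > 0"
  shows "\<not> \<phi> g ` h \<inter> Y \<subset> h \<inter> Y"
proof
  assume less: "\<phi> g ` h \<inter> Y \<subset> h \<inter> Y"
  have YV: "Y \<subseteq> V" using Y conv_sub by blast
  have hV: "h \<subseteq> V" "h \<in> halves" using crossing_sub crossing_halves h by blast+
  define B where "B k = \<phi> (g [^] k) ` h \<inter> Y" for k :: nat
  have step: "B (Suc k) \<subset> B k" for k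
  proof -
    have gk: "g [^] k \<in> carrier G" using g by simp
    have "\<phi> (g [^] k) ` (\<phi> g ` h \<inter> Y) \<subset> \<phi> (g [^] k) ` (h \<inter> Y)"
      by (rule act_psubset[OF gk less]) (use hV(1) in blast)
    then have "\<phi> (g [^] k) ` \<phi> g ` h \<inter> Y \<subset> \<phi> (g [^] k) ` h \<inter> Y"
      unfolding act_trace[OF YV Y(2) gk act_image_sub[OF g hV(1)]] act_trace[OF YV Y(2) gk hV(1)] .
    then show ?thesis unfolding B_def act_image_mult[OF gk g hV(1)] by simp
  qed
  then have "decseq B" unfolding decseq_Suc_iff by blast
  have strict: "B j \<subset> B i" if "i < j" for i j
    using subset_psubset_trans[OF decseqD[OF \<open>decseq B\<close> Suc_leI[OF that]] step] .
  have "B 1 \<subset> B 0" using strict by simp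
  then obtain y where y: "y \<in> B 0" "y \<notin> B 1" by blast
  have yY: "y \<in> Y" using y B_def by simp
  \<comment> \<open>Multiples of the period keep \<open>u\<close> inside every iterate. The
    successor excludes the exponent 0, so that all these traces lie in \<open>B 1\<close>, which
    misses \<open>y\<close>.\<close>
  define hs where "hs k = \<phi> (g [^] (n * Suc k)) ` h" for k
  have "inj hs"
  proof (rule injI)
    fix k l assume "hs k = hs l"
    then have "B (n * Suc k) = B (n * Suc l)" unfolding B_def hs_def by simp
    then have "\<not> n * Suc k < n * Suc l" "\<not> n * Suc l < n * Suc k"
      using strict[of "n * Suc k" "n * Suc l"] strict[of "n * Suc l" "n * Suc k"] by auto
    then show "k = l" using u(3) by simp
  qed
  then have "infinite (range hs)" using range_inj_infinite by blast
  moreover have "range hs \<subseteq> {h \<in> halves. (u \<in> h) \<noteq> (y \<in> h)}"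
  proof
    fix k assume "k \<in> range hs"
    then obtain i where k: "k = hs i" by blast
    have "k \<in> halves" unfolding k hs_def using act_halves hV g by simp
    moreover have "\<phi> (g [^] (n * Suc i)) u = u" using act_pow_fixed[OF g _ u(2)] u(1) hV(1) by blast
    then have "u \<in> k" unfolding k hs_def using u(1) by (intro image_eqI[of _ _ u]) simp_all
    moreover have "B (n * Suc i) \<subseteq> B 1" using decseqD[OF \<open>decseq B\<close>, of 1 "n * Suc i"] u(3) by simp
    then have "y \<notin> k" using y(2) yY unfolding k hs_def B_def by blast
    ultimately show "k \<in> {h \<in> halves. (u \<in> h) \<noteq> (y \<in> h)}" by blast
  qed
  moreover have "u \<in> V" "y \<in> V" using u(1) hV(1) yY YV by auto
  ultimately show False using finite_subset[OF _ finite_separating] by simp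
qed

text \<open>If the periodic vertex lies outside \<open>h\<close>, pass to complements:
  \<open>inv g\<close> then pushes \<open>V - h\<close> strictly into itself on \<open>Y\<close>,
  and the same vertex is periodic for \<open>inv g\<close>.\<close>

lemma no_descent:
  assumes Y: "conv Y" "invariant Y" and g: "g \<in> carrier G" and h: "h \<in> crossing Y"
  shows "\<not> \<phi> g ` h \<inter> Y \<subset> h \<inter> Y"
proof
  assume less: "\<phi> g ` h \<inter> Y \<subset> h \<inter> Y"
  have YV: "Y \<subseteq> V" using Y conv_sub by blast
  have hV: "h \<subseteq> V" using crossing_sub h by blast
  obtain u n where u: "u \<in> V" "n > 0" "\<phi> (g [^] (n::nat)) u = u" using periodic[OF g] by blast
  show False
  proof (cases "u \<in> h")
    case True
    then show False using no_descent_aux[OF Y g h True u(3,2)] less by blast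
  next
    case False
    define h' where "h' = V - \<phi> g ` h"
    have gi: "inv g \<in> carrier G" using g by simp
    have h': "h' \<in> crossing Y" unfolding h'_def using crossing_compl act_crossing YV Y g h by blast
    have h'': "V - h = \<phi> (inv g) ` h'" unfolding h'_def
      using act_compl[OF gi act_image_sub[OF g hV]] act_image_inv(1)[OF g hV] by simp
    have "(V - h) \<inter> Y \<subset> h' \<inter> Y" using less YV unfolding h'_def by blast
    then have l: "\<phi> (inv g) ` h' \<inter> Y \<subset> h' \<inter> Y" using h'' by simp
    have "\<phi> (inv g) u \<in> V" using gi u act_V by blast
    have "\<phi> (inv g [^] n) u = \<phi> (inv g [^] n) (\<phi> (g [^] n) u)" using u by simp
    also have "\<dots> = u" using act_inv(2)[of "g [^] n" u] g u by (simp add: nat_pow_inv)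
    finally have p: "\<phi> (inv g [^] n) u = u" .
    have "u \<in> V - h" using u False by simp
    have hc: "V - h \<in> crossing Y" using crossing_compl YV h by blast
    have "\<phi> (inv g) ` \<phi> (inv g) ` h' \<inter> Y \<subset> \<phi> (inv g) ` h' \<inter> Y"
      using act_psubset[OF gi l] YV act_trace[OF YV Y(2) gi] crossing_sub[OF h'] act_image_sub[OF gi crossing_sub[OF h']]
      by (simp add: le_infI2)
    then show False using no_descent_aux[OF Y gi hc \<open>u \<in> V - h\<close> p u(2)] h'' by simp
  qed
qed

lemma orb_self: "h \<subseteq> V \<Longrightarrow> h \<in> orb h"
  unfolding orb_def using act_one by (intro image_eqI[of _ _ \<one>]) force+

lemma orb_act:
  assumes "g \<in> carrier G" "h \<subseteq> V" shows "orb (\<phi> g ` h) = orb h"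
proof -
  have sub: "orb (\<phi> g ` h) \<subseteq> orb h" if "g \<in> carrier G" "h \<subseteq> V" for g h
    unfolding orb_def using act_image_mult[OF _ that] that(1) by auto
  show ?thesis using sub[OF assms] sub[of "inv g" "\<phi> g ` h"] assms act_image_inv(1)[OF assms] act_image_sub[OF assms]
    by auto
qed

lemma orb_act_mem:
  assumes "k \<in> orb h" "g \<in> carrier G" "h \<subseteq> V" shows "\<phi> g ` k \<in> orb h"
proof -
  obtain g' where g': "g' \<in> carrier G" "k = \<phi> g' ` h" using assms(1) unfolding orb_def by auto
  then have "\<phi> g ` k = \<phi> (g \<otimes> g') ` h" using act_image_mult[OF assms(2) g'(1) assms(3)] by simp
  then show ?thesis unfolding orb_def using assms(2) g'(1) by auto
qed

text \<open>Otherwise there is an infinite strictly descending sequence of traces. With finitely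
  many orbits two terms are translates of each other, which \<open>no_descent\<close>
  forbids.\<close>

lemma exists_minimal:
  assumes Y: "conv Y" "invariant Y" and fin: "finite (orb ` crossing Y)" and k: "k \<in> crossing Y"
  shows "\<exists>h. minimal Y h \<and> h \<inter> Y \<subseteq> k \<inter> Y"
proof (rule ccontr)
  assume no: "\<not> ?thesis"
  define P where "P h \<longleftrightarrow> h \<in> crossing Y \<and> h \<inter> Y \<subseteq> k \<inter> Y" for h
  have "\<exists>f. \<forall>n. P (f n) \<and> f (Suc n) \<inter> Y \<subset> f n \<inter> Y"
  proof (rule dependent_nat_choice)
    show "\<exists>x. P x" using k P_def by blast
    fix x :: "'a set" and n :: nat assume "P x"
    then have "\<not> minimal Y x" using no P_def by blast
    then obtain y where "y \<in> crossing Y" "y \<inter> Y \<subset> x \<inter> Y" using \<open>P x\<close> unfolding minimal_def P_def by blast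
    then show "\<exists>y. P y \<and> y \<inter> Y \<subset> x \<inter> Y" using \<open>P x\<close> unfolding P_def by blast
  qed
  then obtain f where "\<forall>n. P (f n) \<and> f (Suc n) \<inter> Y \<subset> f n \<inter> Y" by (rule exE)
  then have f: "P (f n)" "f (Suc n) \<inter> Y \<subset> f n \<inter> Y" for n by (blast dest: spec)+
  have "range (\<lambda>n. orb (f n)) \<subseteq> orb ` crossing Y" using f(1) unfolding P_def by blast
  then have "finite (range (\<lambda>n. orb (f n)))" using fin finite_subset by blast
  then have "\<not> inj (\<lambda>n. orb (f n))" using finite_imageD infinite_UNIV_nat by blast
  then obtain i j where ij: "i < j" "orb (f i) = orb (f j)" unfolding inj_on_def by (metis nat_neq_iff)
  have "f j \<in> orb (f i)" using ij(2) orb_self crossing_sub f(1) P_def by blast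
  then obtain g where g: "g \<in> carrier G" "f j = \<phi> g ` f i" unfolding orb_def by blast
  have "decseq (\<lambda>n. f n \<inter> Y)" unfolding decseq_Suc_iff using f(2) by blast
  then have "f j \<inter> Y \<subseteq> f (Suc i) \<inter> Y" using decseqD[of _ "Suc i" j] ij(1) by fastforce
  then have "\<phi> g ` f i \<inter> Y \<subset> f i \<inter> Y" using f(2)[of i] g(2) by blast
  then show False using no_descent[OF Y g(1)] f(1) P_def by blast
qed

lemma minimal_adjacent:
  assumes Y: "conv Y" and v: "v \<in> Y" "v \<in> h" and h: "minimal Y h"
  obtains x where "x \<in> Y" "adj v x" "h = half v x"
proof -
  have h': "h \<in> halves" "\<not> Y \<subseteq> h" using h unfolding minimal_def crossing_def by auto
  show thesis
  proof (rule adjacent_or_smaller[OF Y v h'])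
    fix x assume "x \<in> Y" "adj v x" "h = half v x" then show thesis by (rule that)
  next
    fix k assume "k \<in> halves" "v \<in> k" "k \<inter> Y \<subset> h \<inter> Y" "\<not> Y \<subseteq> k"
    then show thesis using h v(1) unfolding minimal_def crossing_def by blast
  qed
qed

text \<open>Some \<open>y\<close> in \<open>Y\<close> lies outside both halfspaces: otherwise the
  complement of the first would lie in the second within \<open>Y\<close>, so by minimality equal it
  there, although \<open>v\<close> belongs only to the second. Seen from \<open>y\<close>, the edges
  to \<open>a\<close> and \<open>b\<close> both descend, and the quadrangle condition
  applies.\<close>

lemma minimal_square:
  assumes Y: "conv Y" and v: "v \<in> Y" and a: "adj v a" "minimal Y (half v a)"
    and b: "adj v b" "minimal Y (half v b)" and ne: "a \<noteq> b"
  shows "\<exists>c. sq v a c b"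
proof -
  have YV: "Y \<subseteq> V" using Y conv_sub by blast
  have "\<exists>y\<in>Y. y \<notin> half v a \<and> y \<notin> half v b"
  proof (rule ccontr)
    assume "\<not> ?thesis"
    then have "(V - half v a) \<inter> Y \<subseteq> half v b \<inter> Y" by blast
    moreover have "V - half v a \<in> crossing Y" using a(2) crossing_compl YV unfolding minimal_def by blast
    ultimately have "(V - half v a) \<inter> Y = half v b \<inter> Y" using b(2) unfolding minimal_def by blast
    then show False using half_base(1)[OF a(1)] half_base(1)[OF b(1)] v by blast
  qed
  then obtain y where y: "y \<in> V" "\<not> d y v < d y a" "\<not> d y v < d y b" using YV unfolding half_def by blast
  have dy: "d y v = Suc (d y a)" "d y a = d y b"
    using bipartite[OF y(1) a(1)] bipartite[OF y(1) b(1)] y(2,3) by linarith+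
  obtain c where "sq v a c b" using quadrangle[OF y(1) a(1) b(1) ne dy(1) refl dy(2)[symmetric]] by blast
  then show ?thesis by blast
qed

lemma finite_minimal_at:
  assumes Y: "conv Y" and v: "v \<in> Y" shows "finite {a. adj v a \<and> minimal Y (half v a)}"
proof (rule no_infinite_clique)
  show "v \<in> V" using v conv_sub[OF Y] by blast
qed (use minimal_square[OF Y v] in auto)

text \<open>A word for \<open>g\<close> gives a chain of translates of \<open>v\<close>, and
  \<open>h\<close> separates two consecutive ones. Translating that step back to start at
  \<open>v\<close> leaves a generator or its inverse; an inverse is turned round by one more
  translation.\<close>

lemma separated_by_generators:
  assumes S: "S \<subseteq> carrier G" and v: "v \<in> V" and g: "g \<in> generate G S"
    and h: "h \<in> halves" "(v \<in> h) \<noteq> (\<phi> g v \<in> h)"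
  shows "orb h \<in> orb ` (\<Union>s\<in>S. {h \<in> halves. (v \<in> h) \<noteq> (\<phi> s v \<in> h)})" (is "_ \<in> orb ` ?D")
  using g h
proof (induction arbitrary: h rule: generate.induct)
  case one
  then show ?case using act_one v by simp
next
  case (incl s)
  then show ?case by blast
next
  case (inv s)
  have s: "s \<in> carrier G" using inv S by blast
  have hV: "h \<subseteq> V" using inv halves_sub by blast
  have "v \<in> \<phi> s ` h \<longleftrightarrow> \<phi> (inv s) v \<in> h"
    using act_mem_inv[of "inv s" h v] s hV v by simp
  moreover have "\<phi> s v \<in> \<phi> s ` h \<longleftrightarrow> v \<in> h" using act_mem s hV v by blast
  moreover have "\<phi> s ` h \<in> halves" using inv s act_halves by simp
  ultimately have "\<phi> s ` h \<in> halves \<and> (v \<in> \<phi> s ` h) \<noteq> (\<phi> s v \<in> \<phi> s ` h)" using inv.prems(2) by argo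
  then have "\<phi> s ` h \<in> {h \<in> halves. (v \<in> h) \<noteq> (\<phi> s v \<in> h)}" by (rule CollectI)
  then have "\<phi> s ` h \<in> ?D" by (rule UN_I[OF inv.hyps])
  then have "orb (\<phi> s ` h) \<in> orb ` ?D" by (rule imageI)
  then show ?case using orb_act[OF s hV] by simp
next
  case (eng g1 g2)
  have c: "g1 \<in> carrier G" "g2 \<in> carrier G"
    using generate_in_carrier[OF S eng.hyps(1)] generate_in_carrier[OF S eng.hyps(2)] by simp_all
  have hV: "h \<subseteq> V" using halves_sub[OF eng.prems(1)] .
  show ?case
  proof (cases "(v \<in> h) = (\<phi> g1 v \<in> h)")
    case False
    then show ?thesis using eng.IH(1)[OF eng.prems(1)] by simp
  next
    case True
    let ?h = "\<phi> (inv g1) ` h"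
    have "v \<in> ?h \<longleftrightarrow> \<phi> g1 v \<in> h" using act_mem_inv c hV v by blast
    moreover have "\<phi> g2 v \<in> ?h \<longleftrightarrow> \<phi> (g1 \<otimes> g2) v \<in> h"
      using act_mem_inv[OF c(1) hV, of "\<phi> g2 v"] act_V c v act_mult by simp
    ultimately have "(v \<in> ?h) \<noteq> (\<phi> g2 v \<in> ?h)" using True eng.prems(2) by argo
    moreover have "?h \<in> halves" using act_halves eng.prems(1) c by simp
    ultimately have "orb ?h \<in> orb ` ?D" by (rule eng.IH(2)[rotated])
    then show ?thesis using orb_act[of "inv g1" h] c hV by simp
  qed
qed

section \<open>Invariant convex sets with few orbits of crossing halfspaces\<close>

lemma conv_Inter:
  assumes "conv Y" "\<And>k. k \<in> F \<Longrightarrow> conv k" shows "conv {x \<in> Y. \<forall>k\<in>F. x \<in> k}"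
  unfolding conv_def
proof (intro conjI ballI impI)
  show "{x \<in> Y. \<forall>k\<in>F. x \<in> k} \<subseteq> V" using conv_sub[OF assms(1)] by auto
  fix x y z assume x: "x \<in> {x \<in> Y. \<forall>k\<in>F. x \<in> k}" and y: "y \<in> {x \<in> Y. \<forall>k\<in>F. x \<in> k}"
    and z: "z \<in> V" "d x z + d z y = d x y"
  have "z \<in> k" if "k \<in> F" for k using conv_D[OF assms(2)[OF that] _ _ z] x y that by simp
  moreover have "z \<in> Y" using conv_D[OF assms(1) _ _ z] x y by simp
  ultimately show "z \<in> {x \<in> Y. \<forall>k\<in>F. x \<in> k}" by simp
qed

text \<open>\<open>Y\<close> is the intersection of all halfspaces containing an orbit of vertices.
  A halfspace crossing \<open>Y\<close> neither contains nor misses the orbit, so it separates two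
  orbit points and is, up to translation, one of the finitely many in \<open>?D\<close>.\<close>

lemma exists_cofinite:
  "\<exists>Y. conv Y \<and> invariant Y \<and> Y \<noteq> {} \<and> finite (orb ` crossing Y)"
proof -
  obtain v where v: "v \<in> V" using V_nonempty by blast
  obtain S where S: "finite S" "S \<subseteq> carrier G" "generate G S = carrier G" using finitely_generated by blast
  let ?D = "\<Union>s\<in>S. {h \<in> halves. (v \<in> h) \<noteq> (\<phi> s v \<in> h)}"
  have finD: "finite ?D" using S finite_separating v act_V by blast
  define O' where "O' = (\<lambda>g. \<phi> g v) ` carrier G"
  have OV: "O' \<subseteq> V" unfolding O'_def using act_V v by blast
  have Oact: "\<phi> g ` O' \<subseteq> O'" if g: "g \<in> carrier G" for g
  proof
    fix x assume "x \<in> \<phi> g ` O'"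
    then obtain k where k: "k \<in> carrier G" "x = \<phi> g (\<phi> k v)" unfolding O'_def by blast
    then have "x = \<phi> (g \<otimes> k) v" using act_mult g v by simp
    then show "x \<in> O'" unfolding O'_def using g k by blast
  qed
  define F where "F = {h \<in> halves. O' \<subseteq> h}"
  define Y where "Y = {x \<in> V. \<forall>k\<in>F. x \<in> k}"
  have "conv V" unfolding conv_def by blast
  then have Yc: "conv Y" unfolding Y_def using conv_halves F_def by (intro conv_Inter) auto
  have OY: "O' \<subseteq> Y" unfolding Y_def F_def using OV by blast
  have "v \<in> O'" unfolding O'_def using act_one[OF v] by (metis image_eqI one_closed)
  have Yinv: "invariant Y"
  proof (rule invariantI)
    show "Y \<subseteq> V" unfolding Y_def by blast
    fix g x assume g: "g \<in> carrier G" and x: "x \<in> Y"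
    have xV: "x \<in> V" using x Y_def by simp
    have "\<phi> g x \<in> k" if k: "k \<in> F" for k
    proof -
      have kV: "k \<subseteq> V" using k F_def halves_sub by blast
      have "O' \<subseteq> \<phi> (inv g) ` k"
      proof
        fix y assume y: "y \<in> O'"
        then have "\<phi> g y \<in> k" using Oact[OF g] k unfolding F_def by blast
        then show "y \<in> \<phi> (inv g) ` k" using act_mem_inv[OF g kV] y OV by blast
      qed
      then have "\<phi> (inv g) ` k \<in> F" using k act_halves g unfolding F_def by simp
      then have "x \<in> \<phi> (inv g) ` k" using x unfolding Y_def by blast
      then show ?thesis using act_mem_inv[OF g kV xV] by blast
    qed
    then show "\<phi> g x \<in> Y" unfolding Y_def using act_V[OF g xV] by blast
  qed
  have "orb ` crossing Y \<subseteq> orb ` ?D"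
  proof
    fix o' assume "o' \<in> orb ` crossing Y"
    then obtain h where h: "h \<in> crossing Y" "o' = orb h" by blast
    have hh: "h \<in> halves" "h \<subseteq> V" using crossing_halves crossing_sub h by blast+
    have "\<not> O' \<subseteq> h"
    proof
      assume "O' \<subseteq> h" then have "h \<in> F" using hh F_def by simp
      then show False using h(1) unfolding crossing_def Y_def by blast
    qed
    moreover have "\<not> O' \<subseteq> V - h"
    proof
      assume "O' \<subseteq> V - h" then have "V - h \<in> F" using compl_halves hh F_def by simp
      then show False using h(1) unfolding crossing_def Y_def by blast
    qed
    ultimately obtain g1 g2 where g: "g1 \<in> carrier G" "g2 \<in> carrier G" "\<phi> g1 v \<in> h" "\<phi> g2 v \<notin> h"
      using OV unfolding O'_def by blast
    let ?h = "\<phi> (inv g1) ` h"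
    have "v \<in> ?h" using act_mem_inv g hh v by blast
    moreover have "\<phi> (inv g1 \<otimes> g2) v \<notin> ?h"
      using act_mem[of "inv g1" h "\<phi> g2 v"] g act_mult act_V v hh by simp
    moreover have "?h \<in> halves" using act_halves hh g by simp
    moreover have "inv g1 \<otimes> g2 \<in> generate G S" using S g by simp
    ultimately have "orb ?h \<in> orb ` ?D" using separated_by_generators[OF S(2) v] by blast
    then show "o' \<in> orb ` ?D" using orb_act[of "inv g1" h] g hh h(2) by simp
  qed
  then have "finite (orb ` crossing Y)" using finD finite_subset by blast
  then show ?thesis using Yc Yinv OY \<open>v \<in> O'\<close> by blast
qed

text \<open>Take \<open>w\<close> in as few translates of \<open>h\<close> as possible; the number
  is finite by \<open>finite_minimal_at\<close>. If \<open>w\<close> lies in a translate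
  \<open>k\<close>, cross its boundary to an adjacent \<open>x\<close> in \<open>Y\<close>. A
  translate containing \<open>x\<close> but not \<open>w\<close> would be \<open>V - k\<close>,
  making the complement of \<open>h\<close> minimal after translation. Hence \<open>x\<close> lies
  in fewer translates.\<close>

lemma push_off_minimal:
  assumes Y: "conv Y" "invariant Y" "Y \<noteq> {}" and h: "minimal Y h" "\<not> minimal Y (V - h)"
  shows "\<exists>w\<in>Y. \<forall>k\<in>orb h. w \<notin> k"
proof -
  have YV: "Y \<subseteq> V" using Y conv_sub by blast
  have hV: "h \<subseteq> V" using h(1) crossing_sub[of h Y] unfolding minimal_def by simp
  define bad where "bad w = {k \<in> orb h. w \<in> k}" for w
  have min: "minimal Y k" if "k \<in> orb h" for k
    using that act_minimal[OF YV Y(2) _ h(1)] unfolding orb_def by blast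
  have finbad: "finite (bad w)" if w: "w \<in> Y" for w
  proof -
    have "bad w \<subseteq> half w ` {a. adj w a \<and> minimal Y (half w a)}"
    proof
      fix k assume "k \<in> bad w"
      then have k: "w \<in> k" "minimal Y k" using min unfolding bad_def by auto
      obtain x where "adj w x" "k = half w x" by (rule minimal_adjacent[OF Y(1) w k])
      then show "k \<in> half w ` {a. adj w a \<and> minimal Y (half w a)}" using k by blast
    qed
    then show ?thesis using finite_minimal_at[OF Y(1) w] finite_surj by blast
  qed
  have "\<exists>w. w \<in> Y" using Y by blast
  then obtain w where w: "w \<in> Y" "\<And>x. x \<in> Y \<Longrightarrow> card (bad w) \<le> card (bad x)"
    using ex_has_least_nat[of "\<lambda>w. w \<in> Y" _ "\<lambda>w. card (bad w)"] by blast
  have "bad w = {}"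
  proof (rule ccontr)
    assume "bad w \<noteq> {}"
    then obtain k where k: "k \<in> orb h" "w \<in> k" unfolding bad_def by blast
    obtain x where x: "x \<in> Y" "adj w x" "k = half w x" by (rule minimal_adjacent[OF Y(1) w(1) k(2) min[OF k(1)]])
    have "bad x \<subseteq> bad w"
    proof
      fix k' assume k': "k' \<in> bad x"
      then have k'o: "k' \<in> orb h" "x \<in> k'" unfolding bad_def by auto
      have "w \<in> k'"
      proof (rule ccontr)
        assume "w \<notin> k'"
        have "k' \<in> halves" using min[OF k'o(1)] crossing_halves unfolding minimal_def by blast
        then have "k' = half x w" using halves_boundary[OF _ adj_sym[OF x(2)] k'o(2) \<open>w \<notin> k'\<close>] by blast
        then have eq: "k' = V - k" using compl_half[OF x(2)] x(3) by simp
        obtain g where g: "g \<in> carrier G" "k = \<phi> g ` h" using k(1) unfolding orb_def by blast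
        have "minimal Y (\<phi> g ` (V - h))" using min[OF k'o(1)] eq act_compl[OF g(1) hV] g(2) by simp
        then have "minimal Y (\<phi> (inv g) ` \<phi> g ` (V - h))" using act_minimal[OF YV Y(2)] g(1) by simp
        then show False using h(2) act_image_inv(1)[OF g(1), of "V - h"] by simp
      qed
      then show "k' \<in> bad w" using k'o unfolding bad_def by blast
    qed
    moreover have "k \<in> bad w" "k \<notin> bad x" using k x half_base(2) unfolding bad_def by auto
    ultimately have "card (bad x) < card (bad w)" using finbad[OF w(1)] by (intro psubset_card_mono) auto
    then show False using w(2)[OF x(1)] by simp
  qed
  then show ?thesis using w(1) unfolding bad_def by blast
qed

lemma exists_all_minimal:
  "\<exists>Y. conv Y \<and> invariant Y \<and> Y \<noteq> {} \<and> (\<forall>h\<in>crossing Y. minimal Y h)"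
proof -
  let ?P = "\<lambda>Y. conv Y \<and> invariant Y \<and> Y \<noteq> {} \<and> finite (orb ` crossing Y)"
  obtain Y where P: "?P Y" and least: "\<And>Z. ?P Z \<Longrightarrow> card (orb ` crossing Y) \<le> card (orb ` crossing Z)"
    using ex_has_least_nat[of ?P _ "\<lambda>Y. card (orb ` crossing Y)"] exists_cofinite by blast
  have Y: "conv Y" "invariant Y" "Y \<noteq> {}" and fin: "finite (orb ` crossing Y)" using P by auto
  have YV: "Y \<subseteq> V" using Y conv_sub by blast
  have compl: "minimal Y (V - h)" if h: "minimal Y h" for h
  proof (rule ccontr)
    assume n: "\<not> minimal Y (V - h)"
    \<comment> \<open>What remains of \<open>Y\<close> after cutting off all translates of
      \<open>h\<close>. It is nonempty by \<open>push_off_minimal\<close>, and the orbit of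
      \<open>h\<close> no longer crosses it, against the choice of \<open>Y\<close>.\<close>
    define Z where "Z = {x \<in> Y. \<forall>k\<in>(\<lambda>k. V - k) ` orb h. x \<in> k}"
    have hc: "h \<in> crossing Y" using h minimal_def by blast
    have orbh: "k \<in> halves" if "k \<in> orb h" for k
      using that act_halves crossing_halves[OF hc] unfolding orb_def by blast
    have "conv Z" unfolding Z_def using Y(1) conv_halves compl_halves orbh by (intro conv_Inter) auto
    moreover have "invariant Z"
    proof (rule invariantI)
      show "Z \<subseteq> V" using YV Z_def by blast
      fix g x assume g: "g \<in> carrier G" and x: "x \<in> Z"
      have xY: "x \<in> Y" "x \<in> V" using x YV Z_def by auto
      have nz: "x \<notin> k" if "k \<in> orb h" for k using x that unfolding Z_def by auto
      have "\<phi> g x \<notin> k" if k: "k \<in> orb h" for k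
      proof
        assume a: "\<phi> g x \<in> k"
        have kV: "k \<subseteq> V" using orbh[OF k] halves_sub by blast
        have "x \<in> \<phi> (inv g) ` k" using a act_mem_inv[OF g kV xY(2)] by blast
        moreover have "\<phi> (inv g) ` k \<in> orb h"
          using k orb_act_mem g crossing_sub[OF hc] by simp
        ultimately show False using nz[of "\<phi> (inv g) ` k"] by argo
      qed
      moreover have "\<phi> g x \<in> Y" using Y(2) g xY unfolding invariant_def by blast
      ultimately show "\<phi> g x \<in> Z" unfolding Z_def using YV by blast
    qed
    moreover have "Z \<noteq> {}"
    proof -
      obtain w where "w \<in> Y" "\<forall>k\<in>orb h. w \<notin> k" using push_off_minimal[OF Y h n] by (rule bexE)
      then have "w \<in> Z" using YV unfolding Z_def by auto
      then show ?thesis by auto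
    qed
    ultimately have Z: "conv Z" "invariant Z" "Z \<noteq> {}" by simp_all
    have ZY: "Z \<subseteq> Y" unfolding Z_def by auto
    have sub: "crossing Z \<subseteq> crossing Y"
    proof
      fix k assume "k \<in> crossing Z"
      then show "k \<in> crossing Y" using ZY unfolding crossing_def by auto
    qed
    have "finite (orb ` crossing Z)" using finite_subset[OF image_mono[OF sub] fin] .
    then have le: "card (orb ` crossing Y) \<le> card (orb ` crossing Z)" using least[of Z] Z by simp
    have "orb h \<notin> orb ` crossing Z"
    proof
      assume "orb h \<in> orb ` crossing Z"
      then obtain k where k: "orb h = orb k" "k \<in> crossing Z" by (rule imageE)
      then have "k \<in> orb h" using orb_self[OF crossing_sub] by simp
      then have "k \<inter> Z = {}" unfolding Z_def by auto
      then show False using k(2) unfolding crossing_def by simp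
    qed
    moreover have "orb h \<in> orb ` crossing Y" using hc by (rule imageI)
    ultimately have "orb ` crossing Z \<subset> orb ` crossing Y" using image_mono[OF sub, of orb] by auto
    then have "card (orb ` crossing Z) < card (orb ` crossing Y)" by (rule psubset_card_mono[OF fin])
    then show False using le by simp
  qed
  \<comment> \<open>Take a minimal \<open>h\<close> inside \<open>k\<close> on \<open>Y\<close>. Its
    complement is minimal too and contains that of \<open>k\<close>, so both have the same trace on
    \<open>Y\<close>.\<close>
  have "minimal Y k" if k: "k \<in> crossing Y" for k
  proof -
    obtain h where h: "minimal Y h" "h \<inter> Y \<subseteq> k \<inter> Y" using exists_minimal[OF Y(1,2) fin k] by blast
    have kc: "V - k \<in> crossing Y" using crossing_compl YV k by blast
    have "\<not> (V - k) \<inter> Y \<subset> (V - h) \<inter> Y" using compl[OF h(1)] kc unfolding minimal_def by blast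
    then have "h \<inter> Y = k \<inter> Y" using h(2) YV by blast
    then show ?thesis using h(1) k unfolding minimal_def by simp
  qed
  then show ?thesis using Y by blast
qed

text \<open>The result of the group argument in the form needed to build the cube: the edges from
  \<open>v\<close> to \<open>N\<close> pairwise span squares, and they account for every halfspace
  at \<open>v\<close> that cuts \<open>Y\<close>.\<close>

lemma invariant_cube_corner:
  obtains Y v N where "conv Y" "invariant Y" "v \<in> Y" "finite N" "N \<subseteq> Y"
    "\<forall>a\<in>N. adj v a" "\<forall>a\<in>N. \<forall>b\<in>N. a \<noteq> b \<longrightarrow> (\<exists>c. sq v a c b)"
    "\<forall>h\<in>halves. v \<in> h \<longrightarrow> \<not> Y \<subseteq> h \<longrightarrow> (\<exists>a\<in>N. h = half v a)"
proof -
  obtain Y where Y: "conv Y" "invariant Y" "Y \<noteq> {}" and m: "\<And>h. h \<in> crossing Y \<Longrightarrow> minimal Y h"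
    using exists_all_minimal by blast
  obtain v where v: "v \<in> Y" using Y by blast
  define N where "N = {a \<in> Y. adj v a}"
  have mN: "minimal Y (half v a)" if "a \<in> N" for a
  proof -
    have a: "a \<in> Y" "adj v a" using that N_def by auto
    then have "half v a \<in> crossing Y" unfolding crossing_def halves_def using half_base[OF a(2)] v by blast
    then show ?thesis by (rule m)
  qed
  show thesis
  proof (rule that[of Y v N])
    have "N \<subseteq> {a. adj v a \<and> minimal Y (half v a)}" using mN N_def by blast
    then show "finite N" using finite_minimal_at[OF Y(1) v] finite_subset by blast
    show "\<forall>a\<in>N. \<forall>b\<in>N. a \<noteq> b \<longrightarrow> (\<exists>c. sq v a c b)"
      using minimal_square[OF Y(1) v _ mN _ mN] N_def by blast
    show "\<forall>h\<in>halves. v \<in> h \<longrightarrow> \<not> Y \<subseteq> h \<longrightarrow> (\<exists>a\<in>N. h = half v a)"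
    proof (intro ballI impI)
      fix h assume h: "h \<in> halves" "v \<in> h" "\<not> Y \<subseteq> h"
      have hm: "minimal Y h" by (rule m) (use h v crossing_def in blast)
      obtain x where "x \<in> Y" "adj v x" "h = half v x" by (rule minimal_adjacent[OF Y(1) v h(2) hm])
      then show "\<exists>a\<in>N. h = half v a" unfolding N_def by blast
    qed
  qed (use Y v N_def in auto)
qed

end

section \<open>Isometries of cubes and gluing maps\<close>

definition corner :: "nat \<Rightarrow> (nat \<Rightarrow> real) \<Rightarrow> bool" where
  "corner n w \<longleftrightarrow> (\<forall>i<n. w i \<in> {0, 1}) \<and> (\<forall>i\<ge>n. w i = 0)"

text \<open>A face seen from one of its corners \<open>w\<close>, with free coordinates
  \<open>I\<close>. Unlike the fixed values in \<open>is_cube_face\<close>, this turns inclusion and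
  equality of faces at a common corner into inclusion and equality of index sets.\<close>

definition face :: "nat \<Rightarrow> (nat \<Rightarrow> real) \<Rightarrow> nat set \<Rightarrow> (nat \<Rightarrow> real) set" where
  "face n w I = {x \<in> unit_cube n. \<forall>i. i \<notin> I \<longrightarrow> x i = w i}"

definition flip :: "nat set \<Rightarrow> (nat \<Rightarrow> real) \<Rightarrow> nat \<Rightarrow> real" where
  "flip S w = (\<lambda>i. if i \<in> S then 1 - w i else w i)"

lemma unit_cube_bounds: "x \<in> unit_cube n \<Longrightarrow> 0 \<le> x i \<and> x i \<le> 1"
  unfolding unit_cube_def by (cases "i < n") auto

lemma corner_01: "corner n w \<Longrightarrow> w i = 0 \<or> w i = 1"
  unfolding corner_def by (cases "i < n") auto

lemma corner_unit_cube: "corner n w \<Longrightarrow> w \<in> unit_cube n"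
  unfolding corner_def unit_cube_def by auto

lemma cornerI: "w \<in> unit_cube n \<Longrightarrow> (\<And>i. i < n \<Longrightarrow> w i = 0 \<or> w i = 1) \<Longrightarrow> corner n w"
  unfolding corner_def unit_cube_def by auto

lemma corner_flip: "corner n w \<Longrightarrow> S \<subseteq> {..<n} \<Longrightarrow> corner n (flip S w)"
  unfolding corner_def flip_def by auto

lemma flip_eq_iff: "corner n w \<Longrightarrow> flip S w = flip T w \<longleftrightarrow> S = T"
proof
  assume w: "corner n w" and e: "flip S w = flip T w"
  have "i \<in> S \<longleftrightarrow> i \<in> T" for i
    using fun_cong[OF e, of i] corner_01[OF w, of i] unfolding flip_def by (auto split: if_splits)
  then show "S = T" by auto
qed auto

lemma abs_flip: "corner n w \<Longrightarrow> \<bar>flip S w i - w i\<bar> = (if i \<in> S then 1 else 0)"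
  using corner_01[of n w i] unfolding flip_def by auto

lemma face_base: "corner n w \<Longrightarrow> w \<in> face n w I"
  unfolding face_def using corner_unit_cube by auto

lemma flip_face: "corner n w \<Longrightarrow> S \<subseteq> I \<Longrightarrow> I \<subseteq> {..<n} \<Longrightarrow> flip S w \<in> face n w I"
  unfolding face_def using corner_unit_cube[OF corner_flip[of n w S]] by (auto simp: flip_def)

lemma flip_face_iff: "corner n w \<Longrightarrow> flip S w \<in> face n w I \<Longrightarrow> S \<subseteq> I"
proof
  fix i assume w: "corner n w" and f: "flip S w \<in> face n w I" and i: "i \<in> S"
  show "i \<in> I"
  proof (rule ccontr)
    assume "i \<notin> I"
    then have "flip S w i = w i" using f unfolding face_def by blast
    then show False using corner_01[OF w, of i] i unfolding flip_def by auto
  qed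
qed

lemma face_mono: "I \<subseteq> K \<Longrightarrow> face n w I \<subseteq> face n w K"
  unfolding face_def by auto

lemma is_cube_face_face:
  assumes "corner n w" "I \<subseteq> {..<n}" shows "is_cube_face n (card I) (face n w I)"
  unfolding is_cube_face_def
proof (intro exI conjI)
  show "{..<n} - I \<subseteq> {..<n}" by auto
  show "card ({..<n} - I) + card I = n"
    using assms(2) card_mono[OF _ assms(2)] by (simp add: card_Diff_subset finite_subset[OF assms(2)])
  show "\<forall>i\<in>{..<n} - I. w i \<in> {0, 1}" using corner_01[OF assms(1)] by auto
  have "x i = w i" if "x \<in> unit_cube n" "\<forall>i\<in>{..<n} - I. x i = w i" "i \<notin> I" for x i
    using that assms(1) unfolding unit_cube_def corner_def by (cases "i < n") auto
  then show "face n w I = {x \<in> unit_cube n. \<forall>i\<in>{..<n} - I. x i = w i}" unfolding face_def by auto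
qed

lemma unit_cube_face: "corner n w \<Longrightarrow> face n w {..<n} = unit_cube n"
  unfolding face_def corner_def by (auto simp: unit_cube_def)

lemma is_cube_face_unit_cube: "is_cube_face n n (unit_cube n)"
  unfolding is_cube_face_def by (intro exI[of _ "{}"]) auto

text \<open>On the coordinates fixed by the face, \<open>x\<close> has value 0 or 1 and differs from
  the corner by less than 1, so the two agree there.\<close>

lemma cube_face_near:
  assumes F: "is_cube_face n k F" and w: "corner n w" and x: "x \<in> F" "\<And>i. i < n \<Longrightarrow> \<bar>x i - w i\<bar> < 1"
  shows "w \<in> F"
proof -
  obtain J a where J: "J \<subseteq> {..<n}" "\<forall>i\<in>J. a i \<in> {0, 1}" "F = {x \<in> unit_cube n. \<forall>i\<in>J. x i = a i}"
    using F unfolding is_cube_face_def by auto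
  have "w i = a i" if "i \<in> J" for i
  proof -
    have "x i = a i" "a i \<in> {0, 1}" using J x(1) that by auto
    moreover have "\<bar>x i - w i\<bar> < 1" using x(2) J(1) that by auto
    ultimately show ?thesis using corner_01[OF w, of i] by auto
  qed
  then show ?thesis using J(3) corner_unit_cube[OF w] by auto
qed

lemma cube_face_at_corner:
  assumes F: "is_cube_face n k F" and w: "corner n w" "w \<in> F"
  obtains I where "I \<subseteq> {..<n}" "card I = k" "F = face n w I"
proof -
  obtain J a where J: "J \<subseteq> {..<n}" "card J + k = n" "F = {x \<in> unit_cube n. \<forall>i\<in>J. x i = a i}"
    using F unfolding is_cube_face_def by auto
  have wa: "w i = a i" if "i \<in> J" for i using w(2) J(3) that by auto
  have c: "card ({..<n} - J) = k" using J(1,2) by (simp add: card_Diff_subset finite_subset[OF J(1)])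
  have f: "F = face n w ({..<n} - J)"
  proof -
    have "(\<forall>i\<in>J. x i = a i) \<longleftrightarrow> (\<forall>i. i \<notin> {..<n} - J \<longrightarrow> x i = w i)" if x: "x \<in> unit_cube n" for x
    proof
      assume a: "\<forall>i\<in>J. x i = a i"
      show "\<forall>i. i \<notin> {..<n} - J \<longrightarrow> x i = w i"
      proof (intro allI impI)
        fix i assume "i \<notin> {..<n} - J"
        then show "x i = w i" using x a w(1) wa[of i] unfolding unit_cube_def corner_def by (cases "i < n") auto
      qed
    next
      assume a: "\<forall>i. i \<notin> {..<n} - J \<longrightarrow> x i = w i"
      show "\<forall>i\<in>J. x i = a i"
      proof
        fix i assume i: "i \<in> J"
        then have "x i = w i" using a by blast
        then show "x i = a i" using wa[OF i] by simp
      qed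
    qed
    then show ?thesis unfolding J(3) face_def by blast
  qed
  show thesis by (rule that[OF Diff_subset c f])
qed

lemma cube_face_corner_exists:
  assumes "is_cube_face n k F" obtains w where "corner n w" "w \<in> F"
proof -
  obtain J a where J: "J \<subseteq> {..<n}" "\<forall>i\<in>J. a i \<in> {0, 1}" "F = {x \<in> unit_cube n. \<forall>i\<in>J. x i = a i}"
    using assms unfolding is_cube_face_def by auto
  define w where "w = (\<lambda>i. if i \<in> J then a i else 0 :: real)"
  have "corner n w" using J(1,2) unfolding corner_def w_def by auto
  moreover then have "w \<in> F" unfolding J(3) using corner_unit_cube by (auto simp: w_def)
  ultimately show thesis by (rule that)
qed

section \<open>Rigidity of isometries between faces\<close>

definition sqd :: "nat \<Rightarrow> (nat \<Rightarrow> real) \<Rightarrow> (nat \<Rightarrow> real) \<Rightarrow> real" where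
  "sqd n x y = (\<Sum>i<n. (x i - y i)\<^sup>2)"

lemma cube_dist_eq_iff: "cube_dist m x y = cube_dist n x' y' \<longleftrightarrow> sqd m x y = sqd n x' y'"
  unfolding cube_dist_def L2_set_def sqd_def by simp

lemma sqd_face:
  assumes "I \<subseteq> {..<n}" "x \<in> face n w I" "y \<in> face n w I" shows "sqd n x y = (\<Sum>i\<in>I. (x i - y i)\<^sup>2)"
  unfolding sqd_def using assms by (intro sum.mono_neutral_right) (auto simp: face_def)

lemma sq_diff_le_1:
  fixes a b :: real assumes "0 \<le> a" "a \<le> 1" "0 \<le> b" "b \<le> 1" shows "(a - b)\<^sup>2 \<le> 1"
  using assms by (intro power_le_one_iff[THEN iffD2] abs_square_le_1[THEN iffD2]) auto

lemma sqd_face_le: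
  assumes "I \<subseteq> {..<n}" "x \<in> face n w I" "y \<in> face n w I" shows "sqd n x y \<le> card I"
proof -
  have "(\<Sum>i\<in>I. (x i - y i)\<^sup>2) \<le> (\<Sum>i\<in>I. 1)"
    using assms unit_cube_bounds by (intro sum_mono sq_diff_le_1) (auto simp: face_def)
  then show ?thesis using sqd_face[OF assms] by simp
qed

lemma sqd_flip:
  assumes "corner n w" "S \<subseteq> {..<n}" "T \<subseteq> {..<n}"
  shows "sqd n (flip S w) (flip T w) = card ((S - T) \<union> (T - S))"
proof -
  define D where "D = (S - T) \<union> (T - S)"
  have "(flip S w i - flip T w i)\<^sup>2 = (if i \<in> D then 1 else 0)" for i
    using corner_01[OF assms(1), of i] unfolding flip_def D_def by auto
  then have "sqd n (flip S w) (flip T w) = (\<Sum>i<n. if i \<in> D then 1 else 0)"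
    unfolding sqd_def by simp
  also have "\<dots> = (\<Sum>i\<in>{..<n} \<inter> D. 1)" by (rule sum.inter_restrict[symmetric]) simp
  also have "{..<n} \<inter> D = D" using assms unfolding D_def by auto
  finally show ?thesis unfolding D_def by simp
qed

lemma flip_empty [simp]: "flip {} w = w"
  unfolding flip_def by auto

lemma sum_eq_card:
  fixes f :: "'a \<Rightarrow> real"
  assumes "finite I" "\<And>i. i \<in> I \<Longrightarrow> f i \<le> 1" "sum f I = card I" "i \<in> I" shows "f i = 1"
proof -
  have "(\<Sum>i\<in>I. 1 - f i) = 0" using assms(3) by (simp add: sum_subtractf)
  then have "\<forall>i\<in>I. 1 - f i = 0" using sum_nonneg_eq_0_iff[OF assms(1), of "\<lambda>i. 1 - f i"] assms(2) by auto
  then show ?thesis using assms(4) by auto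
qed

lemma corner_diff:
  assumes "corner n w" "corner n w'" shows "w' = flip {i. w i \<noteq> w' i} w" "{i. w i \<noteq> w' i} \<subseteq> {..<n}"
proof -
  show "w' = flip {i. w i \<noteq> w' i} w"
  proof
    fix i show "w' i = flip {i. w i \<noteq> w' i} w i"
      using corner_01[OF assms(1), of i] corner_01[OF assms(2), of i] unfolding flip_def by auto
  qed
  show "{i. w i \<noteq> w' i} \<subseteq> {..<n}"
  proof
    fix i assume "i \<in> {i. w i \<noteq> w' i}"
    then show "i \<in> {..<n}" using assms unfolding corner_def by (cases "i < n") auto
  qed
qed

text \<open>Opposite corners of a face are exactly the pairs at maximal distance, so an isometry maps corners
  to corners; a corner and its neighbours determine the coordinates of every point.\<close>

lemma face_isometry:
  assumes F: "is_cube_face n k F" and F': "is_cube_face m l F'" and h: "cube_isometry n F m F' h"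
    and w: "corner n w" "w \<in> F"
  obtains I I' \<sigma> where "I \<subseteq> {..<n}" "F = face n w I" "corner m (h w)" "I' \<subseteq> {..<m}" "F' = face m (h w) I'"
    "bij_betw \<sigma> I I'" "\<forall>x\<in>F. \<forall>i\<in>I. \<bar>h x (\<sigma> i) - h w (\<sigma> i)\<bar> = \<bar>x i - w i\<bar>"
proof -
  have hd: "sqd m (h x) (h y) = sqd n x y" if "x \<in> F" "y \<in> F" for x y
    using h that cube_dist_eq_iff unfolding cube_isometry_def by blast
  have hb: "bij_betw h F F'" using h unfolding cube_isometry_def by blast
  have hF: "h x \<in> F'" if "x \<in> F" for x using hb that bij_betwE by blast
  obtain I where I: "I \<subseteq> {..<n}" "card I = k" "F = face n w I" using cube_face_at_corner[OF F w] .
  obtain z where z: "corner m z" "z \<in> F'" using cube_face_corner_exists[OF F'] .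
  obtain I' where I': "I' \<subseteq> {..<m}" "card I' = l" "F' = face m z I'" using cube_face_at_corner[OF F' z] .
  have fin: "finite I" "finite I'" using I I' finite_subset by blast+
  have fl: "flip S w \<in> F" if "S \<subseteq> I" for S using flip_face[OF w(1) that I(1)] I(3) by simp
  \<comment> \<open>The squared diameter of a face is its dimension, so isometric faces have equal
    dimension.\<close>
  have "real k \<le> l"
  proof -
    have "real k = sqd n (flip {} w) (flip I w)" using sqd_flip[OF w(1), of "{}" I] I by simp
    also have "\<dots> = sqd m (h w) (h (flip I w))" using hd[OF w(2) fl[of I]] by simp
    also have "\<dots> \<le> l" using sqd_face_le[OF I'(1)] hF w(2) fl I' by blast
    finally show ?thesis .
  qed
  moreover have "real l \<le> k"
  proof -
    have "flip I' z \<in> F'" using flip_face[OF z(1) _ I'(1)] I'(3) by simp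
    then obtain x y where xy: "x \<in> F" "y \<in> F" "h x = z" "h y = flip I' z"
      using hb z(2) unfolding bij_betw_def by (metis imageE)
    have "real l = sqd m (flip {} z) (flip I' z)" using sqd_flip[OF z(1), of "{}" I'] I' by simp
    also have "\<dots> = sqd n x y" using hd[OF xy(1,2)] xy(3,4) by simp
    also have "\<dots> \<le> k" using sqd_face_le[OF I(1)] xy I by blast
    finally show ?thesis .
  qed
  ultimately have kl: "l = k" by simp
  have hcorner: "corner m (h (flip S w))" if S: "S \<subseteq> I" for S
  proof (rule cornerI)
    let ?c = "flip S w" and ?c' = "flip (I - S) w"
    have c: "?c \<in> F" "?c' \<in> F" using fl S by auto
    show "h ?c \<in> unit_cube m" using hF[OF c(1)] I'(3) face_def by blast
    fix j assume "j < m"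
    \<comment> \<open>The opposite corner is at squared distance equal to the dimension. In the
      image each free coordinate contributes at most 1, so each contributes exactly 1, which forces
      the values 0 and 1.\<close>
    have "sqd n ?c ?c' = card ((S - (I - S)) \<union> ((I - S) - S))" using S I(1) by (intro sqd_flip[OF w(1)]) auto
    also have "(S - (I - S)) \<union> ((I - S) - S) = I" using S by auto
    finally have "sqd m (h ?c) (h ?c') = card I'" using hd[OF c] I(2) I'(2) kl by simp
    then have s: "(\<Sum>i\<in>I'. (h ?c i - h ?c' i)\<^sup>2) = card I'"
      using sqd_face[OF I'(1)] hF c I'(3) by metis
    have b: "0 \<le> h x i \<and> h x i \<le> 1" if "x \<in> F" for x i
      using hF[OF that] I'(3) unit_cube_bounds unfolding face_def by blast
    show "h ?c j = 0 \<or> h ?c j = 1"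
    proof (cases "j \<in> I'")
      case True
      have "(h ?c j - h ?c' j)\<^sup>2 = 1"
        by (rule sum_eq_card[OF fin(2) _ s True]) (use b c in \<open>auto intro!: sq_diff_le_1\<close>)
      then have "h ?c j - h ?c' j = 1 \<or> h ?c j - h ?c' j = -1" by (simp add: power2_eq_1_iff)
      then show ?thesis using b[OF c(1), of j] b[OF c(2), of j] by auto
    next
      case False
      then have "h ?c j = z j" using hF[OF c(1)] I'(3) unfolding face_def by auto
      then show ?thesis using corner_01[OF z(1)] by simp
    qed
  qed
  define w' where "w' = h w"
  have w': "corner m w'" "w' \<in> F'" using hcorner[of "{}"] hF[OF w(2)] unfolding w'_def by auto
  have F'w: "F' = face m w' I'" using w'(2) unfolding I'(3) face_def by auto
  \<comment> \<open>Neighbouring corners are at squared distance 1, and between corners that number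
    counts the differing coordinates. This defines the matching of directions.\<close>
  have "\<exists>j\<in>I'. h (flip {i} w) = flip {j} w'" if i: "i \<in> I" for i
  proof -
    let ?D = "{j. w' j \<noteq> h (flip {i} w) j}"
    have c: "corner m (h (flip {i} w))" using hcorner i by auto
    note D = corner_diff[OF w'(1) c]
    have "sqd m w' (h (flip {i} w)) = sqd n w (flip {i} w)"
      using hd[OF w(2) fl[of "{i}"]] i unfolding w'_def by simp
    also have "\<dots> = 1" using sqd_flip[OF w(1), of "{}" "{i}"] i I(1) by auto
    finally have "sqd m (flip {} w') (flip ?D w') = 1" using D(1) by simp
    then have "card ?D = 1" using sqd_flip[OF w'(1) _ D(2), of "{}"] by simp
    then obtain j where j: "?D = {j}" using card_1_singletonE by blast
    have "flip {j} w' \<in> face m w' I'" using hF[OF fl[of "{i}"]] i D(1) j F'w by auto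
    then have "j \<in> I'" using flip_face_iff[OF w'(1)] by blast
    then show ?thesis using D(1) j by auto
  qed
  then obtain \<sigma> where \<sigma>: "\<And>i. i \<in> I \<Longrightarrow> \<sigma> i \<in> I'" "\<And>i. i \<in> I \<Longrightarrow> h (flip {i} w) = flip {\<sigma> i} w'" by metis
  have "inj_on \<sigma> I"
  proof (rule inj_onI)
    fix i j assume ij: "i \<in> I" "j \<in> I" "\<sigma> i = \<sigma> j"
    then have "h (flip {i} w) = h (flip {j} w)" using \<sigma>(2)[OF ij(1)] \<sigma>(2)[OF ij(2)] by simp
    moreover have "flip {i} w \<in> F" "flip {j} w \<in> F" by (rule fl, use ij in blast)+
    ultimately have "flip {i} w = flip {j} w" by (rule inj_onD[OF bij_betw_imp_inj_on[OF hb]])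
    then show "i = j" using flip_eq_iff[OF w(1), of "{i}" "{j}"] by simp
  qed
  moreover have "\<sigma> ` I = I'"
    using \<sigma>(1) card_image[OF \<open>inj_on \<sigma> I\<close>] I(2) I'(2) kl fin by (intro card_subset_eq) auto
  ultimately have bij: "bij_betw \<sigma> I I'" unfolding bij_betw_def by blast
  have "\<forall>x\<in>F. \<forall>i\<in>I. \<bar>h x (\<sigma> i) - w' (\<sigma> i)\<bar> = \<bar>x i - w i\<bar>"
  proof (intro ballI)
    fix x i assume x: "x \<in> F" and i: "i \<in> I"
    \<comment> \<open>Comparing the distances to a corner and to its \<open>i\<close>-th neighbour
      cancels all other coordinates and leaves an affine function of the \<open>i\<close>-th
      deviation.\<close>
    have gen: "sqd n x w - sqd n x (flip {i} w) = 2 * \<bar>x i - w i\<bar> - 1"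
      if "x \<in> unit_cube n" "corner n w" "i < n" for n x w i
    proof -
      have "sqd n x w = (x i - w i)\<^sup>2 + (\<Sum>j\<in>{..<n} - {i}. (x j - w j)\<^sup>2)"
        "sqd n x (flip {i} w) = (x i - flip {i} w i)\<^sup>2 + (\<Sum>j\<in>{..<n} - {i}. (x j - flip {i} w j)\<^sup>2)"
        unfolding sqd_def using that(3) by (simp_all add: sum.remove)
      moreover have "(\<Sum>j\<in>{..<n} - {i}. (x j - flip {i} w j)\<^sup>2) = (\<Sum>j\<in>{..<n} - {i}. (x j - w j)\<^sup>2)"
        by (rule sum.cong) (auto simp: flip_def)
      moreover have "(x i - w i)\<^sup>2 - (x i - flip {i} w i)\<^sup>2 = 2 * \<bar>x i - w i\<bar> - 1"
        using corner_01[OF that(2), of i] unit_cube_bounds[OF that(1), of i]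
        by (auto simp: flip_def power2_eq_square algebra_simps)
      ultimately show ?thesis by simp
    qed
    have U: "x \<in> unit_cube n" "h x \<in> unit_cube m" using x hF[OF x] I I' unfolding face_def by auto
    have "2 * \<bar>h x (\<sigma> i) - w' (\<sigma> i)\<bar> - 1 = sqd m (h x) w' - sqd m (h x) (flip {\<sigma> i} w')"
      using gen[OF U(2) w'(1), of "\<sigma> i"] \<sigma>(1)[OF i] I'(1) by auto
    also have "\<dots> = sqd n x w - sqd n x (flip {i} w)"
      using hd[OF x w(2)] hd[OF x fl[of "{i}"]] \<sigma>(2)[OF i] i unfolding w'_def by simp
    also have "\<dots> = 2 * \<bar>x i - w i\<bar> - 1" using gen[OF U(1) w(1), of i] i I(1) by auto
    finally show "\<bar>h x (\<sigma> i) - w' (\<sigma> i)\<bar> = \<bar>x i - w i\<bar>" by simp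
  qed
  then show thesis using that[OF I(1,3) _ I'(1) _ bij] w'(1) F'w unfolding w'_def by blast
qed

lemma corner_near_exists:
  assumes "x \<in> unit_cube n" obtains w where "corner n w" "\<And>i. i < n \<Longrightarrow> \<bar>x i - w i\<bar> < 1"
proof -
  \<comment> \<open>Rounding to 0 is within distance less than 1 of every coordinate value except
    1.\<close>
  define w where "w = (\<lambda>i. if x i = 1 then 1 else 0 :: real)"
  have "corner n w" using assms unfolding corner_def w_def unit_cube_def by auto
  moreover have "\<bar>x i - w i\<bar> < 1" for i using unit_cube_bounds[OF assms, of i] unfolding w_def by auto
  ultimately show thesis using that by blast
qed

lemma face_point_unique:
  assumes "corner m w" "x \<in> face m w I" "y \<in> face m w I" "\<And>i. i \<in> I \<Longrightarrow> \<bar>x i - w i\<bar> = \<bar>y i - w i\<bar>"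
  shows "x = y"
proof
  fix i
  have "0 \<le> x i \<and> x i \<le> 1" "0 \<le> y i \<and> y i \<le> 1"
    using assms unit_cube_bounds unfolding face_def by blast+
  then show "x i = y i"
    using assms(2-4) corner_01[OF assms(1), of i] unfolding face_def by (cases "i \<in> I") force+
qed

section \<open>Charts of a cubical complex\<close>

locale cube_cpx =
  fixes X :: "'a set" and A :: "(nat \<times> ((nat \<Rightarrow> real) \<Rightarrow> 'a)) set"
  assumes cubical: "cubical_complex X A"
begin

lemma chart_inj: "(n, p) \<in> A \<Longrightarrow> inj_on p (unit_cube n)"
  using cubical unfolding cubical_complex_def by fast

lemma chart_eq_iff: "(n, p) \<in> A \<Longrightarrow> x \<in> unit_cube n \<Longrightarrow> y \<in> unit_cube n \<Longrightarrow> p x = p y \<longleftrightarrow> x = y"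
  using chart_inj inj_on_eq_iff by metis

lemma chart_exists: assumes "x \<in> X" obtains n p y where "(n, p) \<in> A" "y \<in> unit_cube n" "x = p y"
  using assms cubical unfolding cubical_complex_def by fast

lemma chart_X: "(n, p) \<in> A \<Longrightarrow> y \<in> unit_cube n \<Longrightarrow> p y \<in> X"
  using cubical unfolding cubical_complex_def by fast

lemma gluing:
  assumes "(n, p) \<in> A" "(m, q) \<in> A" "p ` unit_cube n \<inter> q ` unit_cube m \<noteq> {}"
  shows "\<exists>k l F F' h. is_cube_face n k F \<and> is_cube_face m l F' \<and> cube_isometry n F m F' h \<and>
           (\<forall>x\<in>unit_cube n. \<forall>y\<in>unit_cube m. p x = q y \<longleftrightarrow> x \<in> F \<and> y = h x)"
proof -
  from cubical have "\<forall>(n, p)\<in>A. \<forall>(m, q)\<in>A. p ` unit_cube n \<inter> q ` unit_cube m \<noteq> {} \<longrightarrow>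
        (\<exists>k l F F' h. is_cube_face n k F \<and> is_cube_face m l F' \<and> cube_isometry n F m F' h \<and>
           (\<forall>x\<in>unit_cube n. \<forall>y\<in>unit_cube m. p x = q y \<longleftrightarrow> x \<in> F \<and> y = h x))"
    unfolding cubical_complex_def by (elim conjE)
  from bspec[OF bspec[OF this assms(1), unfolded prod.case] assms(2), unfolded prod.case] assms(3)
  show ?thesis by (rule mp)
qed

end

section \<open>Links and cubes at a vertex\<close>

lemma flip_disjoint: "S \<inter> T = {} \<Longrightarrow> flip S (flip T w) = flip (S \<union> T) w"
  unfolding flip_def by (auto simp: fun_eq_iff)

lemma flip_insert: "i \<notin> S \<Longrightarrow> flip {i} (flip S w) = flip (insert i S) w"
  using flip_disjoint[of "{i}" S w] by simp

lemma flip_twice: "flip {i} (flip {i} w) = w"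
  unfolding flip_def by (auto simp: fun_eq_iff)

definition center :: "nat set \<Rightarrow> (nat \<Rightarrow> real) \<Rightarrow> nat \<Rightarrow> real" where
  "center K w = (\<lambda>i. if i \<in> K then 1/2 else w i)"

lemma center_face:
  assumes w: "corner n w" and K: "K \<subseteq> I" "I \<subseteq> {..<n}" shows "center K w \<in> face n w I"
proof -
  have "center K w \<in> unit_cube n"
    using corner_unit_cube[OF w] K unfolding unit_cube_def center_def by auto
  then show ?thesis using K unfolding face_def center_def by auto
qed

lemma abs_center: "corner n w \<Longrightarrow> \<bar>center K w i - w i\<bar> = (if i \<in> K then 1/2 else 0)"
  using corner_01[of n w i] unfolding center_def by auto

lemma face_eq_iff:
  assumes "corner n w" "I \<subseteq> {..<n}" "K \<subseteq> {..<n}" shows "face n w I = face n w K \<longleftrightarrow> I = K"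
proof
  assume e: "face n w I = face n w K"
  have "flip I w \<in> face n w K" "flip K w \<in> face n w I"
    using flip_face[OF assms(1) order_refl assms(2)] flip_face[OF assms(1) order_refl assms(3)] e by auto
  then show "I = K" using flip_face_iff[OF assms(1)] by blast
qed simp

lemma finite_corners: "finite {w. corner n w}"
proof -
  have z: "corner n (\<lambda>_. 0)" unfolding corner_def by simp
  have "{w. corner n w} \<subseteq> (\<lambda>S. flip S (\<lambda>_. 0)) ` Pow {..<n}"
  proof
    fix w assume "w \<in> {w. corner n w}"
    then have "corner n w" by simp
    note corner_diff[OF z this]
    then show "w \<in> (\<lambda>S. flip S (\<lambda>_. 0)) ` Pow {..<n}" by (intro image_eqI[of _ _ "{i. 0 \<noteq> w i}"]) auto
  qed
  then show ?thesis by (rule finite_subset) simp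
qed

lemma face_unit_cube: "face n w I \<subseteq> unit_cube n"
  unfolding face_def by auto

text \<open>Two parametrised cubes \<open>p\<close> and \<open>q\<close> agree exactly along faces at the corners \<open>w\<close> and \<open>w'\<close>,
  which are identified by matching coordinates relative to these corners.\<close>

definition aligned ::
  "nat \<Rightarrow> ((nat \<Rightarrow> real) \<Rightarrow> 'a) \<Rightarrow> (nat \<Rightarrow> real) \<Rightarrow> nat \<Rightarrow> ((nat \<Rightarrow> real) \<Rightarrow> 'a) \<Rightarrow> (nat \<Rightarrow> real) \<Rightarrow>
    nat set \<Rightarrow> nat set \<Rightarrow> (nat \<Rightarrow> nat) \<Rightarrow> bool" where
  "aligned n p w m q w' I I' \<sigma> \<longleftrightarrow> corner n w \<and> corner m w' \<and> p w = q w' \<and> I \<subseteq> {..<n} \<and> I' \<subseteq> {..<m} \<and>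
     bij_betw \<sigma> I I' \<and>
     (\<forall>x\<in>unit_cube n. \<forall>y\<in>unit_cube m. p x = q y \<longleftrightarrow>
        x \<in> face n w I \<and> y \<in> face m w' I' \<and> (\<forall>i\<in>I. \<bar>y (\<sigma> i) - w' (\<sigma> i)\<bar> = \<bar>x i - w i\<bar>)) \<and>
     p ` face n w I = q ` face m w' I'"

text \<open>A point of \<open>F'\<close> is determined by how far its coordinates deviate from the
  corner \<open>h w\<close>. So \<open>y = h x\<close> just says that deviations match under
  \<open>\<sigma>\<close>, and the isometry itself can be forgotten.\<close>

lemma aligned_isometry:
  assumes g: "is_cube_face n k F" "is_cube_face m l F'" "cube_isometry n F m F' h" and w: "corner n w" "w \<in> F"
    and eq: "\<And>x y. x \<in> unit_cube n \<Longrightarrow> y \<in> unit_cube m \<Longrightarrow> p x = q y \<longleftrightarrow> x \<in> F \<and> y = h x"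
  obtains I I' \<sigma> where "aligned n p w m q (h w) I I' \<sigma>" "F = face n w I"
proof -
  obtain I I' \<sigma> where I: "I \<subseteq> {..<n}" "F = face n w I" "corner m (h w)" "I' \<subseteq> {..<m}" "F' = face m (h w) I'"
    "bij_betw \<sigma> I I'" "\<forall>x\<in>F. \<forall>i\<in>I. \<bar>h x (\<sigma> i) - h w (\<sigma> i)\<bar> = \<bar>x i - w i\<bar>"
    by (rule face_isometry[OF g w])
  have hb: "bij_betw h F F'" using g(3) unfolding cube_isometry_def by blast
  have FU: "F \<subseteq> unit_cube n" "F' \<subseteq> unit_cube m" unfolding I(2,5) by (rule face_unit_cube)+
  have ph: "p x = q (h x)" if "x \<in> F" for x
    using eq[of x "h x"] that FU bij_betwE[OF hb] by blast
  have "p x = q y \<longleftrightarrow> x \<in> F \<and> y \<in> F' \<and> (\<forall>i\<in>I. \<bar>y (\<sigma> i) - h w (\<sigma> i)\<bar> = \<bar>x i - w i\<bar>)"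
    if x: "x \<in> unit_cube n" and y: "y \<in> unit_cube m" for x y
  proof
    assume "p x = q y"
    then have "x \<in> F" "y = h x" using eq[OF x y] by auto
    then show "x \<in> F \<and> y \<in> F' \<and> (\<forall>i\<in>I. \<bar>y (\<sigma> i) - h w (\<sigma> i)\<bar> = \<bar>x i - w i\<bar>)"
      using I(7) bij_betwE[OF hb] by auto
  next
    assume a: "x \<in> F \<and> y \<in> F' \<and> (\<forall>i\<in>I. \<bar>y (\<sigma> i) - h w (\<sigma> i)\<bar> = \<bar>x i - w i\<bar>)"
    then have xF: "x \<in> F" by simp
    have "y = h x"
    proof (rule face_point_unique[OF I(3)])
      show "y \<in> face m (h w) I'" using a I(5) by blast
      show "h x \<in> face m (h w) I'" using bij_betwE[OF hb] xF I(5) by auto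
      fix j assume "j \<in> I'"
      then obtain i where i: "i \<in> I" "j = \<sigma> i" using I(6) unfolding bij_betw_def by blast
      then show "\<bar>y j - h w j\<bar> = \<bar>h x j - h w j\<bar>" using a I(7) xF by simp
    qed
    then show "p x = q y" using ph[OF xF] by simp
  qed
  moreover have "p ` F = q ` F'"
    using ph hb unfolding bij_betw_def by force
  ultimately have "aligned n p w m q (h w) I I' \<sigma>"
    unfolding aligned_def I(2)[symmetric] I(5)[symmetric] using w(1) I ph[OF w(2)] by blast
  then show thesis using I(2) by (rule that)
qed

context cube_cpx
begin

text \<open>The gluing face contains a point close to \<open>w\<close>, hence \<open>w\<close> by
  \<open>cube_face_near\<close>.\<close>

lemma aligned_near:
  assumes A: "(n, p) \<in> A" "(m, q) \<in> A" and w: "corner n w"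
    and x: "x \<in> unit_cube n" "\<And>i. i < n \<Longrightarrow> \<bar>x i - w i\<bar> < 1" and y: "y \<in> unit_cube m" "p x = q y"
  obtains w' I I' \<sigma> where "aligned n p w m q w' I I' \<sigma>"
proof -
  have "p ` unit_cube n \<inter> q ` unit_cube m \<noteq> {}" using x(1) y by blast
  from gluing[OF A this] obtain k l F F' h where
    g: "is_cube_face n k F" "is_cube_face m l F'" "cube_isometry n F m F' h"
      "\<And>x y. x \<in> unit_cube n \<Longrightarrow> y \<in> unit_cube m \<Longrightarrow> p x = q y \<longleftrightarrow> x \<in> F \<and> y = h x" by metis
  have "x \<in> F" using g(4)[OF x(1) y(1)] y(2) by blast
  then have "w \<in> F" using cube_face_near[OF g(1) w] x(2) by blast
  from aligned_isometry[OF g(1-3) w this g(4)] that show thesis by metis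
qed

lemma aligned_corner:
  assumes A: "(n, p) \<in> A" "(m, q) \<in> A" and w: "corner n w" and y: "y \<in> unit_cube m" "p w = q y"
  obtains I I' \<sigma> where "aligned n p w m q y I I' \<sigma>"
proof -
  obtain w' I I' \<sigma> where al: "aligned n p w m q w' I I' \<sigma>"
    by (rule aligned_near[OF A w corner_unit_cube[OF w] _ y]) auto
  then have "corner m w'" "q y = q w'" using y unfolding aligned_def by auto
  then have "y = w'" using chart_eq_iff[OF A(2)] y corner_unit_cube by blast
  then show thesis using that al by blast
qed

lemma aligned_iff:
  assumes "aligned n p w m q w' I I' \<sigma>" "x \<in> unit_cube n" "y \<in> unit_cube m"
  shows "p x = q y \<longleftrightarrow> x \<in> face n w I \<and> y \<in> face m w' I' \<and> (\<forall>i\<in>I. \<bar>y (\<sigma> i) - w' (\<sigma> i)\<bar> = \<bar>x i - w i\<bar>)"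
  using assms unfolding aligned_def by blast

lemma aligned_flip:
  assumes al: "aligned n p w m q w' I I' \<sigma>" and S: "S \<subseteq> I"
  shows "q (flip (\<sigma> ` S) w') = p (flip S w)" "\<sigma> ` S \<subseteq> {..<m}"
proof -
  have a: "corner n w" "corner m w'" "I \<subseteq> {..<n}" "I' \<subseteq> {..<m}" "bij_betw \<sigma> I I'"
    using al unfolding aligned_def by auto
  have SI': "\<sigma> ` S \<subseteq> I'" using a(5) S unfolding bij_betw_def by auto
  then show "\<sigma> ` S \<subseteq> {..<m}" using a(4) by blast
  have f: "flip S w \<in> face n w I" "flip (\<sigma> ` S) w' \<in> face m w' I'"
    using flip_face[OF a(1) S a(3)] flip_face[OF a(2) SI' a(4)] by auto
  have "\<sigma> i \<in> \<sigma> ` S \<longleftrightarrow> i \<in> S" if "i \<in> I" for i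
    using inj_on_image_mem_iff[OF bij_betw_imp_inj_on[OF a(5)] that S] .
  then have "\<forall>i\<in>I. \<bar>flip (\<sigma> ` S) w' (\<sigma> i) - w' (\<sigma> i)\<bar> = \<bar>flip S w i - w i\<bar>"
    using abs_flip[OF a(1)] abs_flip[OF a(2)] by simp
  moreover have "flip S w \<in> unit_cube n" "flip (\<sigma> ` S) w' \<in> unit_cube m" using f face_def by auto
  ultimately show "q (flip (\<sigma> ` S) w') = p (flip S w)" using aligned_iff[OF al] f by metis
qed

lemma aligned_index:
  assumes A: "(m, q) \<in> A" and al: "aligned n p w m q w' I I' \<sigma>"
    and S: "S \<subseteq> {..<n}" and y: "y \<in> unit_cube m" "p (flip S w) = q y"
  shows "S \<subseteq> I" "y = flip (\<sigma> ` S) w'"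
proof -
  have a: "corner n w" "corner m w'" using al unfolding aligned_def by auto
  have "flip S w \<in> face n w I"
    using aligned_iff[OF al corner_unit_cube[OF corner_flip[OF a(1) S]] y(1)] y(2) by blast
  then show SI: "S \<subseteq> I" using flip_face_iff a by blast
  have "q y = q (flip (\<sigma> ` S) w')" using aligned_flip(1)[OF al SI] y by simp
  then show "y = flip (\<sigma> ` S) w'"
    using chart_eq_iff[OF A y(1) corner_unit_cube[OF corner_flip[OF a(2) aligned_flip(2)[OF al SI]]]] by blast
qed

lemma aligned_face:
  assumes al: "aligned n p w m q w' I I' \<sigma>" and K: "K \<subseteq> I"
  shows "p ` face n w K = q ` face m w' (\<sigma> ` K)"
proof -
  have a: "corner n w" "corner m w'" "I \<subseteq> {..<n}" "I' \<subseteq> {..<m}" "bij_betw \<sigma> I I'" "p ` face n w I = q ` face m w' I'"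
    using al unfolding aligned_def by auto
  have im: "\<sigma> ` K \<subseteq> I'" "\<sigma> ` I = I'" using a(5) K unfolding bij_betw_def by auto
  have inj: "inj_on \<sigma> I" using a(5) bij_betw_imp_inj_on by blast
  have key: "x \<in> face n w K \<longleftrightarrow> y \<in> face m w' (\<sigma> ` K)" if xy: "x \<in> face n w I" "y \<in> face m w' I'" "p x = q y" for x y
  proof -
    have U: "x \<in> unit_cube n" "y \<in> unit_cube m" using xy face_def by auto
    have rel: "x i = w i \<longleftrightarrow> y (\<sigma> i) = w' (\<sigma> i)" if "i \<in> I" for i
    proof -
      have "\<bar>y (\<sigma> i) - w' (\<sigma> i)\<bar> = \<bar>x i - w i\<bar>" using aligned_iff[OF al U] xy(3) that by blast
      then show ?thesis by linarith
    qed
    have "(\<forall>i. i \<notin> K \<longrightarrow> x i = w i) \<longleftrightarrow> (\<forall>i\<in>I - K. x i = w i)"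
      using xy(1) unfolding face_def by auto
    also have "\<dots> \<longleftrightarrow> (\<forall>i\<in>I - K. y (\<sigma> i) = w' (\<sigma> i))" using rel by auto
    also have "\<dots> \<longleftrightarrow> (\<forall>j\<in>\<sigma> ` (I - K). y j = w' j)" by auto
    also have "\<sigma> ` (I - K) = I' - \<sigma> ` K" using inj_on_image_set_diff[OF inj, of I K] K im by auto
    also have "(\<forall>j\<in>I' - \<sigma> ` K. y j = w' j) \<longleftrightarrow> (\<forall>j. j \<notin> \<sigma> ` K \<longrightarrow> y j = w' j)"
      using xy(2) unfolding face_def by auto
    finally show ?thesis using U unfolding face_def by simp
  qed
  show ?thesis
  proof (intro subset_antisym subsetI)
    fix z assume "z \<in> p ` face n w K"
    then obtain x where x: "x \<in> face n w K" "z = p x" by blast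
    then have xI: "x \<in> face n w I" using face_mono[OF K] by blast
    then have "p x \<in> q ` face m w' I'" using a(6) by blast
    then obtain y where y: "y \<in> face m w' I'" "p x = q y" by blast
    then show "z \<in> q ` face m w' (\<sigma> ` K)" using key[OF xI y] x by blast
  next
    fix z assume "z \<in> q ` face m w' (\<sigma> ` K)"
    then obtain y where y: "y \<in> face m w' (\<sigma> ` K)" "z = q y" by blast
    then have yI: "y \<in> face m w' I'" using face_mono[OF im(1)] by blast
    then have "q y \<in> p ` face n w I" using a(6) by blast
    then obtain x where x: "x \<in> face n w I" "q y = p x" by blast
    then show "z \<in> p ` face n w K" using key[OF x(1) yI] y by auto
  qed
qed

lemma aligned_center:
  assumes al: "aligned n p w m q w' I I' \<sigma>" and K: "K \<subseteq> I"
  shows "p (center K w) = q (center (\<sigma> ` K) w')"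
proof -
  have a: "corner n w" "corner m w'" "I \<subseteq> {..<n}" "I' \<subseteq> {..<m}" "bij_betw \<sigma> I I'"
    using al unfolding aligned_def by auto
  have "\<sigma> ` K \<subseteq> I'" using a(5) K unfolding bij_betw_def by auto
  then have c: "center K w \<in> face n w I" "center (\<sigma> ` K) w' \<in> face m w' I'"
    using center_face[OF a(1) K a(3)] center_face[OF a(2) _ a(4)] by auto
  have "\<sigma> i \<in> \<sigma> ` K \<longleftrightarrow> i \<in> K" if "i \<in> I" for i
    using inj_on_image_mem_iff[OF bij_betw_imp_inj_on[OF a(5)] that K] .
  then have "\<forall>i\<in>I. \<bar>center (\<sigma> ` K) w' (\<sigma> i) - w' (\<sigma> i)\<bar> = \<bar>center K w i - w i\<bar>"
    using abs_center[OF a(1)] abs_center[OF a(2)] by simp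
  then show ?thesis using aligned_iff[OF al] c face_unit_cube by blast
qed

lemma aligned_close:
  assumes al: "aligned n p w m q w' I I' \<sigma>" and x: "x \<in> unit_cube n" "\<forall>i<n. \<bar>x i - w i\<bar> < 1"
    and y: "y \<in> unit_cube m" "p x = q y"
  shows "\<bar>y j - w' j\<bar> < 1"
proof (cases "j \<in> I'")
  case True
  then obtain i where i: "i \<in> I" "j = \<sigma> i" using al unfolding aligned_def bij_betw_def by blast
  then have "\<bar>y j - w' j\<bar> = \<bar>x i - w i\<bar>" using aligned_iff[OF al x(1) y(1)] y(2) by simp
  also have "\<dots> < 1" using x(2) i(1) al unfolding aligned_def by blast
  finally show ?thesis .
next
  case False
  then have "y j = w' j" using aligned_iff[OF al x(1) y(1)] y(2) unfolding face_def by blast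
  then show ?thesis by simp
qed

section \<open>Vertices, edges and squares of the complex\<close>

definition vadj :: "'a \<Rightarrow> 'a \<Rightarrow> bool" where
  "vadj u v \<longleftrightarrow> (\<exists>n p w i. (n, p) \<in> A \<and> corner n w \<and> i < n \<and> u = p w \<and> v = p (flip {i} w))"

definition vsq :: "'a \<Rightarrow> 'a \<Rightarrow> 'a \<Rightarrow> 'a \<Rightarrow> bool" where
  "vsq a b c d \<longleftrightarrow> (\<exists>n p w i j. (n, p) \<in> A \<and> corner n w \<and> i < n \<and> j < n \<and> i \<noteq> j \<and>
     a = p w \<and> b = p (flip {i} w) \<and> c = p (flip {i, j} w) \<and> d = p (flip {j} w))"

lemma vadjI: "(n, p) \<in> A \<Longrightarrow> corner n w \<Longrightarrow> i < n \<Longrightarrow> vadj (p w) (p (flip {i} w))"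
  unfolding vadj_def by blast

lemma vsqI: "(n, p) \<in> A \<Longrightarrow> corner n w \<Longrightarrow> i < n \<Longrightarrow> j < n \<Longrightarrow> i \<noteq> j \<Longrightarrow>
    vsq (p w) (p (flip {i} w)) (p (flip {i, j} w)) (p (flip {j} w))"
  unfolding vsq_def by blast

lemma vsq_flip:
  assumes A: "(n, p) \<in> A" and w: "corner n w" "T \<subseteq> {..<n}" and ij: "i < n" "j < n" "i \<noteq> j" "i \<notin> T" "j \<notin> T"
  shows "vsq (p (flip T w)) (p (flip (insert i T) w)) (p (flip (insert i (insert j T)) w)) (p (flip (insert j T) w))"
  using vsqI[OF A corner_flip[OF w] ij(1-3)] flip_insert[OF ij(4)] flip_insert[OF ij(5)]
    flip_disjoint[of "{i, j}" T w] ij by simp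

lemma vertex_iff: "v \<in> cc_vertices A \<longleftrightarrow> (\<exists>n p w. (n, p) \<in> A \<and> corner n w \<and> v = p w)"
proof
  assume "v \<in> cc_vertices A"
  then obtain n p F where F: "(n, p) \<in> A" "is_cube_face n 0 F" "{v} = p ` F"
    unfolding cc_vertices_def cubes_def by auto
  obtain w where "corner n w" "w \<in> F" using cube_face_corner_exists[OF F(2)] .
  moreover have "p w \<in> {v}" unfolding F(3) using \<open>w \<in> F\<close> by (rule imageI)
  ultimately show "\<exists>n p w. (n, p) \<in> A \<and> corner n w \<and> v = p w" using F(1) by blast
next
  assume "\<exists>n p w. (n, p) \<in> A \<and> corner n w \<and> v = p w"
  then obtain n p w where v: "(n, p) \<in> A" "corner n w" "v = p w" by blast
  have "x = w" if "x \<in> face n w {}" for x using that unfolding face_def by auto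
  then have "face n w {} = {w}" using face_base[OF v(2)] by blast
  then have "is_cube_face n 0 {w}" using is_cube_face_face[OF v(2), of "{}"] by simp
  then have "{v} \<in> cubes A 0" unfolding cubes_def using v by blast
  then show "v \<in> cc_vertices A" unfolding cc_vertices_def by simp
qed

text \<open>A vertex is a corner in some chart, and alignment carries corners to corners.\<close>

lemma vertex_at:
  assumes "(n, p) \<in> A" "p y \<in> cc_vertices A" "y \<in> unit_cube n" shows "corner n y"
proof -
  obtain m q w where "(m, q) \<in> A" "corner m w" "p y = q w" using assms(2) vertex_iff by blast
  then obtain I I' \<sigma> where "aligned m q w n p y I I' \<sigma>" using aligned_corner[OF _ assms(1) _ assms(3)] by metis
  then show ?thesis unfolding aligned_def by simp
qed

lemma vadj_sym: "vadj u v \<Longrightarrow> vadj v u"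
proof -
  assume "vadj u v"
  then obtain n p w i where u: "(n, p) \<in> A" "corner n w" "i < n" "u = p w" "v = p (flip {i} w)"
    unfolding vadj_def by blast
  then have "vadj (p (flip {i} w)) (p (flip {i} (flip {i} w)))" by (intro vadjI corner_flip) auto
  then show ?thesis using u flip_twice by simp
qed

lemma vadj_vertex: "vadj u v \<Longrightarrow> u \<in> cc_vertices A"
  unfolding vadj_def vertex_iff by blast

lemma vadj_irrefl: "\<not> vadj u u"
proof
  assume "vadj u u"
  then obtain n p w i where u: "(n, p) \<in> A" "corner n w" "i < n" "p w = p (flip {i} w)"
    unfolding vadj_def by blast
  have c: "corner n (flip {i} w)" using corner_flip[OF u(2), of "{i}"] u(3) by simp
  have "flip {} w = flip {i} w"
    using chart_eq_iff[OF u(1) corner_unit_cube[OF u(2)] corner_unit_cube[OF c]] u(4) by simp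
  then show False using flip_eq_iff[OF u(2), of "{}" "{i}"] by simp
qed

lemma vsq_refl: "vsq a b c d \<Longrightarrow> vsq a d c b"
proof -
  assume "vsq a b c d"
  then obtain n p w i j where "(n, p) \<in> A" "corner n w" "i < n" "j < n" "i \<noteq> j"
    "a = p w" "b = p (flip {i} w)" "c = p (flip {i, j} w)" "d = p (flip {j} w)"
    unfolding vsq_def by blast
  then show ?thesis using vsqI[of n p w j i] by (simp add: insert_commute)
qed

lemma vsq_rot: assumes "vsq a b c d" shows "vsq b c d a"
proof -
  obtain n p w i j where s: "(n, p) \<in> A" "corner n w" "i < n" "j < n" "i \<noteq> j"
    "a = p w" "b = p (flip {i} w)" "c = p (flip {i, j} w)" "d = p (flip {j} w)"
    using assms unfolding vsq_def by blast
  have 1: "flip {j} (flip {i} w) = flip {i, j} w" "flip {j, i} (flip {i} w) = flip {j} w"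
    using s(5) unfolding flip_def by (auto simp: fun_eq_iff)
  have "corner n (flip {i} w)" using s by (intro corner_flip) auto
  then have "vsq (p (flip {i} w)) (p (flip {j} (flip {i} w))) (p (flip {j, i} (flip {i} w))) (p (flip {i} (flip {i} w)))"
    using s by (intro vsqI) auto
  then show ?thesis using s 1 flip_twice by simp
qed

lemma vsq_adj: "vsq a b c d \<Longrightarrow> vadj a b"
  unfolding vsq_def vadj_def by blast

lemma vsq_neq: assumes "vsq a b c d" shows "b \<noteq> d"
proof
  assume "b = d"
  obtain n p w i j where s: "(n, p) \<in> A" "corner n w" "i < n" "j < n" "i \<noteq> j"
    "b = p (flip {i} w)" "d = p (flip {j} w)"
    using assms unfolding vsq_def by blast
  have "corner n (flip {i} w)" "corner n (flip {j} w)" using s by (auto intro!: corner_flip)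
  then have "flip {i} w = flip {j} w" using chart_eq_iff[OF s(1)] corner_unit_cube s \<open>b = d\<close> by blast
  then show False using flip_eq_iff[OF s(2), of "{i}" "{j}"] s(5) by simp
qed

text \<open>Aligned at \<open>v\<close>, the edges to \<open>a\<close> and \<open>b\<close> have
  directions \<open>i'\<close> and \<open>j'\<close> in the second chart. The gluing face contains
  both directions, hence also the opposite corner.\<close>

lemma vsq_at_corner_unique:
  assumes s: "vsq v a c b" and A: "(m, q) \<in> A" "corner m w'" "v = q w'" "a = q (flip {i'} w')" "b = q (flip {j'} w')"
    and ij: "i' < m" "j' < m"
  shows "c = q (flip {i', j'} w')"
proof -
  obtain n p w i j where s: "(n, p) \<in> A" "corner n w" "i < n" "j < n" "i \<noteq> j"
    "v = p w" "a = p (flip {i} w)" "c = p (flip {i, j} w)" "b = p (flip {j} w)"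
    using s unfolding vsq_def by blast
  have "p w = q w'" using s A by simp
  obtain I I' \<sigma> where al: "aligned n p w m q w' I I' \<sigma>"
    by (rule aligned_corner[OF s(1) A(1) s(2) corner_unit_cube[OF A(2)] \<open>p w = q w'\<close>])
  have c: "flip {i'} w' \<in> unit_cube m" "flip {j'} w' \<in> unit_cube m"
    using corner_unit_cube[OF corner_flip[OF A(2)]] ij by auto
  have i: "{i} \<subseteq> I" "flip {i'} w' = flip {\<sigma> i} w'"
    using aligned_index[OF A(1) al _ c(1), of "{i}"] s A by auto
  have j: "{j} \<subseteq> I" "flip {j'} w' = flip {\<sigma> j} w'"
    using aligned_index[OF A(1) al _ c(2), of "{j}"] s A by auto
  have "\<sigma> i = i'" "\<sigma> j = j'" using i(2) j(2) flip_eq_iff[OF A(2)] by auto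
  then show ?thesis using aligned_flip(1)[OF al, of "{i, j}"] i(1) j(1) s by auto
qed

lemma vsq_unique: assumes "vsq a b c d" "vsq a b c d'" shows "d = d'"
proof -
  have 1: "vsq b c d a" "vsq b c d' a" using assms vsq_rot by auto
  obtain n p w i j where s: "(n, p) \<in> A" "corner n w" "i < n" "j < n" "i \<noteq> j"
    "b = p w" "c = p (flip {i} w)" "d = p (flip {i, j} w)" "a = p (flip {j} w)"
    using 1(1) unfolding vsq_def by blast
  show ?thesis using vsq_at_corner_unique[OF 1(2) s(1,2,6,7,9,3,4)] s(8) by simp
qed

lemma neighbour_in_chart:
  assumes "vadj v a" and A: "(n, p) \<in> A" and w: "corner n w" "v = p w" and y: "y \<in> unit_cube n" "a = p y"
  obtains i where "i < n" "y = flip {i} w"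
proof -
  obtain m q w' i where s: "(m, q) \<in> A" "corner m w'" "i < m" "v = q w'" "a = q (flip {i} w')"
    using assms(1) unfolding vadj_def by blast
  have "q w' = p w" using s w by simp
  obtain I I' \<sigma> where al: "aligned m q w' n p w I I' \<sigma>"
    by (rule aligned_corner[OF s(1) A s(2) corner_unit_cube[OF w(1)] \<open>q w' = p w\<close>])
  have "{i} \<subseteq> I" "y = flip {\<sigma> i} w"
    using aligned_index[OF A al _ y(1), of "{i}"] s(3,5) y(2) by auto
  moreover have "\<sigma> ` {i} \<subseteq> {..<n}" using aligned_flip(2)[OF al \<open>{i} \<subseteq> I\<close>] .
  ultimately show thesis using that by auto
qed

text \<open>In coordinates aligned at the corner, the common face of the two charts contains every
  direction of \<open>K\<close>, and \<open>F\<close> has their images among its free directions.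
  Corner and neighbours thus determine the spanned cube across charts.\<close>

lemma span_subset:
  assumes A: "(n, p) \<in> A" "(m, q) \<in> A" and w: "corner n w" "K \<subseteq> {..<n}" and F: "is_cube_face m k F"
    and v: "p w \<in> q ` F" "\<And>i. i \<in> K \<Longrightarrow> p (flip {i} w) \<in> q ` F"
  shows "p ` face n w K \<subseteq> q ` F"
proof -
  obtain y where y: "y \<in> F" "p w = q y" using v(1) by blast
  have FU: "F \<subseteq> unit_cube m" using F unfolding is_cube_face_def by auto
  obtain I I' \<sigma> where al: "aligned n p w m q y I I' \<sigma>"
    by (rule aligned_corner[OF A w(1) _ y(2)]) (use y FU in blast)
  have "corner m y" using al unfolding aligned_def by simp
  then obtain L where L: "L \<subseteq> {..<m}" "F = face m y L" using cube_face_at_corner[OF F _ y(1)] by metis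
  have "i \<in> I \<and> \<sigma> i \<in> L" if i: "i \<in> K" for i
  proof -
    obtain z where z: "z \<in> F" "p (flip {i} w) = q z" using v(2)[OF i] by blast
    have "{i} \<subseteq> I" "z = flip (\<sigma> ` {i}) y"
      using aligned_index[OF A(2) al _ _ z(2)] z(1) FU i w(2) by auto
    then show ?thesis using z(1) flip_face_iff[OF \<open>corner m y\<close>, of "{\<sigma> i}" L] L(2) by auto
  qed
  then have "K \<subseteq> I" "\<sigma> ` K \<subseteq> L" by auto
  then show ?thesis using aligned_face[OF al, of K] face_mono[of "\<sigma> ` K" L m y] L(2) by auto
qed

text \<open>After alignment at \<open>w\<close>, the coordinates in which \<open>y\<close> differs
  from \<open>w\<close> inject into the single free direction of the edge, so there is exactly
  one.\<close>

lemma edge_cube: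
  assumes A: "(n, p) \<in> A" and w: "corner n w" and e: "e \<in> cubes A 1" "p w \<in> e" "p y \<in> e" "y \<in> unit_cube n" "y \<noteq> w"
    "p y \<in> cc_vertices A"
  obtains i where "i < n" "y = flip {i} w" "e = p ` face n w {i}"
proof -
  obtain m q F where F: "(m, q) \<in> A" "is_cube_face m 1 F" "e = q ` F" using e(1) unfolding cubes_def by auto
  have FU: "F \<subseteq> unit_cube m" using F unfolding is_cube_face_def by auto
  obtain z where z: "z \<in> F" "p w = q z" using e(2) F(3) by blast
  obtain x where x: "x \<in> F" "p y = q x" using e(3) F(3) by blast
  obtain I I' \<sigma> where al: "aligned n p w m q z I I' \<sigma>"
    by (rule aligned_corner[OF A F(1) w _ z(2)]) (use z FU in blast)
  have cz: "corner m z" "bij_betw \<sigma> I I'" "I \<subseteq> {..<n}" using al unfolding aligned_def by auto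
  obtain L where L: "L \<subseteq> {..<m}" "card L = 1" "F = face m z L" using cube_face_at_corner[OF F(2) cz(1) z(1)] by metis
  then obtain j where j: "L = {j}" using card_1_singletonE by blast
  have cx: "corner m x" using vertex_at[OF F(1)] e(6) x FU by auto
  let ?S = "{i. w i \<noteq> y i}"
  have yS: "y = flip ?S w" "?S \<subseteq> {..<n}"
    using corner_diff[OF w vertex_at[OF A e(6,4)]] by simp_all
  have "?S \<noteq> {}" using e(5) by auto
  have S: "p (flip ?S w) = q x" using yS(1) x(2) by simp
  have "x \<in> unit_cube m" using x FU by auto
  note i = aligned_index[OF F(1) al yS(2) this S]
  have "\<sigma> ` ?S \<subseteq> {j}" using x(1) i(2) flip_face_iff[OF cz(1)] unfolding L(3) j by blast
  then have "\<sigma> ` ?S = {j}" using \<open>?S \<noteq> {}\<close> by blast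
  then have "card ?S = 1" using card_image[OF inj_on_subset[OF bij_betw_imp_inj_on[OF cz(2)] i(1)]] by simp
  then obtain k where k: "?S = {k}" using card_1_singletonE by blast
  then have "e = p ` face n w {k}"
    using aligned_face[OF al, of "{k}"] i(1) \<open>\<sigma> ` ?S = {j}\<close> F(3) L(3) j by auto
  moreover have "k < n" using yS(2) k by auto
  moreover have "y = flip {k} w" using yS(1) unfolding k .
  ultimately show thesis by (intro that)
qed

lemma edges_in_face:
  assumes A: "(n, p) \<in> A" and w: "corner n w" "K \<subseteq> {..<n}"
  shows "{e \<in> cubes A 1. p w \<in> e \<and> e \<subseteq> p ` face n w K} = (\<lambda>i. p ` face n w {i}) ` K"
proof (intro subset_antisym subsetI)
  fix e assume "e \<in> (\<lambda>i. p ` face n w {i}) ` K"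
  then obtain i where i: "i \<in> K" "e = p ` face n w {i}" by blast
  have "is_cube_face n 1 (face n w {i})" using is_cube_face_face[OF w(1), of "{i}"] w(2) i by auto
  then have "e \<in> cubes A 1" unfolding cubes_def using A i by blast
  moreover have "p w \<in> e" using face_base[OF w(1)] i by blast
  moreover have "e \<subseteq> p ` face n w K" using face_mono[of "{i}" K] i by blast
  ultimately show "e \<in> {e \<in> cubes A 1. p w \<in> e \<and> e \<subseteq> p ` face n w K}" by blast
next
  fix e assume "e \<in> {e \<in> cubes A 1. p w \<in> e \<and> e \<subseteq> p ` face n w K}"
  then have e: "e \<in> cubes A 1" "p w \<in> e" "e \<subseteq> p ` face n w K" by auto
  obtain m q F where F: "(m, q) \<in> A" "is_cube_face m 1 F" "e = q ` F" using e(1) unfolding cubes_def by auto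
  have FU: "F \<subseteq> unit_cube m" using F unfolding is_cube_face_def by auto
  obtain z where z: "z \<in> F" "p w = q z" using e(2) F(3) by blast
  have "q z \<in> cc_vertices A" using vertex_iff A w(1) z(2) by metis
  then have "corner m z" using vertex_at[OF F(1)] z(1) FU by blast
  then obtain L where L: "L \<subseteq> {..<m}" "card L = 1" "F = face m z L" using cube_face_at_corner[OF F(2) _ z(1)] by metis
  then obtain j where j: "L = {j}" using card_1_singletonE by blast
  have f: "flip {j} z \<in> F" "corner m (flip {j} z)"
    using flip_face[OF \<open>corner m z\<close>, of L L] corner_flip[OF \<open>corner m z\<close>, of L] L j by auto
  then obtain y where y: "y \<in> face n w K" "q (flip {j} z) = p y" using e(3) F(3) by blast
  have "y \<noteq> w"
  proof
    assume "y = w"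
    then have "flip {j} z = z" using chart_eq_iff[OF F(1)] y(2) z FU f by auto
    then show False using flip_eq_iff[OF \<open>corner m z\<close>, of "{j}" "{}"] by simp
  qed
  moreover have "p y \<in> cc_vertices A" using y(2) f F(1) vertex_iff by metis
  moreover have "p y \<in> e" using y(2) f F(3) by force
  moreover have "y \<in> unit_cube n" using y(1) face_def by auto
  ultimately obtain i where i: "i < n" "y = flip {i} w" "e = p ` face n w {i}"
    using edge_cube[OF A w(1) e(1,2)] by blast
  have "i \<in> K" using flip_face_iff[OF w(1), of "{i}" K] y(1) i(2) by auto
  then show "e \<in> (\<lambda>i. p ` face n w {i}) ` K" using i(3) by blast
qed

end

section \<open>Flag links and the cubes they span\<close>

locale flag_cube_cpx = cube_cpx +
  assumes flag: "v \<in> cc_vertices A \<Longrightarrow> flag_complex (cc_link A v)"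
begin

lemma link_simplexI:
  assumes "(n, p) \<in> A" "corner n w" "K \<subseteq> {..<n}" "K \<noteq> {}"
  shows "(\<lambda>i. p ` face n w {i}) ` K \<in> cc_link A (p w)"
proof -
  have "card K > 0" using assms(3,4) finite_subset[OF assms(3)] by (simp add: card_gt_0_iff)
  moreover have "p ` face n w K \<in> cubes A (card K)"
    unfolding cubes_def using is_cube_face_face[OF assms(2,3)] assms(1) by blast
  moreover have "p w \<in> p ` face n w K" using face_base[OF assms(2)] by blast
  ultimately show ?thesis unfolding cc_link_def using edges_in_face[OF assms(1-3), symmetric] by blast
qed

text \<open>The edges from \<open>v\<close> to \<open>N\<close> are vertices of the link, and
  squares join them pairwise, so by flagness they form a simplex. A chart carrying its cube exhibits
  all of \<open>N\<close> as flips. The empty family is treated apart because flagness concerns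
  nonempty simplices.\<close>

lemma clique_spans_cube:
  assumes v: "v \<in> cc_vertices A" and N: "finite N" "\<And>a. a \<in> N \<Longrightarrow> vadj v a"
    and sq: "\<And>a b. a \<in> N \<Longrightarrow> b \<in> N \<Longrightarrow> a \<noteq> b \<Longrightarrow> \<exists>c. vsq v a c b"
  obtains n p w where "(n, p) \<in> A" "corner n w" "v = p w" "\<forall>a\<in>N. \<exists>i<n. a = p (flip {i} w)"
proof (cases "N = {}")
  case True
  obtain n p w where "(n, p) \<in> A" "corner n w" "v = p w" using v vertex_iff by blast
  then show thesis using that True by blast
next
  case False
  have "\<exists>e. e \<in> cubes A 1 \<and> v \<in> e \<and> a \<in> e" if a: "a \<in> N" for a
  proof -
    obtain n p w i where s: "(n, p) \<in> A" "corner n w" "i < n" "v = p w" "a = p (flip {i} w)"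
      using N(2)[OF a] unfolding vadj_def by blast
    have "is_cube_face n 1 (face n w {i})" using is_cube_face_face[OF s(2), of "{i}"] s(3) by simp
    then have "p ` face n w {i} \<in> cubes A 1" unfolding cubes_def using s(1) by blast
    moreover have "v \<in> p ` face n w {i}" "a \<in> p ` face n w {i}"
      using face_base[OF s(2)] flip_face[OF s(2), of "{i}" "{i}"] s by auto
    ultimately show ?thesis by blast
  qed
  then obtain E where E: "\<And>a. a \<in> N \<Longrightarrow> E a \<in> cubes A 1 \<and> v \<in> E a \<and> a \<in> E a" by metis
  have E_eq: "E a = p ` face n w {i}"
    if t: "a \<in> N" "(n, p) \<in> A" "corner n w" "i < n" "v = p w" "a = p (flip {i} w)" for a n p w i
  proof -
    have c: "corner n (flip {i} w)" using corner_flip t by simp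
    have 1: "flip {i} w \<noteq> w" using flip_eq_iff[OF t(3), of "{i}" "{}"] by simp
    have 2: "p (flip {i} w) \<in> cc_vertices A" using vertex_iff c t(2) by blast
    have 3: "E a \<in> cubes A 1" "p w \<in> E a" "p (flip {i} w) \<in> E a" using E[OF t(1)] t(5,6) by auto
    obtain j where "flip {i} w = flip {j} w" "E a = p ` face n w {j}"
      by (rule edge_cube[OF t(2,3) 3 corner_unit_cube[OF c] 1 2])
    then show ?thesis using flip_eq_iff[OF t(3), of "{i}" "{j}"] by simp
  qed
  have pair: "{E a, E b} \<in> cc_link A v" if ab: "a \<in> N" "b \<in> N" for a b
  proof (cases "a = b")
    case True
    obtain n p w i where s: "(n, p) \<in> A" "corner n w" "i < n" "v = p w" "a = p (flip {i} w)"
      using N(2)[OF ab(1)] unfolding vadj_def by blast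
    then show ?thesis using link_simplexI[OF s(1,2), of "{i}"] E_eq[OF ab(1) s] True by simp
  next
    case False
    obtain c where "vsq v a c b" using sq[OF ab False] by blast
    then obtain n p w i j where s: "(n, p) \<in> A" "corner n w" "i < n" "j < n" "i \<noteq> j"
      "v = p w" "a = p (flip {i} w)" "b = p (flip {j} w)" unfolding vsq_def by blast
    then show ?thesis
      using link_simplexI[OF s(1,2), of "{i, j}"] E_eq[OF ab(1) s(1,2,3,6,7)] E_eq[OF ab(2) s(1,2,4,6,8)] by simp
  qed
  have "E ` N \<in> cc_link A v"
    using flag[OF v] N(1) False pair unfolding flag_complex_def by blast
  then obtain C k where C: "C \<in> cubes A k" "v \<in> C" "E ` N = {e \<in> cubes A 1. v \<in> e \<and> e \<subseteq> C}"
    unfolding cc_link_def by blast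
  obtain n p F where F: "(n, p) \<in> A" "is_cube_face n k F" "C = p ` F" using C(1) unfolding cubes_def by auto
  have FU: "F \<subseteq> unit_cube n" using F unfolding is_cube_face_def by auto
  obtain w where w: "w \<in> F" "v = p w" using C(2) F(3) by blast
  have cw: "corner n w" using vertex_at[OF F(1)] v w FU by auto
  have "\<exists>i<n. a = p (flip {i} w)" if a: "a \<in> N" for a
  proof -
    have "a \<in> C" using C(3) E[OF a] a by blast
    then obtain y where y: "y \<in> F" "a = p y" using F(3) by blast
    then have yU: "y \<in> unit_cube n" using FU by blast
    obtain i where "i < n" "y = flip {i} w" by (rule neighbour_in_chart[OF N(2)[OF a] F(1) cw w(2) yU y(2)])
    then show ?thesis using y by blast
  qed
  then show thesis using that F(1) cw w(2) by blast
qed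

lemma vsq_cube:
  assumes s: "vsq v a x b" "vsq v b y c" "vsq v c z a"
  shows "\<exists>t. vsq b x t y \<and> vsq c y t z \<and> vsq a z t x"
proof -
  have ne: "a \<noteq> b" "b \<noteq> c" "c \<noteq> a" using s vsq_neq by auto
  have ad: "vadj v a" "vadj v b" "vadj v c" using s vsq_adj by auto
  have "\<exists>u. vsq v i u j" if "i \<in> {a, b, c}" "j \<in> {a, b, c}" "i \<noteq> j" for i j
    using that s vsq_refl by blast
  then obtain n p w where w: "(n, p) \<in> A" "corner n w" "v = p w" "\<forall>a\<in>{a, b, c}. \<exists>i<n. a = p (flip {i} w)"
    using clique_spans_cube[OF vadj_vertex[OF ad(1)], of "{a, b, c}"] ad by blast
  obtain i j k where ijk: "i < n" "j < n" "k < n" "a = p (flip {i} w)" "b = p (flip {j} w)" "c = p (flip {k} w)"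
    using w(4) by blast
  have d: "i \<noteq> j" "j \<noteq> k" "k \<noteq> i" using ne ijk by auto
  have x: "x = p (flip {i, j} w)" by (rule vsq_at_corner_unique[OF s(1) w(1-3) ijk(4,5,1,2)])
  have y: "y = p (flip {j, k} w)" by (rule vsq_at_corner_unique[OF s(2) w(1-3) ijk(5,6,2,3)])
  have z: "z = p (flip {k, i} w)" by (rule vsq_at_corner_unique[OF s(3) w(1-3) ijk(6,4,3,1)])
  have "vsq b x (p (flip {i, j, k} w)) y"
    using vsq_flip[OF w(1,2), of "{j}" i k] ijk d x y by (simp add: insert_commute)
  moreover have "vsq c y (p (flip {i, j, k} w)) z"
    using vsq_flip[OF w(1,2), of "{k}" j i] ijk d z y by (simp add: insert_commute)
  moreover have "vsq a z (p (flip {i, j, k} w)) x"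
    using vsq_flip[OF w(1,2), of "{i}" k j] ijk d x z by (simp add: insert_commute)
  ultimately show ?thesis by blast
qed

sublocale square_graph "cc_vertices A" vadj vsq
  by unfold_locales (fact vadj_sym vadj_irrefl vadj_vertex vsq_rot vsq_refl vsq_adj vsq_neq vsq_unique vsq_cube)+

text \<open>The first \<open>r\<close> members of an injective sequence in \<open>N\<close> span an
  \<open>r\<close>-cube. The charts change with \<open>r\<close>, so nesting of these cubes comes
  from \<open>span_subset\<close> and not from coordinates.\<close>

lemma infinite_clique_infinite_cube:
  assumes v: "v \<in> cc_vertices A" and N: "infinite N" "\<And>a. a \<in> N \<Longrightarrow> vadj v a"
    and sq: "\<And>a b. a \<in> N \<Longrightarrow> b \<in> N \<Longrightarrow> a \<noteq> b \<Longrightarrow> \<exists>c. vsq v a c b"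
  shows "\<exists>Q. infinite_cube A Q"
proof -
  obtain s :: "nat \<Rightarrow> 'a" where s: "inj s" "range s \<subseteq> N" using infinite_countable_subset[OF N(1)] by blast
  have "\<exists>n p w K. (n, p) \<in> A \<and> corner n w \<and> v = p w \<and> K \<subseteq> {..<n} \<and> (\<lambda>i. p (flip {i} w)) ` K = s ` {..<r}" for r
  proof -
    obtain n p w where w: "(n, p) \<in> A" "corner n w" "v = p w" "\<forall>a\<in>s ` {..<r}. \<exists>i<n. a = p (flip {i} w)"
      by (rule clique_spans_cube[OF v, of "s ` {..<r}"]) (use N(2) sq s(2) in blast)+
    have "(\<lambda>i. p (flip {i} w)) ` {i. i < n \<and> p (flip {i} w) \<in> s ` {..<r}} = s ` {..<r}"
    proof (intro subset_antisym subsetI)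
      fix a assume a: "a \<in> s ` {..<r}"
      then obtain i where i: "i < n" "a = p (flip {i} w)" using w(4) by blast
      then show "a \<in> (\<lambda>i. p (flip {i} w)) ` {i. i < n \<and> p (flip {i} w) \<in> s ` {..<r}}"
        using a by (intro image_eqI[of _ _ i]) auto
    qed auto
    moreover have "{i. i < n \<and> p (flip {i} w) \<in> s ` {..<r}} \<subseteq> {..<n}" by auto
    ultimately show ?thesis using w(1-3) by blast
  qed
  then obtain n p w K where np: "\<And>r. (n r, p r) \<in> A" "\<And>r. corner (n r) (w r)" "\<And>r. v = p r (w r)"
    "\<And>r. K r \<subseteq> {..<n r}" "\<And>r. (\<lambda>i. p r (flip {i} (w r))) ` K r = s ` {..<r}" by metis
  define C where "C r = p r ` face (n r) (w r) (K r)" for r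
  have cardK: "card (K r) = r" for r
  proof -
    have "inj_on (\<lambda>i. p r (flip {i} (w r))) (K r)"
    proof (rule inj_onI)
      fix i j assume ij: "i \<in> K r" "j \<in> K r" "p r (flip {i} (w r)) = p r (flip {j} (w r))"
      have "flip {i} (w r) \<in> unit_cube (n r)" "flip {j} (w r) \<in> unit_cube (n r)"
        using corner_unit_cube[OF corner_flip[OF np(2)]] ij np(4)[of r] by auto
      then have "flip {i} (w r) = flip {j} (w r)" using chart_eq_iff[OF np(1)] ij(3) by blast
      then show "i = j" using flip_eq_iff[OF np(2), of "{i}" r "{j}"] by simp
    qed
    then have "card (K r) = card (s ` {..<r})" using np(5)[of r] card_image by metis
    also have "\<dots> = r" using card_image[OF inj_on_subset[OF s(1)], of "{..<r}"] by simp
    finally show ?thesis .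
  qed
  have fc: "is_cube_face (n r) r (face (n r) (w r) (K r))" for r
    using is_cube_face_face[OF np(2,4), of r] cardK by simp
  \<comment> \<open>The cube of index \<open>r\<close> contains no later member of the sequence,
    which makes the inclusions strict.\<close>
  have mem: "s i \<in> C r \<longleftrightarrow> i < r" for i r
  proof
    assume "i < r"
    then have "s i \<in> (\<lambda>i. p r (flip {i} (w r))) ` K r" using np(5)[of r] by auto
    then obtain j where j: "j \<in> K r" "s i = p r (flip {j} (w r))" by blast
    then have "flip {j} (w r) \<in> face (n r) (w r) (K r)" using flip_face[OF np(2) _ np(4), of "{j}" r] by simp
    then show "s i \<in> C r" unfolding C_def using j by blast
  next
    assume "s i \<in> C r"
    then obtain y where y: "y \<in> face (n r) (w r) (K r)" "s i = p r y" unfolding C_def by blast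
    have "vadj v (s i)" using N(2) s(2) by blast
    then obtain j where j: "j < n r" "y = flip {j} (w r)"
      using neighbour_in_chart[OF _ np(1,2,3) _ y(2)] y(1) face_def by blast
    then have "j \<in> K r" using flip_face_iff[OF np(2), of "{j}" r] y(1) by auto
    then have "s i \<in> s ` {..<r}" using np(5)[of r] j y by blast
    then show "i < r" using s(1) by (auto dest: injD)
  qed
  have "C r \<subset> C (Suc r)" for r
  proof -
    have "C r \<subseteq> C (Suc r)" unfolding C_def
    proof (rule span_subset[OF np(1,1,2,4) fc])
      have "p (Suc r) (w (Suc r)) = p r (w r)" using np(3) by metis
      then show "p r (w r) \<in> p (Suc r) ` face (n (Suc r)) (w (Suc r)) (K (Suc r))"
        using face_base[OF np(2)] by (metis imageI)
      fix i assume "i \<in> K r"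
      then have "p r (flip {i} (w r)) \<in> s ` {..<r}" using np(5)[of r] by blast
      then obtain l where "l < r" "p r (flip {i} (w r)) = s l" by blast
      then show "p r (flip {i} (w r)) \<in> p (Suc r) ` face (n (Suc r)) (w (Suc r)) (K (Suc r))"
        using mem[of l "Suc r"] unfolding C_def by simp
    qed
    moreover have "s r \<in> C (Suc r)" "s r \<notin> C r" using mem by auto
    ultimately show ?thesis by blast
  qed
  moreover have "C r \<in> cubes A r" for r unfolding C_def cubes_def using np(1) fc by blast
  ultimately have "\<forall>r. C r \<in> cubes A r \<and> C r \<subset> C (Suc r)" by simp
  then have "infinite_cube A (\<Union>r. C r)" unfolding infinite_cube_def by (intro exI[of _ C]) simp
  then show ?thesis by (rule exI)
qed

end

section \<open>Open stars and local systems\<close>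

context cube_cpx
begin

text \<open>The open star: in some chart every coordinate is strictly less than one edge length away
  from the corner.\<close>

definition star :: "'a \<Rightarrow> 'a set" where
  "star v = {x. \<exists>n p y w. (n, p) \<in> A \<and> y \<in> unit_cube n \<and> x = p y \<and> corner n w \<and> v = p w \<and> (\<forall>i<n. \<bar>y i - w i\<bar> < 1)}"

text \<open>Membership can be tested in any chart containing the point, since alignment preserves
  the deviations from the corner.\<close>

lemma star_iff:
  assumes A: "(m, q) \<in> A" and y: "y \<in> unit_cube m"
  shows "q y \<in> star v \<longleftrightarrow> (\<exists>w. corner m w \<and> v = q w \<and> (\<forall>i<m. \<bar>y i - w i\<bar> < 1))"
proof
  assume "q y \<in> star v"
  then obtain n p x w where x: "(n, p) \<in> A" "x \<in> unit_cube n" "q y = p x" "corner n w" "v = p w" "\<And>i. i < n \<Longrightarrow> \<bar>x i - w i\<bar> < 1"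
    unfolding star_def by blast
  obtain w' I I' \<sigma> where al: "aligned n p w m q w' I I' \<sigma>"
    by (rule aligned_near[OF x(1) A x(4,2,6) y x(3)[symmetric]])
  then have a: "corner m w'" "p w = q w'" unfolding aligned_def by auto
  have "\<bar>y j - w' j\<bar> < 1" for j using aligned_close[OF al x(2) _ y] x(3,6) by simp
  then show "\<exists>w. corner m w \<and> v = q w \<and> (\<forall>i<m. \<bar>y i - w i\<bar> < 1)" using a x(5) by blast
next
  assume "\<exists>w. corner m w \<and> v = q w \<and> (\<forall>i<m. \<bar>y i - w i\<bar> < 1)"
  then show "q y \<in> star v" unfolding star_def using A y by blast
qed

lemma star_open: "openin (cc_topology X A) (star v)"
  unfolding openin_cc_topology
proof (intro conjI ballI)
  show "star v \<subseteq> X" unfolding star_def using chart_X by blast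
  fix c assume "c \<in> A"
  obtain m q where c: "c = (m, q)" by (cases c)
  \<comment> \<open>By injectivity the union has at most one member; it is empty when
    \<open>v\<close> is not a corner of this chart.\<close>
  define U where "U = (\<Union>w\<in>{w. corner m w \<and> v = q w}. \<Inter>i<m. {y :: nat \<Rightarrow> real. \<bar>y i - w i\<bar> < 1})"
  have "open {y :: nat \<Rightarrow> real. \<bar>y i - w i\<bar> < 1}" for i and w :: "nat \<Rightarrow> real"
    by (intro open_Collect_less continuous_intros continuous_on_product_coordinates)
  then have "open U" unfolding U_def by (intro open_UN open_INT ballI) auto
  moreover have "{x \<in> unit_cube m. q x \<in> star v} = unit_cube m \<inter> U"
  proof (rule Set.set_eqI)
    fix x show "x \<in> {x \<in> unit_cube m. q x \<in> star v} \<longleftrightarrow> x \<in> unit_cube m \<inter> U"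
      using star_iff[of m q x v] \<open>c \<in> A\<close> unfolding c U_def by (auto simp: Bex_def)
  qed
  ultimately have "openin (top_of_set (unit_cube m)) {x \<in> unit_cube m. q x \<in> star v}"
    unfolding openin_open by blast
  then show "case c of (n, p) \<Rightarrow> openin (top_of_set (unit_cube n)) {x \<in> unit_cube n. p x \<in> star v}"
    unfolding c by simp
qed

lemma star_cover: assumes "x \<in> X" shows "\<exists>v\<in>cc_vertices A. x \<in> star v"
proof -
  obtain n p y where y: "(n, p) \<in> A" "y \<in> unit_cube n" "x = p y" using chart_exists[OF assms] .
  obtain w where w: "corner n w" "\<And>i. i < n \<Longrightarrow> \<bar>y i - w i\<bar> < 1" using corner_near_exists[OF y(2)] by blast
  have "x \<in> star (p w)" using star_iff[OF y(1,2)] y(3) w by blast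
  moreover have "p w \<in> cc_vertices A" using vertex_iff y(1) w(1) by blast
  ultimately show ?thesis by blast
qed

lemma star_self: assumes "v \<in> cc_vertices A" shows "v \<in> star v"
proof -
  obtain n p w where w: "(n, p) \<in> A" "corner n w" "v = p w" using assms vertex_iff by blast
  then show ?thesis using star_iff[OF w(1) corner_unit_cube[OF w(2)], of v] by auto
qed

lemma star_vertex: assumes "x \<in> cc_vertices A" "x \<in> star v" shows "v = x"
proof -
  obtain n p y where w: "(n, p) \<in> A" "corner n y" "x = p y" using assms vertex_iff by blast
  then obtain w where c: "corner n w" "v = p w" "\<forall>i<n. \<bar>y i - w i\<bar> < 1"
    using star_iff[OF w(1) corner_unit_cube[OF w(2)], of v] assms(2) by blast
  have "y i = w i" for i
  proof (cases "i < n")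
    case True
    then show ?thesis using c(3) corner_01[OF c(1), of i] corner_01[OF w(2), of i] by auto
  next
    case False
    then show ?thesis using w(2) c(1) unfolding corner_def by simp
  qed
  then have "y = w" by auto
  then show ?thesis using c w by simp
qed

lemma topspace_cc: "topspace (cc_topology X A) = X"
proof -
  have "openin (cc_topology X A) X"
    unfolding openin_cc_topology
  proof (intro conjI ballI)
    fix c assume "c \<in> A"
    obtain n p where c: "c = (n, p)" by (cases c)
    have "{x \<in> unit_cube n. p x \<in> X} = unit_cube n" using chart_X \<open>c \<in> A\<close> c by auto
    then show "case c of (n, p) \<Rightarrow> openin (top_of_set (unit_cube n)) {x \<in> unit_cube n. p x \<in> X}"
      unfolding c using openin_subtopology_self by simp
  qed simp
  moreover have "topspace (cc_topology X A) \<subseteq> X"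
    using openin_topspace[of "cc_topology X A"] unfolding openin_cc_topology by blast
  ultimately show ?thesis using openin_subset by blast
qed

lemma chart_continuous: assumes "(n, p) \<in> A" shows "continuous_map (top_of_set (unit_cube n)) (cc_topology X A) p"
  unfolding continuous_map_def
proof (intro conjI allI impI)
  show "p \<in> topspace (top_of_set (unit_cube n)) \<rightarrow> topspace (cc_topology X A)"
    unfolding topspace_cc using chart_X assms by auto
  fix U assume "openin (cc_topology X A) U"
  then show "openin (top_of_set (unit_cube n)) {x \<in> topspace (top_of_set (unit_cube n)). p x \<in> U}"
    unfolding openin_cc_topology using assms by auto
qed

lemma chart_walk:
  assumes A: "(n, p) \<in> A" and w: "corner n w" "corner n w'" shows "vadj\<^sup>*\<^sup>* (p w) (p w')"
proof -
  have "vadj\<^sup>*\<^sup>* (p w) (p (flip S w))" if "finite S" "S \<subseteq> {..<n}" for S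
    using that
  proof (induction S rule: finite_induct)
    case (insert i S)
    have "vadj (p (flip S w)) (p (flip {i} (flip S w)))"
      using insert by (intro vadjI[OF A] corner_flip w) auto
    then have "vadj (p (flip S w)) (p (flip (insert i S) w))" using flip_insert[OF insert(2)] by simp
    then show "vadj\<^sup>*\<^sup>* (p w) (p (flip (insert i S) w))"
      using insert by (auto intro: rtranclp.rtrancl_into_rtrancl)
  qed simp
  then show ?thesis using corner_diff[OF w] finite_subset[OF corner_diff(2)[OF w]] by (metis finite_lessThan)
qed

lemma star_walk:
  assumes "x \<in> star u" "x \<in> star v" shows "vadj\<^sup>*\<^sup>* u v"
proof -
  obtain n p y w where x: "(n, p) \<in> A" "y \<in> unit_cube n" "x = p y" "corner n w" "u = p w"
    using assms(1) unfolding star_def by blast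
  obtain w' where "corner n w'" "v = p w'" using star_iff[OF x(1,2), of v] assms(2) x(3) by blast
  then show ?thesis using chart_walk[OF x(1,4)] x(5) by blast
qed

lemma rtranclp_walk: "vadj\<^sup>*\<^sup>* u v \<Longrightarrow> \<exists>xs. walk vadj xs u v"
proof (induction rule: rtranclp_induct)
  case base
  show ?case by (intro exI[of _ "[u]"]) (simp add: walk_def)
next
  case (step y z)
  then obtain xs where "walk vadj xs u y" by blast
  then have "walk vadj (xs @ [z]) u z" using step(2) unfolding walk_def by (auto simp: successively_append_iff)
  then show ?case by blast
qed

end

section \<open>Extending a local system over whole cubes\<close>

locale cube_local_system = cube_cpx X A
  for X :: "'a set" and A :: "(nat \<times> ((nat \<Rightarrow> real) \<Rightarrow> 'a)) set" +
  fixes R :: "'a \<Rightarrow> 'b set" and Tr :: "'a \<Rightarrow> 'a \<Rightarrow> 'b \<Rightarrow> 'b"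
  assumes ls: "local_system vadj vsq R Tr"
begin

lemma Tr_in: "vadj u v \<Longrightarrow> s \<in> R u \<Longrightarrow> Tr u v s \<in> R v"
  and Tr_inv: "vadj u v \<Longrightarrow> s \<in> R u \<Longrightarrow> Tr v u (Tr u v s) = s"
  and Tr_sq: "vsq a b c d \<Longrightarrow> s \<in> R a \<Longrightarrow> Tr b c (Tr a b s) = Tr d c (Tr a d s)"
  using ls unfolding local_system_def by blast+

definition parallel_section :: "nat \<Rightarrow> ((nat \<Rightarrow> real) \<Rightarrow> 'a) \<Rightarrow> ((nat \<Rightarrow> real) \<Rightarrow> 'b) \<Rightarrow> bool" where
  "parallel_section n p t \<longleftrightarrow> (\<forall>w. corner n w \<longrightarrow> t w \<in> R (p w)) \<and>
     (\<forall>w i. corner n w \<longrightarrow> i < n \<longrightarrow> t (flip {i} w) = Tr (p w) (p (flip {i} w)) (t w))"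

lemma parallel_section_exists_aux:
  assumes A: "(n, p) \<in> A" and w: "corner n w" and s: "s \<in> R (p w)"
  shows "k \<le> n \<Longrightarrow> \<exists>t. t {} = s \<and> (\<forall>S\<subseteq>{..<k}. t S \<in> R (p (flip S w))) \<and>
    (\<forall>S\<subseteq>{..<k}. \<forall>i<k. i \<notin> S \<longrightarrow> t (insert i S) = Tr (p (flip S w)) (p (flip (insert i S) w)) (t S))"
proof (induction k)
  case 0
  show ?case using s by (intro exI[of _ "\<lambda>_. s"]) auto
next
  case (Suc k)
  then obtain t where t: "t {} = s" "\<And>S. S \<subseteq> {..<k} \<Longrightarrow> t S \<in> R (p (flip S w))"
    "\<And>S i. S \<subseteq> {..<k} \<Longrightarrow> i < k \<Longrightarrow> i \<notin> S \<Longrightarrow> t (insert i S) = Tr (p (flip S w)) (p (flip (insert i S) w)) (t S)"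
    by (auto dest: Suc_leD)
  define t' where "t' S = (if k \<in> S then Tr (p (flip (S - {k}) w)) (p (flip S w)) (t (S - {k})) else t S)" for S
  have adj: "vadj (p (flip S w)) (p (flip (insert i S) w))" if "S \<subseteq> {..<n}" "i < n" "i \<notin> S" for S i
    using vadjI[OF A corner_flip[OF w that(1)] that(2)] flip_insert[OF that(3)] by simp
  have sub: "S - {k} \<subseteq> {..<k}" if "S \<subseteq> {..<Suc k}" for S using that by (auto simp: less_Suc_eq)
  have sub': "S \<subseteq> {..<k}" if "S \<subseteq> {..<Suc k}" "k \<notin> S" for S using sub[OF that(1)] that(2) by simp
  have subn: "S \<subseteq> {..<n}" if "S \<subseteq> {..<k}" for S using that Suc.prems by auto
  show ?case
  proof (intro exI[of _ t'] conjI allI impI)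
    show "t' {} = s" using t(1) t'_def by simp
  next
    fix S assume S: "S \<subseteq> {..<Suc k}"
    show "t' S \<in> R (p (flip S w))"
    proof (cases "k \<in> S")
      case True
      have "vadj (p (flip (S - {k}) w)) (p (flip (insert k (S - {k})) w))"
        using adj[OF subn[OF sub[OF S]], of k] Suc.prems by simp
      then show ?thesis using Tr_in t(2)[OF sub[OF S]] True unfolding t'_def by (simp add: insert_absorb)
    next
      case False
      then show ?thesis using t(2)[OF sub'[OF S]] unfolding t'_def by simp
    qed
  next
    fix S i assume S: "S \<subseteq> {..<Suc k}" and i: "i < Suc k" "i \<notin> S"
    show "t' (insert i S) = Tr (p (flip S w)) (p (flip (insert i S) w)) (t' S)"
    proof (cases "i = k")
      case True
      then show ?thesis using i unfolding t'_def by simp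
    next
      case ik: False
      then have "i < k" using i by simp
      show ?thesis
      proof (cases "k \<in> S")
        case False
        then show ?thesis using t(3)[OF sub'[OF S False] \<open>i < k\<close> i(2)] ik unfolding t'_def by simp
      next
        case True
        define S0 where "S0 = S - {k}"
        have S0: "S = insert k S0" "k \<notin> S0" "i \<notin> S0" "S0 \<subseteq> {..<k}"
          using True i sub[OF S] unfolding S0_def by auto
        have e: "insert i S - {k} = insert i S0" using S0 ik by auto
        have "t' (insert i S) = Tr (p (flip (insert i S0) w)) (p (flip (insert i S) w)) (t (insert i S0))"
          using True e unfolding t'_def by simp
        also have "t (insert i S0) = Tr (p (flip S0 w)) (p (flip (insert i S0) w)) (t S0)"
          using t(3)[OF S0(4) \<open>i < k\<close> S0(3)] .
        also have "Tr (p (flip (insert i S0) w)) (p (flip (insert i S) w)) \<dots> =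
            Tr (p (flip (insert k S0) w)) (p (flip (insert i S) w)) (Tr (p (flip S0 w)) (p (flip (insert k S0) w)) (t S0))"
          using Tr_sq[OF vsq_flip[OF A w subn[OF S0(4)], of i k] t(2)[OF S0(4)]] S0 ik \<open>i < k\<close> Suc.prems by simp
        also have "Tr (p (flip S0 w)) (p (flip (insert k S0) w)) (t S0) = t' S"
          using S0(1,2) unfolding t'_def by simp
        finally show ?thesis using S0(1) by simp
      qed
    qed
  qed
qed

lemma parallel_section_exists:
  assumes A: "(n, p) \<in> A" and w0: "corner n w0" and s: "s \<in> R (p w0)"
  obtains t where "parallel_section n p t" "t w0 = s"
proof -
  obtain t where t: "t {} = s" "\<And>S. S \<subseteq> {..<n} \<Longrightarrow> t S \<in> R (p (flip S w0))"
    "\<And>S i. S \<subseteq> {..<n} \<Longrightarrow> i < n \<Longrightarrow> i \<notin> S \<Longrightarrow> t (insert i S) = Tr (p (flip S w0)) (p (flip (insert i S) w0)) (t S)"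
    using parallel_section_exists_aux[OF A w0 s order_refl] by metis
  define t' where "t' w = t {i. w0 i \<noteq> w i}" for w :: "nat \<Rightarrow> real"
  have t'S: "t' (flip S w0) = t S" for S
  proof -
    have "w0 i \<noteq> flip S w0 i \<longleftrightarrow> i \<in> S" for i
      using corner_01[OF w0, of i] unfolding flip_def by auto
    then show ?thesis unfolding t'_def by simp
  qed
  have "parallel_section n p t'"
    unfolding parallel_section_def
  proof (intro conjI allI impI)
    fix w assume w: "corner n w"
    obtain S where S: "w = flip S w0" "S \<subseteq> {..<n}" using corner_diff[OF w0 w] by blast
    show "t' w \<in> R (p w)" using t(2)[OF S(2)] t'S S(1) by simp
    fix i assume i: "i < n"
    show "t' (flip {i} w) = Tr (p w) (p (flip {i} w)) (t' w)"
    proof (cases "i \<in> S")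
      case False
      then show ?thesis using flip_insert[OF False, of w0] t(3)[OF S(2) i False] t'S S(1) by simp
    next
      case True
      define S0 where "S0 = S - {i}"
      have S0: "S = insert i S0" "i \<notin> S0" "S0 \<subseteq> {..<n}" using True S(2) unfolding S0_def by auto
      have w': "w = flip {i} (flip S0 w0)" "flip {i} w = flip S0 w0"
        unfolding S(1) S0(1) using flip_insert[OF S0(2), of w0] flip_twice[of i "flip S0 w0"] by simp_all
      have "t S = Tr (p (flip S0 w0)) (p w) (t S0)" using t(3)[OF S0(3) i S0(2)] S0(1) S(1) by simp
      moreover have "vadj (p (flip S0 w0)) (p w)" using vadjI[OF A corner_flip[OF w0 S0(3)] i] w'(1) by simp
      ultimately have "Tr (p w) (p (flip S0 w0)) (t S) = t S0" using Tr_inv t(2)[OF S0(3)] by simp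
      then show ?thesis using t'S[of S0] t'S[of S] S(1) w'(2) by simp
    qed
  qed
  moreover have "t' w0 = s" using t'S[of "{}"] t(1) by simp
  ultimately show thesis by (rule that)
qed

text \<open>The two common corners are joined by flips inside the common face of the charts, and
  there both sections follow the same transports.\<close>

lemma parallel_section_agree:
  assumes A: "(n, p) \<in> A" "(m, q) \<in> A" and t: "parallel_section n p t" "parallel_section m q t'"
    and w: "corner n w" "corner n v" and w': "corner m w'" "corner m v'"
    and e: "p w = q w'" "p v = q v'" "t w = t' w'"
  shows "t v = t' v'"
proof -
  obtain I I' \<sigma> where al: "aligned n p w m q w' I I' \<sigma>"
    by (rule aligned_corner[OF A w(1) corner_unit_cube[OF w'(1)] e(1)])
  define D where "D = {i. w i \<noteq> v i}"
  have D: "v = flip D w" "D \<subseteq> {..<n}" using corner_diff[OF w] unfolding D_def by blast+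
  have D': "D \<subseteq> I" "v' = flip (\<sigma> ` D) w'"
    using aligned_index[OF A(2) al D(2) corner_unit_cube[OF w'(2)]] e(2) D(1) by auto
  have inj: "inj_on \<sigma> I" using al bij_betw_imp_inj_on unfolding aligned_def by blast
  have "t (flip S w) = t' (flip (\<sigma> ` S) w')" if "finite S" "S \<subseteq> I" for S
    using that
  proof (induction S rule: finite_induct)
    case empty
    then show ?case using e(3) by simp
  next
    case (insert i S)
    have S: "S \<subseteq> I" "i \<in> I" using insert by auto
    have "i < n" "S \<subseteq> {..<n}" using S al unfolding aligned_def by auto
    have \<sigma>i: "\<sigma> i \<notin> \<sigma> ` S" using inj insert(2) S unfolding inj_on_def by blast
    have \<sigma>S: "\<sigma> ` S \<subseteq> {..<m}" "\<sigma> i < m" using aligned_flip(2)[OF al, of "insert i S"] S by auto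
    have "t (flip (insert i S) w) = Tr (p (flip S w)) (p (flip (insert i S) w)) (t (flip S w))"
      using t(1) corner_flip[OF w(1) \<open>S \<subseteq> {..<n}\<close>] \<open>i < n\<close> flip_insert[OF insert(2), of w]
      unfolding parallel_section_def by metis
    also have "\<dots> = Tr (q (flip (\<sigma> ` S) w')) (q (flip (insert (\<sigma> i) (\<sigma> ` S)) w')) (t' (flip (\<sigma> ` S) w'))"
      using insert aligned_flip(1)[OF al S(1)] aligned_flip(1)[OF al, of "insert i S"] S by simp
    also have "\<dots> = t' (flip (insert (\<sigma> i) (\<sigma> ` S)) w')"
      using t(2) corner_flip[OF w'(1) \<sigma>S(1)] \<sigma>S(2) flip_insert[OF \<sigma>i, of w']
      unfolding parallel_section_def by metis
    finally show ?case by simp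
  qed
  then have "t (flip D w) = t' (flip (\<sigma> ` D) w')" using D' finite_subset[OF D(2)] by simp
  then show ?thesis using D D' by simp
qed

text \<open>Transport between any two corners of a common cube. Vertices whose stars overlap need
  not be adjacent, so \<open>Tr\<close> alone would not compare their fibres. The description is
  unique by \<open>parallel_section_agree\<close>.\<close>

definition tau :: "'a \<Rightarrow> 'a \<Rightarrow> 'b \<Rightarrow> 'b" where
  "tau u v s = (THE s'. \<exists>n p t a b. (n, p) \<in> A \<and> parallel_section n p t \<and> corner n a \<and> corner n b \<and>
     u = p a \<and> v = p b \<and> t a = s \<and> t b = s')"

lemma tau_eq:
  assumes "(n, p) \<in> A" "parallel_section n p t" "corner n a" "corner n b"
  shows "tau (p a) (p b) (t a) = t b"
  unfolding tau_def
proof (rule the_equality)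
  show "\<exists>n' p' t' a' b'. (n', p') \<in> A \<and> parallel_section n' p' t' \<and> corner n' a' \<and> corner n' b' \<and>
     p a = p' a' \<and> p b = p' b' \<and> t' a' = t a \<and> t' b' = t b" using assms by blast
  fix s' assume "\<exists>n' p' t' a' b'. (n', p') \<in> A \<and> parallel_section n' p' t' \<and> corner n' a' \<and> corner n' b' \<and>
     p a = p' a' \<and> p b = p' b' \<and> t' a' = t a \<and> t' b' = s'"
  then obtain n' p' t' a' b' where 1: "(n', p') \<in> A" "parallel_section n' p' t'" "corner n' a'" "corner n' b'"
     "p a = p' a'" "p b = p' b'" "t' a' = t a" "t' b' = s'" by blast
  show "s' = t b" using parallel_section_agree[OF 1(1) assms(1) 1(2) assms(2) 1(3,4) assms(3,4)] 1(5-8) by simp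
qed

text \<open>Any chart through \<open>x\<close> has \<open>a\<close>, \<open>b\<close> and
  \<open>c\<close> among its corners, so all three comparisons are read off from one parallel
  section.\<close>

lemma tau_cocycle:
  assumes x: "x \<in> star a" "x \<in> star b" "x \<in> star c" and s: "s \<in> R a"
  shows "tau a b s \<in> R b" "tau b c (tau a b s) = tau a c s"
proof -
  obtain n p y w where w: "(n, p) \<in> A" "y \<in> unit_cube n" "x = p y" "corner n w" "a = p w"
    using x(1) unfolding star_def by blast
  obtain u where u: "corner n u" "b = p u" using star_iff[OF w(1,2)] x(2) w(3) by blast
  obtain v where v: "corner n v" "c = p v" using star_iff[OF w(1,2)] x(3) w(3) by blast
  obtain t where t: "parallel_section n p t" "t w = s" using parallel_section_exists[OF w(1,4)] s w(5) by blast
  have 1: "tau a b s = t u" "tau b c (t u) = t v" "tau a c s = t v"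
    using tau_eq[OF w(1) t(1)] w(4,5) u v t(2) by auto
  then show "tau b c (tau a b s) = tau a c s" by simp
  show "tau a b s \<in> R b" using 1 t(1) u unfolding parallel_section_def by simp
qed

lemma tau_adj:
  assumes "vadj u v" "s \<in> R u" shows "tau u v s = Tr u v s"
proof -
  obtain n p w i where w: "(n, p) \<in> A" "corner n w" "i < n" "u = p w" "v = p (flip {i} w)"
    using assms(1) unfolding vadj_def by blast
  obtain t where t: "parallel_section n p t" "t w = s" using parallel_section_exists[OF w(1,2)] assms(2) w(4) by blast
  have "tau u v s = t (flip {i} w)"
    using tau_eq[OF w(1) t(1) w(2) corner_flip[OF w(2), of "{i}"]] w t(2) by simp
  also have "\<dots> = Tr u v s" using t w unfolding parallel_section_def by simp
  finally show ?thesis .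
qed

lemma tau_same:
  assumes "u \<in> cc_vertices A" "s \<in> R u" shows "tau u u s = s"
proof -
  obtain n p w where w: "(n, p) \<in> A" "corner n w" "u = p w" using assms(1) vertex_iff by blast
  obtain t where t: "parallel_section n p t" "t w = s" using parallel_section_exists[OF w(1,2)] assms(2) w(3) by blast
  show ?thesis using tau_eq[OF w(1) t(1) w(2,2)] w(3) t(2) by simp
qed

end

section \<open>Trivial monodromy\<close>

lemma grid_point:
  fixes s :: real and i N :: nat
  assumes "i < N" "real i \<le> s * N" "s * N \<le> real i + 1"
  shows "s \<in> {0..1}" "\<bar>real i / N - s\<bar> \<le> 1 / N"
proof -
  have N: "0 < real N" "real i + 1 \<le> real N" using assms(1) by linarith+
  then have "s * N \<le> 1 * N" "0 \<le> s * N" using assms by linarith+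
  then show "s \<in> {0..1}" using mult_le_cancel_right_pos[OF N(1)] zero_le_mult_iff[of s "real N"] N(1) by auto
  have "\<bar>real i / N - s\<bar> = \<bar>real i - s * N\<bar> / N" using N(1) by (simp add: abs_divide[symmetric] field_simps)
  also have "\<dots> \<le> 1 / N" using assms(2,3) N(1) by (intro divide_right_mono) auto
  finally show "\<bar>real i / N - s\<bar> \<le> 1 / N" .
qed

context cube_cpx
begin

text \<open>Vertex \<open>k\<close> is visited at time \<open>k\<close>. The last clause uses
  half-open intervals because at time \<open>k + 1\<close> the path is at the next vertex, which the
  open star of \<open>xs ! k\<close> omits.\<close>

lemma walk_path:
  "successively vadj xs \<Longrightarrow> set xs \<subseteq> cc_vertices A \<Longrightarrow> length xs = Suc n \<Longrightarrow>
    \<exists>g. continuous_map euclideanreal (cc_topology X A) g \<and> (\<forall>k\<le>n. g (real k) = xs ! k) \<and>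
      (\<forall>k<n. \<forall>s. real k \<le> s \<and> s < real k + 1 \<longrightarrow> g s \<in> star (xs ! k))"
proof (induction xs arbitrary: n rule: rev_induct)
  case (snoc z xs)
  show ?case
  proof (cases "xs = []")
    case True
    have "z \<in> X"
      using snoc(3) vertex_iff chart_X corner_unit_cube by (metis True append_Nil list.set_intros(1) subsetD)
    then have "continuous_map euclideanreal (cc_topology X A) (\<lambda>_. z)"
      using topspace_cc by simp
    then show ?thesis using True snoc(4) by (intro exI[of _ "\<lambda>_. z"]) auto
  next
    case False
    then obtain m where m: "length xs = Suc m" "n = Suc m" using snoc(4) by (cases xs) auto
    have "successively vadj xs" "vadj (last xs) z" using snoc(2) False by (auto simp: successively_append_iff)
    then obtain g where g: "continuous_map euclideanreal (cc_topology X A) g" "\<And>k. k \<le> m \<Longrightarrow> g (real k) = xs ! k"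
      "\<And>k s. k < m \<Longrightarrow> real k \<le> s \<Longrightarrow> s < real k + 1 \<Longrightarrow> g s \<in> star (xs ! k)"
      using snoc(1)[of m] snoc(3) m by auto
    have last: "last xs = xs ! m" using m False by (simp add: last_conv_nth)
    obtain l p w i where w: "(l, p) \<in> A" "corner l w" "i < l" "xs ! m = p w" "z = p (flip {i} w)"
      using \<open>vadj (last xs) z\<close> unfolding vadj_def last by blast
    \<comment> \<open>The parameter is clamped to the unit interval, so the segment is defined and
      continuous on the whole line.\<close>
    define seg where "seg s = (\<lambda>j. if j = i then w i + max 0 (min 1 (s - real m)) * (1 - 2 * w i) else w j)" for s :: real
    have w01: "w i = 0 \<or> w i = 1" using corner_01[OF w(2)] .
    have segU: "seg s \<in> unit_cube l" for s
    proof -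
      have "w \<in> unit_cube l" using corner_unit_cube[OF w(2)] .
      then show ?thesis using w01 w(3) unfolding unit_cube_def seg_def by (auto simp: max_def min_def)
    qed
    have seg_m: "seg (real m) = w" unfolding seg_def by auto
    have seg_n: "seg (real n) = flip {i} w" unfolding seg_def flip_def m(2) by auto
    have "continuous_on UNIV seg"
    proof (rule continuous_on_coordinatewise_then_product)
      fix j show "continuous_on UNIV (\<lambda>s. seg s j)"
        unfolding seg_def by (cases "j = i") (auto intro!: continuous_intros)
    qed
    then have "continuous_map euclideanreal (top_of_set (unit_cube l)) seg"
      using segU by (auto simp: continuous_map_in_subtopology)
    then have "continuous_map euclideanreal (cc_topology X A) (p \<circ> seg)"
      using chart_continuous[OF w(1)] by (rule continuous_map_compose)
    moreover define q where "q = p \<circ> seg"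
    ultimately have e: "continuous_map euclideanreal (cc_topology X A) q" by simp
    have q: "q s = p (seg s)" for s unfolding q_def by simp
    define g' where "g' s = (if s \<le> real m then g s else q s)" for s
    have "continuous_map euclideanreal (cc_topology X A) g'"
      unfolding g'_def
    proof (rule continuous_map_cases_le)
      show "g x = q x" if "x = real m" for x using that g(2)[of m] seg_m w(4) q by simp
    qed (auto intro: continuous_map_from_subtopology g(1) e)
    moreover have "g' (real k) = (xs @ [z]) ! k" if "k \<le> n" for k
    proof (cases "k \<le> m")
      case True
      then show ?thesis unfolding g'_def using g(2) m by (simp add: nth_append)
    next
      case False
      then have "k = n" using that m by simp
      then show ?thesis unfolding g'_def using seg_n w(5) m q by (simp add: nth_append)
    qed
    moreover have "g' s \<in> star ((xs @ [z]) ! k)" if k: "k < n" "real k \<le> s" "s < real k + 1" for k s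
    proof (cases "k < m")
      case True
      then have "s \<le> real m" using k(3) by linarith
      then show ?thesis unfolding g'_def using g(3)[OF True k(2,3)] True m by (simp add: nth_append)
    next
      case False
      then have km: "k = m" using k(1) m by simp
      have "\<bar>seg s j - w j\<bar> < 1" for j using w01 k(2,3) unfolding seg_def km by auto
      then have "p (seg s) \<in> star (p w)" using star_iff[OF w(1) segU] w(2) by blast
      moreover have "g' s = p (seg s)"
      proof (cases "s \<le> real m")
        case True
        then have "s = real m" using k(2) km by simp
        then show ?thesis unfolding g'_def using g(2)[of m] seg_m w(4) by simp
      qed (simp add: g'_def q)
      ultimately show ?thesis using km m w(4) by (simp add: nth_append)
    qed
    ultimately show ?thesis by blast
  qed
qed simp

text \<open>A Lebesgue number for the cover of \<open>K\<close> by preimages of open stars.\<close>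

lemma uniform_star:
  fixes K :: "'c::metric_space set"
  assumes K: "compact K" and h: "continuous_map (top_of_set K) (cc_topology X A) h"
  obtains e where "e > 0" "\<And>x. x \<in> K \<Longrightarrow> \<exists>v\<in>cc_vertices A. \<forall>y\<in>K. dist x y < e \<longrightarrow> h y \<in> star v"
proof -
  define \<C> where "\<C> = {U. open U \<and> (\<exists>v\<in>cc_vertices A. \<forall>y\<in>K \<inter> U. h y \<in> star v)}"
  have "K \<subseteq> \<Union>\<C>"
  proof
    fix x assume x: "x \<in> K"
    then have "h x \<in> X" using h topspace_cc unfolding continuous_map_def by auto
    then obtain v where v: "v \<in> cc_vertices A" "h x \<in> star v" using star_cover by blast
    have "openin (top_of_set K) {y \<in> topspace (top_of_set K). h y \<in> star v}"
      using h star_open by (rule openin_continuous_map_preimage)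
    then obtain U where U: "open U" "{y \<in> K. h y \<in> star v} = K \<inter> U" unfolding openin_open by auto
    then have "U \<in> \<C>" unfolding \<C>_def using v(1) by blast
    moreover have "x \<in> U" using x v(2) U(2) by blast
    ultimately show "x \<in> \<Union>\<C>" by blast
  qed
  moreover have "\<And>G. G \<in> \<C> \<Longrightarrow> open G" unfolding \<C>_def by blast
  ultimately obtain e where e: "0 < e" "\<And>x. x \<in> K \<Longrightarrow> \<exists>G\<in>\<C>. ball x e \<subseteq> G" using Heine_Borel_lemma[OF K] by metis
  have "\<exists>v\<in>cc_vertices A. \<forall>y\<in>K. dist x y < e \<longrightarrow> h y \<in> star v" if x: "x \<in> K" for x
  proof -
    obtain G where G: "G \<in> \<C>" "ball x e \<subseteq> G" using e(2)[OF x] by blast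
    then obtain v where "v \<in> cc_vertices A" "\<forall>y\<in>K \<inter> G. h y \<in> star v" unfolding \<C>_def by blast
    then show ?thesis using G(2) by (intro bexI[of _ v]) auto
  qed
  with e(1) show thesis by (rule that)
qed

text \<open>Stars of vertices reachable from \<open>u\<close> and stars of the others form two open
  sets covering \<open>X\<close>. They are disjoint because overlapping stars have their vertices in
  one cube.\<close>

lemma skeleton_connected:
  assumes pc: "path_connected_space (cc_topology X A)" and u: "u \<in> cc_vertices A" and v: "v \<in> cc_vertices A"
  shows "\<exists>xs. walk vadj xs u v"
proof -
  define U where "U = (\<Union>w\<in>{w \<in> cc_vertices A. vadj\<^sup>*\<^sup>* u w}. star w)"
  define W where "W = (\<Union>w\<in>{w \<in> cc_vertices A. \<not> vadj\<^sup>*\<^sup>* u w}. star w)"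
  have "openin (cc_topology X A) U" "openin (cc_topology X A) W"
    unfolding U_def W_def using star_open by blast+
  moreover have "topspace (cc_topology X A) \<subseteq> U \<union> W"
    unfolding topspace_cc U_def W_def using star_cover by blast
  moreover have "U \<inter> W = {}"
    unfolding U_def W_def using star_walk rtranclp_trans[of vadj u] by blast
  moreover have "U \<noteq> {}" unfolding U_def using u star_self[OF u] by blast
  ultimately have "W = {}"
    using path_connected_imp_connected_space[OF pc] unfolding connected_space_def by blast
  then have "vadj\<^sup>*\<^sup>* u v" unfolding W_def using v star_self[OF v] by blast
  then show ?thesis by (rule rtranclp_walk)
qed

end

context cube_local_system
begin

text \<open>A null homotopy of the loop is cut into small squares, each carried by an open star. The lifts of
  consecutive rows of vertices agree at the end points, and the top row is constant.\<close>

lemma loop_transport: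
  assumes sc: "simply_connected_space (cc_topology X A)"
    and w: "walk vadj xs v0 v0" and v0: "v0 \<in> cc_vertices A" and s: "s \<in> R v0"
  shows "transport Tr xs s = s"
proof -
  have xs: "xs \<noteq> []" "successively vadj xs" "hd xs = v0" "last xs = v0" using w unfolding walk_def by auto
  obtain n where n: "length xs = Suc n" using xs(1) by (cases xs) auto
  have adjk: "vadj (xs ! k) (xs ! Suc k)" if "k < n" for k
    using xs(2) that n by (simp add: successively_conv_nth)
  have xs0: "xs ! 0 = v0" "xs ! n = v0" using xs(1,3,4) n by (simp_all add: hd_conv_nth last_conv_nth)
  have xsV: "xs ! k \<in> cc_vertices A" if "k \<le> n" for k
    using that adjk[of k] vadj_vertex xs0(2) v0 by (cases "k = n") auto
  then have setV: "set xs \<subseteq> cc_vertices A" using n by (auto simp: in_set_conv_nth less_Suc_eq_le)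
  show ?thesis
  proof (cases "n = 0")
    case True
    then obtain x where "xs = [x]" using n by (cases xs) auto
    then show ?thesis by simp
  next
    case False
    then have n0: "n > 0" by simp
    obtain g where g: "continuous_map euclideanreal (cc_topology X A) g" "\<And>k. k \<le> n \<Longrightarrow> g (real k) = xs ! k"
      "\<And>k s. k < n \<Longrightarrow> real k \<le> s \<Longrightarrow> s < real k + 1 \<Longrightarrow> g s \<in> star (xs ! k)"
      using walk_path[OF xs(2) setV n] by blast
    define G where "G = g \<circ> (\<lambda>s. real n * s)"
    have "continuous_map (top_of_set {0..1}) euclideanreal (\<lambda>s. real n * s)"
      by (auto intro!: continuous_intros)
    then have "pathin (cc_topology X A) G" unfolding pathin_def G_def using g(1) by (rule continuous_map_compose)
    have G01: "G 0 = v0" "G 1 = v0" using g(2)[of 0] g(2)[of n] xs0 unfolding G_def by simp_all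
    have "homotopic_with (\<lambda>h. h 0 = v0 \<and> h 1 = v0) (top_of_set {0..1}) (cc_topology X A) G (\<lambda>_. v0)"
    proof -
      have "\<forall>g. pathin (cc_topology X A) g \<and> g 1 = g 0 \<longrightarrow>
          homotopic_with (\<lambda>h. h 0 = g 0 \<and> h 1 = g 0) (top_of_set {0..1}) (cc_topology X A) g (\<lambda>_. g 0)"
        using sc unfolding simply_connected_space_def by (rule conjunct2)
      from spec[OF this, of G] show ?thesis
        using \<open>pathin (cc_topology X A) G\<close> G01 by simp
    qed
    then obtain h where h': "continuous_map (prod_topology (top_of_set {0..1::real}) (top_of_set {0..1::real})) (cc_topology X A) h"
      "\<forall>x. h (0, x) = G x" "\<forall>x. h (1, x) = v0" "\<forall>t\<in>{0..1}. h (t, 0) = v0 \<and> h (t, 1) = v0"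
      unfolding homotopic_with_def by blast
    note h = h'(1)[unfolded prod_topology_subtopology_eu] spec[OF h'(2)] spec[OF h'(3)] bspec[OF h'(4)]
    have "compact ({0..1::real} \<times> {0..1::real})" by (intro compact_Times compact_Icc)
    then obtain e where e: "e > 0" "\<And>x. x \<in> {0..1} \<times> {0..1} \<Longrightarrow>
      \<exists>v\<in>cc_vertices A. \<forall>y\<in>{0..1} \<times> {0..1}. dist x y < e \<longrightarrow> h y \<in> star v"
      using uniform_star[OF _ h(1)] by blast
    obtain M where M: "2 / e < real M" using reals_Archimedean2 by blast
    then have M0: "real M > 0" using e(1) by (meson divide_pos_pos less_trans zero_less_numeral)
    \<comment> \<open>A multiple of \<open>n\<close>, so that the vertices of the edge path fall on
      grid lines; \<open>M\<close> is so large that a cell has diameter below the Lebesgue number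
      \<open>e\<close>.\<close>
    define N where "N = n * M"
    have N0: "real N > 0" "N > 0" using n0 M0 unfolding N_def by simp_all
    have "2 / e < real N"
    proof -
      have "M \<le> N" using n0 unfolding N_def by (cases n) simp_all
      then have "real M \<le> real N" by simp
      then show ?thesis using M by linarith
    qed
    then have Ne: "2 / real N < e" using N0 e(1) by (simp add: field_simps)
    \<comment> \<open>Column \<open>i\<close> is the path parameter and row \<open>j\<close> the
      homotopy parameter. Cells are closed, so a grid point lies in the stars of the carriers of all
      cells around it.\<close>
    have "\<exists>c. i < N \<longrightarrow> j < N \<longrightarrow> c \<in> cc_vertices A \<and> (\<forall>(t::real) (s::real). real j \<le> t * N \<and> t * N \<le> real j + 1 \<and>
        real i \<le> s * N \<and> s * N \<le> real i + 1 \<longrightarrow> h (t, s) \<in> star c)" for i j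
    proof (cases "i < N \<and> j < N")
      case True
      have "(real j / N, real i / N) \<in> {0..1} \<times> {0..1}" using True N0 by simp
      then obtain c where c: "c \<in> cc_vertices A"
        "\<forall>y\<in>{0..1} \<times> {0..1}. dist (real j / N, real i / N) y < e \<longrightarrow> h y \<in> star c" using e(2) by blast
      have "h (t, s) \<in> star c" if t: "real j \<le> t * N" "t * N \<le> real j + 1" "real i \<le> s * N" "s * N \<le> real i + 1" for t s :: real
      proof -
        have 1: "t \<in> {0..1}" "s \<in> {0..1}" "\<bar>real j / N - t\<bar> \<le> 1 / N" "\<bar>real i / N - s\<bar> \<le> 1 / N"
          using grid_point[of j N t] grid_point[of i N s] True t by auto
        have "dist (real j / N, real i / N) (t, s) \<le> \<bar>real j / N - t\<bar> + \<bar>real i / N - s\<bar>"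
          unfolding dist_Pair_Pair dist_real_def by (rule sqrt_sum_squares_le_sum_abs[THEN order_trans]) simp
        also have "\<dots> \<le> 2 / N" using 1(3,4) by simp
        also have "\<dots> < e" by (rule Ne)
        finally show ?thesis using c(2) 1(1,2) by blast
      qed
      then show ?thesis using c(1) by blast
    qed blast
    then obtain c where c: "\<And>i j. i < N \<Longrightarrow> j < N \<Longrightarrow> c i j \<in> cc_vertices A"
      "\<And>i j (t::real) (s::real). i < N \<Longrightarrow> j < N \<Longrightarrow> real j \<le> t * N \<Longrightarrow> t * N \<le> real j + 1 \<Longrightarrow>
        real i \<le> s * N \<Longrightarrow> s * N \<le> real i + 1 \<Longrightarrow> h (t, s) \<in> star (c i j)" by metis
    have N1: "real (N - 1) \<le> real N" "real N \<le> real (N - 1) + 1" "N - 1 < N" using N0 by linarith+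
    \<comment> \<open>The homotopy is constant on these sides, and the only open star containing the
      vertex \<open>v0\<close> is its own.\<close>
    have c_left: "c 0 j = v0" and c_right: "c (N - 1) j = v0" if j: "j < N" for j
    proof -
      have "real j / N \<in> {0..1}" using j N0 by simp
      then have hv: "h (real j / N, 0) = v0" "h (real j / N, 1) = v0" using h(4) by blast+
      have "h (real j / N, 0) \<in> star (c 0 j)" using j N0 by (intro c(2)) simp_all
      then show "c 0 j = v0" using hv star_vertex v0 by metis
      have "h (real j / N, 1) \<in> star (c (N - 1) j)" using j N0 N1 by (intro c(2)) simp_all
      then show "c (N - 1) j = v0" using hv star_vertex v0 by metis
    qed
    have c_top: "c i (N - 1) = v0" if i: "i < N" for i
    proof -
      have "h (1, real i / N) \<in> star (c i (N - 1))" using i N0 N1 by (intro c(2)) simp_all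
      then show ?thesis using h(3) star_vertex v0 by metis
    qed
    \<comment> \<open>Transport of \<open>s\<close> along the carriers of row
      \<open>j\<close>.\<close>
    define a where "a j = rec_nat s (\<lambda>i r. tau (c i j) (c (Suc i) j) r)" for j
    have a0: "a j 0 = s" and aS: "a j (Suc i) = tau (c i j) (c (Suc i) j) (a j i)" for i j
      unfolding a_def by simp_all
    have edge: "h (real j / N, real (Suc i) / N) \<in> star (c i j)" "h (real j / N, real (Suc i) / N) \<in> star (c (Suc i) j)"
      if "Suc i < N" "j < N" for i j
      using that N0 by (intro c(2); simp)+
    have a_in: "a j i \<in> R (c i j)" if "j < N" "i < N" for i j
      using that(2)
    proof (induction i)
      case 0
      then show ?case using a0 c_left that(1) s by simp
    next
      case (Suc i)
      show ?case unfolding aS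
        using tau_cocycle(1)[OF edge(1)[OF Suc(2) that(1)] edge(2)[OF Suc(2) that(1)] edge(2)[OF Suc(2) that(1)]] Suc by simp
    qed
    \<comment> \<open>The four carriers around a grid point have that point in all their stars, so
      the cocycle identity lets the two routes around it agree.\<close>
    have rows: "a (Suc j) i = tau (c i j) (c i (Suc j)) (a j i)" if j: "Suc j < N" and "i < N" for i j
      using that(2)
    proof (induction i)
      case 0
      have "j < N" using j by simp
      then show ?case using a0 c_left j tau_same[OF v0 s] N0 by simp
    next
      case (Suc i)
      have "i < N" "j < N" using Suc j by simp_all
      let ?x = "h (real (Suc j) / N, real (Suc i) / N)"
      have x: "?x \<in> star (c i j)" "?x \<in> star (c (Suc i) j)" "?x \<in> star (c i (Suc j))" "?x \<in> star (c (Suc i) (Suc j))"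
        using Suc(2) j N0 by (intro c(2); simp)+
      have R: "a j i \<in> R (c i j)" using a_in \<open>i < N\<close> \<open>j < N\<close> by simp
      have "a (Suc j) (Suc i) = tau (c i (Suc j)) (c (Suc i) (Suc j)) (tau (c i j) (c i (Suc j)) (a j i))"
        using aS Suc \<open>i < N\<close> by simp
      also have "\<dots> = tau (c i j) (c (Suc i) (Suc j)) (a j i)" by (rule tau_cocycle(2)[OF x(1,3,4) R])
      also have "\<dots> = tau (c (Suc i) j) (c (Suc i) (Suc j)) (tau (c i j) (c (Suc i) j) (a j i))"
        by (rule tau_cocycle(2)[OF x(1,2,4) R, symmetric])
      finally show ?case using aS by simp
    qed
    have row_end: "a j (N - 1) = a 0 (N - 1)" if "j < N" for j
      using that
    proof (induction j)
      case (Suc j)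
      have "j < N" using Suc by simp
      have "a (Suc j) (N - 1) = tau v0 v0 (a j (N - 1))"
        using rows[OF Suc(2) N1(3)] c_right Suc(2) \<open>j < N\<close> by simp
      also have "\<dots> = a j (N - 1)"
        using tau_same[OF v0] a_in[OF \<open>j < N\<close> N1(3)] c_right[OF \<open>j < N\<close>] by simp
      finally show ?case using Suc by simp
    qed simp
    have top: "a (N - 1) i = s" if "i < N" for i
      using that
    proof (induction i)
      case (Suc i)
      then show ?case using aS[of "N - 1" i] c_top tau_same[OF v0 s] by simp
    qed (rule a0)
    have end0: "a 0 (N - 1) = s" using row_end[OF N1(3)] top[OF N1(3)] by simp
    define b where "b k = transport Tr (take (Suc k) xs) s" for k
    have b0: "b 0 = s" unfolding b_def using xs(1) by (cases xs) auto
    have bS: "b (Suc k) = Tr (xs ! k) (xs ! Suc k) (b k)" if "k < n" for k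
    proof -
      have "take (Suc (Suc k)) xs = take (Suc k) xs @ [xs ! Suc k]"
        using that n by (intro take_Suc_conv_app_nth) simp
      moreover have "last (take (Suc k) xs) = xs ! k" using that n by (simp add: take_Suc_conv_app_nth)
      moreover have "take (Suc k) xs \<noteq> []" using xs(1) by simp
      ultimately show ?thesis
        unfolding b_def using transport_snoc[of "take (Suc k) xs" Tr "xs ! Suc k" s] by argo
    qed
    have b_in: "b k \<in> R (xs ! k)" if "k \<le> n" for k
      using that
    proof (induction k)
      case 0
      then show ?case using b0 s xs0 by simp
    next
      case (Suc k)
      then show ?case using bS Tr_in[OF adjk[of k]] by simp
    qed
    have hG: "h (0 / N, x) = g (real n * x)" for x using h(2)[of x] unfolding G_def by simp
    have Mpos: "M > 0" using M0 by simp
    \<comment> \<open>Row 0 follows the edge path. Inside edge \<open>k\<close> the cocycle identity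
      at the grid point suffices; at a multiple of \<open>M\<close> the grid point is the next
      vertex, which forces both adjacent carriers to be that vertex, and \<open>b\<close> advances
      by one edge.\<close>
    have bottom: "a 0 i = tau (xs ! (i div M)) (c i 0) (b (i div M))" if "i < N" for i
      using that
    proof (induction i)
      case 0
      then show ?case using a0 b0 c_left[of 0] xs0 tau_same[OF v0 s] N0 by simp
    next
      case (Suc i)
      have iN: "i < N" using Suc by simp
      define k where "k = i div M"
      have kn: "k < n" unfolding k_def using iN N_def by (simp add: less_mult_imp_div_less)
      have IH: "a 0 i = tau (xs ! k) (c i 0) (b k)" using Suc iN k_def by simp
      let ?x = "h (0 / N, real (Suc i) / N)"
      have x: "?x \<in> star (c i 0)" "?x \<in> star (c (Suc i) 0)" using edge[of i 0] Suc(2) N0 by simp_all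
      have "real n * (real (Suc i) / N) = real (Suc i) / M" unfolding N_def using n0 by simp
      then have xg: "?x = g (real (Suc i) / M)" by (simp only: hG)
      show ?case
      proof (cases "Suc i mod M = 0")
        case True
        have k1: "Suc i div M = Suc k" using True unfolding k_def by (simp add: div_Suc)
        then have "Suc i = Suc k * M" using True by (metis add.right_neutral div_mult_mod_eq)
        then have "real (Suc i) / M = real (Suc k)" using M0 by (simp add: field_simps)
        then have "?x = xs ! Suc k" using xg g(2)[of "Suc k"] kn by simp
        then have cc: "c i 0 = xs ! Suc k" "c (Suc i) 0 = xs ! Suc k"
          using x star_vertex xsV[of "Suc k"] kn by (metis Suc_leI)+
        have "a 0 i = b (Suc k)" using IH cc tau_adj[OF adjk[OF kn] b_in] bS[OF kn] kn by simp
        then show ?thesis using aS[of 0 i] cc k1 by simp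
      next
        case False
        have k1: "Suc i div M = k" using False unfolding k_def by (simp add: div_Suc)
        have "k * M \<le> Suc i" "Suc i < Suc k * M"
          using k1 Mpos by (metis div_times_less_eq_dividend, metis dividend_less_div_times mult_Suc add.commute)
        then have "real k * M \<le> real (Suc i)" "real (Suc i) < (real k + 1) * M"
          by (metis of_nat_le_iff of_nat_mult, metis of_nat_less_iff of_nat_mult of_nat_Suc add.commute)
        then have "real k \<le> real (Suc i) / M" "real (Suc i) / M < real k + 1"
          using M0 by (simp_all add: field_simps)
        then have xk: "?x \<in> star (xs ! k)" using g(3)[OF kn] xg by simp
        have "a 0 (Suc i) = tau (c i 0) (c (Suc i) 0) (tau (xs ! k) (c i 0) (b k))" using aS IH by simp
        also have "\<dots> = tau (xs ! k) (c (Suc i) 0) (b k)"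
          using kn by (intro tau_cocycle(2)[OF xk x] b_in) simp
        finally show ?thesis using k1 by simp
      qed
    qed
    \<comment> \<open>The last cell still belongs to the last edge; its carrier is
      \<open>v0\<close>, so the remaining comparison is the transport along that edge.\<close>
    have "(N - 1) div M = n - 1"
    proof (rule div_nat_eqI)
      have "n * M = (n - 1) * M + M" using n0 by (cases n) auto
      then show "M * (n - 1) \<le> N - 1" "N - 1 < M * Suc (n - 1)"
        unfolding N_def using Mpos n0 by (auto simp: mult.commute)
    qed
    moreover have "n - 1 < n" "Suc (n - 1) = n" using n0 by simp_all
    ultimately have "a 0 (N - 1) = tau (xs ! (n - 1)) (xs ! n) (b (n - 1))"
      using bottom[OF N1(3)] c_right[OF N0(2)] xs0 by simp
    also have "\<dots> = Tr (xs ! (n - 1)) (xs ! n) (b (n - 1))"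
      using tau_adj[OF adjk[of "n - 1"]] b_in[of "n - 1"] n0 by simp
    also have "\<dots> = b n" using bS[of "n - 1"] n0 by simp
    also have "\<dots> = transport Tr xs s" unfolding b_def using n by simp
    finally show ?thesis using end0 by simp
  qed
qed

lemma transport_rev:
  "walk vadj xs u v \<Longrightarrow> s \<in> R u \<Longrightarrow> transport Tr (rev xs) (transport Tr xs s) = s"
proof (induction xs arbitrary: u s rule: induct_list012)
  case (3 x y zs)
  have w: "vadj x y" "x = u" "walk vadj (y # zs) y v" using "3.prems"(1) by (auto simp: walk_def)
  have "transport Tr (rev (x # y # zs)) (transport Tr (x # y # zs) s) =
      transport Tr (rev (y # zs) @ [x]) (transport Tr (y # zs) (Tr x y s))" by simp
  also have "\<dots> = Tr (last (rev (y # zs))) x (transport Tr (rev (y # zs)) (transport Tr (y # zs) (Tr x y s)))"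
    by (rule transport_snoc) simp
  also have "last (rev (y # zs)) = y" by simp
  also have "transport Tr (rev (y # zs)) (transport Tr (y # zs) (Tr x y s)) = Tr x y s"
    using "3.IH"(2)[OF w(3)] Tr_in[OF w(1)] "3.prems"(2) w(2) by simp
  also have "Tr y x (Tr x y s) = s" using Tr_inv[OF w(1)] "3.prems"(2) w(2) by simp
  finally show ?case .
qed (auto simp: walk_def)

lemma transport_join:
  "xs \<noteq> [] \<Longrightarrow> ys \<noteq> [] \<Longrightarrow> last xs = hd ys \<Longrightarrow> transport T (xs @ tl ys) s = transport T ys (transport T xs s)"
proof (induction xs arbitrary: s rule: induct_list012)
  case (2 x)
  then show ?case by (cases ys) auto
qed auto

text \<open>Following \<open>xs\<close> and then \<open>ys\<close> backwards is a loop, to which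
  \<open>loop_transport\<close> applies.\<close>

lemma path_independence:
  assumes sc: "simply_connected_space (cc_topology X A)"
    and w: "walk vadj xs u v" "walk vadj ys u v" and u: "u \<in> cc_vertices A" and s: "s \<in> R u"
  shows "transport Tr xs s = transport Tr ys s"
proof -
  have r: "walk vadj (rev ys) v u"
    using w(2) vadj_sym unfolding walk_def
    by (auto simp: successively_rev hd_rev last_rev elim!: successively_mono)
  have ne: "xs \<noteq> []" "rev ys \<noteq> []" "last xs = hd (rev ys)" using w r unfolding walk_def by auto
  have "walk vadj (xs @ tl (rev ys)) u u"
  proof (cases "tl (rev ys)")
    case Nil
    then have "rev ys = [v]" using r by (cases "rev ys") (auto simp: walk_def)
    then show ?thesis using w r Nil by (auto simp: walk_def)
  next
    case (Cons z zs)
    then have "rev ys = v # z # zs" using r by (cases "rev ys") (auto simp: walk_def)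
    then show ?thesis using w(1) r by (auto simp: walk_def successively_append_iff)
  qed
  then have "transport Tr (xs @ tl (rev ys)) s = s" by (rule loop_transport[OF sc _ u s])
  moreover have "transport Tr (xs @ tl (rev ys)) s = transport Tr (rev ys) (transport Tr xs s)"
    by (rule transport_join[OF ne])
  ultimately have "transport Tr (rev ys) (transport Tr xs s) = s" by (simp only:)
  then have "transport Tr ys s = transport Tr (rev (rev ys)) (transport Tr (rev ys) (transport Tr xs s))" by simp
  also have "\<dots> = transport Tr xs s" using transport_rev[OF r] transport_in[OF ls w(1) s] by blast
  finally show ?thesis by simp
qed

end

section \<open>Automorphisms and the fixed point\<close>

context cube_cpx
begin

lemma center_unique:
  assumes A: "(n, p) \<in> A" "(m, q) \<in> A" and w: "corner n w" "corner m w'"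
    and K: "K \<subseteq> {..<n}" "L \<subseteq> {..<m}" and e: "p ` face n w K = q ` face m w' L"
  shows "p (center K w) = q (center L w')"
proof -
  have "p w \<in> q ` face m w' L" using e face_base[OF w(1)] by blast
  then obtain y where y: "y \<in> face m w' L" "p w = q y" by blast
  then have yU: "y \<in> unit_cube m" unfolding face_def by auto
  obtain I I' \<sigma> where al: "aligned n p w m q y I I' \<sigma>" by (rule aligned_corner[OF A w(1) yU y(2)])
  then have "corner m y" unfolding aligned_def by auto
  have fy: "face m w' L = face m y L" using y(1) unfolding face_def by auto
  have "flip K w \<in> face n w K" using flip_face[OF w(1) order_refl K(1)] .
  then obtain z where z: "z \<in> face m w' L" "p (flip K w) = q z" using e by blast
  then have "z \<in> unit_cube m" unfolding face_def by auto
  then have KI: "K \<subseteq> I" using aligned_index(1)[OF A(2) al K(1) _ z(2)] by blast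
  have "q ` face m y (\<sigma> ` K) = q ` face m y L" using aligned_face[OF al KI] e fy by simp
  then have "face m y (\<sigma> ` K) = face m y L"
    by (rule iffD1[OF inj_on_image_eq_iff[OF chart_inj[OF A(2)] face_unit_cube face_unit_cube]])
  then have "\<sigma> ` K = L" using face_eq_iff[OF \<open>corner m y\<close> aligned_flip(2)[OF al KI] K(2)] by simp
  then have "p (center K w) = q (center L y)" using aligned_center[OF al KI] by simp
  moreover have "center L y = center L w'" using y(1) unfolding center_def face_def by auto
  ultimately show ?thesis by simp
qed

text \<open>The composite of \<open>f\<close> and \<open>p\<close> is treated as one more
  parametrisation, glued to \<open>q\<close> along its whole cube. The lemmas about a given
  alignment ask at most \<open>q\<close> to be a chart, so they describe \<open>f\<close> in
  coordinates.\<close>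

lemma cubical_map_aligned:
  assumes f: "cubical_map A f" and A: "(n, p) \<in> A" and w: "corner n w"
  obtains m q w' L \<sigma> where "(m, q) \<in> A" "aligned n (f \<circ> p) w m q w' {..<n} L \<sigma>"
proof -
  have "\<exists>(m, q)\<in>A. \<exists>k F h. is_cube_face m k F \<and> cube_isometry n (unit_cube n) m F h \<and>
        (\<forall>x\<in>unit_cube n. f (p x) = q (h x))"
    using bspec[OF f[unfolded cubical_map_def] A] by simp
  then obtain m q k F h where 1: "(m, q) \<in> A" "is_cube_face m k F" "cube_isometry n (unit_cube n) m F h"
      "\<And>x. x \<in> unit_cube n \<Longrightarrow> f (p x) = q (h x)" by auto
  have "F \<subseteq> unit_cube m" using 1(2) unfolding is_cube_face_def by auto
  then have "h x \<in> unit_cube m" if "x \<in> unit_cube n" for x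
    using 1(3) that unfolding cube_isometry_def bij_betw_def by blast
  then have eq: "(f \<circ> p) x = q y \<longleftrightarrow> x \<in> unit_cube n \<and> y = h x" if "x \<in> unit_cube n" "y \<in> unit_cube m" for x y
    using 1(4) that chart_eq_iff[OF 1(1)] by auto
  obtain I I' \<sigma> where al: "aligned n (f \<circ> p) w m q (h w) I I' \<sigma>" "unit_cube n = face n w I"
    by (rule aligned_isometry[OF is_cube_face_unit_cube 1(2,3) w corner_unit_cube[OF w] eq])
  have "I \<subseteq> {..<n}" using al(1) unfolding aligned_def by simp
  moreover have "face n w I = face n w {..<n}" using unit_cube_face[OF w] al(2) by simp
  ultimately have "I = {..<n}" using face_eq_iff[OF w, of I "{..<n}"] by simp
  then show thesis using that[OF 1(1)] al(1) by simp
qed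

lemma cubical_map_adj:
  assumes f: "cubical_map A f" and a: "vadj u v" shows "vadj (f u) (f v)"
proof -
  obtain n p w i where u: "(n, p) \<in> A" "corner n w" "i < n" "u = p w" "v = p (flip {i} w)"
    using a unfolding vadj_def by blast
  obtain m q w' L \<sigma> where 1: "(m, q) \<in> A" and al: "aligned n (f \<circ> p) w m q w' {..<n} L \<sigma>"
    by (rule cubical_map_aligned[OF f u(1,2)])
  have "f u = q w'" "f v = q (flip {\<sigma> i} w')" "\<sigma> i < m" "corner m w'"
    using al aligned_flip[OF al, of "{i}"] u unfolding aligned_def by auto
  then show ?thesis using vadjI[OF 1] by simp
qed

lemma cubical_map_vertex:
  assumes f: "cubical_map A f" and v: "v \<in> cc_vertices A" shows "f v \<in> cc_vertices A"
proof -
  obtain n p w where u: "(n, p) \<in> A" "corner n w" "v = p w" using v vertex_iff by blast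
  obtain m q w' L \<sigma> where 1: "(m, q) \<in> A" and al: "aligned n (f \<circ> p) w m q w' {..<n} L \<sigma>"
    by (rule cubical_map_aligned[OF f u(1,2)])
  then have "f v = q w'" "corner m w'" using u(3) unfolding aligned_def by auto
  then show ?thesis using vertex_iff 1 by blast
qed

lemma cubical_map_star:
  assumes f: "cubical_map A f" and x: "x \<in> star v" shows "f x \<in> star (f v)"
proof -
  obtain n p y w where y: "(n, p) \<in> A" "y \<in> unit_cube n" "x = p y" "corner n w" "v = p w" "\<forall>i<n. \<bar>y i - w i\<bar> < 1"
    using x unfolding star_def by blast
  obtain m q w' L \<sigma> where 1: "(m, q) \<in> A" and al: "aligned n (f \<circ> p) w m q w' {..<n} L \<sigma>"
    by (rule cubical_map_aligned[OF f y(1,4)])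
  have a: "f v = q w'" "corner m w'" "(f \<circ> p) ` face n w {..<n} = q ` face m w' L"
    using al y(5) unfolding aligned_def by auto
  have "(f \<circ> p) y \<in> q ` face m w' L" using a(3) y(2) unit_cube_face[OF y(4)] by blast
  then obtain z where z: "z \<in> unit_cube m" "(f \<circ> p) y = q z" using face_unit_cube by blast
  then have "\<forall>i<m. \<bar>z i - w' i\<bar> < 1" using aligned_close[OF al y(2,6) z] by blast
  then show ?thesis unfolding star_def using 1 a(1,2) z y(3) by auto
qed

lemma finite_star_vertices: assumes "x \<in> X" shows "finite {v. x \<in> star v}"
proof -
  obtain n p y where y: "(n, p) \<in> A" "y \<in> unit_cube n" "x = p y" using chart_exists[OF assms] .
  have "{v. x \<in> star v} \<subseteq> p ` {w. corner n w}" using star_iff[OF y(1,2)] y(3) by blast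
  then show ?thesis by (rule finite_subset) (simp add: finite_corners)
qed

lemma vertex_X: "v \<in> cc_vertices A \<Longrightarrow> v \<in> X"
  using vertex_iff chart_X corner_unit_cube by metis

end

section \<open>Halfspaces inside the cubes of a CAT(0) cube complex\<close>

locale cat0_cube_cpx = flag_cube_cpx +
  assumes sc: "simply_connected_space (cc_topology X A)"
begin

sublocale simply_connected_square_graph "cc_vertices A" vadj vsq
proof unfold_locales
  fix u v assume "u \<in> cc_vertices A" "v \<in> cc_vertices A"
  then show "\<exists>xs. walk vadj xs u v" using skeleton_connected sc unfolding simply_connected_space_def by blast
next
  fix R :: "'a \<Rightarrow> 'a list set set" and T xs ys u v s
  assume a: "local_system vadj vsq R T" "walk vadj xs u v" "walk vadj ys u v" "u \<in> cc_vertices A" "s \<in> R u"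
  interpret cube_local_system X A R T by unfold_locales (rule a(1))
  show "transport T xs s = transport T ys s" by (rule path_independence[OF sc a(2-5)])
qed

lemma half_chart:
  assumes A: "(n, p) \<in> A" and w: "corner n w" and i: "i < n"
  shows "finite B \<Longrightarrow> B \<subseteq> {..<n} \<Longrightarrow> i \<notin> B \<Longrightarrow>
    half (p (flip B w)) (p (flip (insert i B) w)) = half (p w) (p (flip {i} w))"
proof (induction B rule: finite_induct)
  case (insert j B)
  have "vsq (p (flip B w)) (p (flip (insert i B) w)) (p (flip (insert i (insert j B)) w)) (p (flip (insert j B) w))"
    using insert i by (intro vsq_flip[OF A w]) auto
  from half_sq[OF this] show ?case using insert by simp
qed simp

text \<open>Flip the coordinates of \<open>S\<close> one by one. The flip that leaves
  \<open>k\<close> is an edge bounding \<open>k\<close>, and \<open>half_chart\<close> moves this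
  edge back to the corner \<open>w\<close>.\<close>

lemma separating_chart:
  assumes A: "(n, p) \<in> A" and w: "corner n w" and k: "k \<in> halves" "p w \<in> k"
  shows "finite S \<Longrightarrow> S \<subseteq> {..<n} \<Longrightarrow> p (flip S w) \<notin> k \<Longrightarrow> \<exists>i\<in>S. k = half (p w) (p (flip {i} w))"
proof (induction S rule: finite_induct)
  case empty
  then show ?case using k by simp
next
  case (insert i S)
  show ?case
  proof (cases "p (flip S w) \<in> k")
    case True
    have "vadj (p (flip S w)) (p (flip {i} (flip S w)))" using insert by (intro vadjI[OF A] corner_flip[OF w]) auto
    then have "vadj (p (flip S w)) (p (flip (insert i S) w))" using flip_insert[OF insert(2)] by simp
    then have "k = half (p (flip S w)) (p (flip (insert i S) w))"
      using halves_boundary[OF k(1) _ True] insert by blast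
    then show ?thesis using half_chart[OF A w _ insert(1) _ insert(2)] insert by auto
  next
    case False
    then show ?thesis using insert by auto
  qed
qed

lemma chart_not_in_half:
  assumes A: "(n, p) \<in> A" and w: "corner n w" and S: "S \<subseteq> {..<n}" "i \<in> S"
  shows "p (flip S w) \<notin> half (p w) (p (flip {i} w))"
proof -
  have T: "S - {i} \<subseteq> {..<n}" "finite (S - {i})" "i < n" "insert i (S - {i}) = S"
    using S finite_subset[OF S(1)] by auto
  have "vadj (p (flip (S - {i}) w)) (p (flip {i} (flip (S - {i}) w)))"
    by (intro vadjI[OF A] corner_flip[OF w] T)
  then have "vadj (p (flip (S - {i}) w)) (p (flip S w))" using flip_insert[of i "S - {i}" w] T(4) by simp
  then show ?thesis using half_base(2) half_chart[OF A w T(3,2,1)] T(4) by auto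
qed

text \<open>A vertex is determined by the halfspaces containing it, so \<open>y\<close> is the vertex of the cube
  obtained from \<open>v\<close> by crossing the hyperplanes that separate \<open>v\<close> from \<open>y\<close>.\<close>

lemma spanned_subset:
  assumes A: "(n, p) \<in> A" and w: "corner n w" and K: "K \<subseteq> {..<n}"
    and Y: "Y \<subseteq> cc_vertices A" and h: "\<And>k. k \<in> halves \<Longrightarrow> p w \<in> k \<Longrightarrow> \<not> Y \<subseteq> k \<Longrightarrow> \<exists>i\<in>K. k = half (p w) (p (flip {i} w))"
  shows "Y \<subseteq> p ` face n w K"
proof
  fix y assume y: "y \<in> Y"
  define S where "S = {i \<in> K. y \<notin> half (p w) (p (flip {i} w))}"
  have S: "S \<subseteq> K" "S \<subseteq> {..<n}" "finite S" using K finite_subset[OF K] unfolding S_def by auto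
  define c where "c = p (flip S w)"
  have V: "y \<in> cc_vertices A" "c \<in> cc_vertices A" "p w \<in> cc_vertices A"
    using y Y vertex_iff A w corner_flip[OF w S(2)] unfolding c_def by blast+
  have "y = c"
  proof (rule ccontr)
    assume "y \<noteq> c"
    then obtain r where "d y c = Suc r" using d_0_iff[OF V(1,2)] by (cases "d y c") auto
    then obtain u where u: "vadj u c" "d y u = r" using d_pred[OF V(1,2)] by metis
    \<comment> \<open>The last edge of a geodesic from \<open>y\<close> to \<open>c\<close> gives a
      halfspace with \<open>y\<close> inside and \<open>c\<close> outside. It or its complement
      contains \<open>p w\<close>, and in both cases the direction obtained contradicts the choice
      of \<open>S\<close>.\<close>
    define k where "k = half u c"
    have k: "k \<in> halves" "y \<in> k" "c \<notin> k"
      using u \<open>d y c = Suc r\<close> V half_base(2)[OF u(1)] unfolding k_def halves_def half_def by auto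
    show False
    proof (cases "p w \<in> k")
      case True
      then obtain i where "i \<in> S" "k = half (p w) (p (flip {i} w))"
        using separating_chart[OF A w k(1) True S(3,2)] k(3) unfolding c_def by blast
      then show False using k(2) unfolding S_def by blast
    next
      case False
      have k': "cc_vertices A - k \<in> halves" "p w \<in> cc_vertices A - k" "\<not> Y \<subseteq> cc_vertices A - k"
        using compl_halves[OF k(1)] False V k(2) y by auto
      then obtain i where i: "i \<in> K" "cc_vertices A - k = half (p w) (p (flip {i} w))" using h by blast
      then have "i \<in> S" using k(2) unfolding S_def by auto
      then have "c \<notin> cc_vertices A - k" using chart_not_in_half[OF A w S(2)] i(2) unfolding c_def by simp
      then show False using V(2) k(3) by blast
    qed
  qed
  then show "y \<in> p ` face n w K" using flip_face[OF w S(1) K] unfolding c_def by blast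
qed

end

theorem theorem1p3:
  fixes G :: "('g, 'm) monoid_scheme"
    and X :: "'a set"
    and A :: "(nat \<times> ((nat \<Rightarrow> real) \<Rightarrow> 'a)) set"
    and \<phi> :: "'g \<Rightarrow> 'a \<Rightarrow> 'a"
  assumes "finitely_generated_group G"
    and "CAT0_cube_complex X A"
    and "cc_action G X A \<phi>"
    and "\<forall>g\<in>carrier G. elliptic X (\<phi> g)"
    and "\<not> (\<exists>Q. infinite_cube A Q)"
  shows "\<exists>x\<in>X. \<forall>g\<in>carrier G. \<phi> g x = x"
proof -
  interpret cat0_cube_cpx X A
    using assms(2) unfolding CAT0_cube_complex_def by unfold_locales auto
  have ga: "group_action G X \<phi>" and aut: "\<And>g. g \<in> carrier G \<Longrightarrow> cc_automorphism X A (\<phi> g)"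
    using assms(3) unfolding cc_action_def by auto
  interpret ga: group_action G X \<phi> by (rule ga)
  have grp: "group G" using assms(1) unfolding finitely_generated_group_def by simp
  interpret group G by (rule grp)
  have cub: "cubical_map A (\<phi> g)" if "g \<in> carrier G" for g using aut[OF that] unfolding cc_automorphism_def by simp
  have mult: "\<phi> (g \<otimes>\<^bsub>G\<^esub> k) x = \<phi> g (\<phi> k x)" if "g \<in> carrier G" "k \<in> carrier G" "x \<in> X" for g k x
    using ga.composition_rule[OF that(3,1,2)] .
  have one: "\<phi> \<one>\<^bsub>G\<^esub> x = x" if "x \<in> X" for x
    using ga.id_eq_one that by (metis restrict_apply')
  have mem: "\<phi> g x \<in> X" if "g \<in> carrier G" "x \<in> X" for g x
    using ga.element_image that by blast
  have inj: "inj_on (\<phi> g) X" if "g \<in> carrier G" for g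
    using ga.inj_prop[OF that] .
  \<comment> \<open>Powers of \<open>g\<close> fix \<open>x\<close>, so they move \<open>v\<close>
    among the finitely many vertices whose stars contain \<open>x\<close>.\<close>
  have periodic: "\<exists>u\<in>cc_vertices A. \<exists>n>0. \<phi> (g [^]\<^bsub>G\<^esub> (n::nat)) u = u" if g: "g \<in> carrier G" for g
  proof -
    obtain x where x: "x \<in> X" "\<phi> g x = x" using assms(4) g unfolding elliptic_def by blast
    obtain v where v: "v \<in> cc_vertices A" "x \<in> star v" using star_cover[OF x(1)] by blast
    have vX: "v \<in> X" using vertex_X[OF v(1)] .
    have "x \<in> star (\<phi> (g [^]\<^bsub>G\<^esub> k) v)" for k :: nat
    proof (induction k)
      case 0
      then show ?case using v one[OF vX] by simp
    next
      case (Suc k)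
      have "\<phi> (g [^]\<^bsub>G\<^esub> Suc k) v = \<phi> g (\<phi> (g [^]\<^bsub>G\<^esub> k) v)"
        using mult[of g "g [^]\<^bsub>G\<^esub> k" v] nat_pow_Suc2[OF g, of k] g vX by simp
      then show ?case using cubical_map_star[OF cub[OF g] Suc] x(2) by simp
    qed
    then have "range (\<lambda>k::nat. \<phi> (g [^]\<^bsub>G\<^esub> k) v) \<subseteq> {v. x \<in> star v}" by blast
    then have "finite (range (\<lambda>k::nat. \<phi> (g [^]\<^bsub>G\<^esub> k) v))" using finite_star_vertices[OF x(1)] finite_subset by blast
    then have "\<not> inj (\<lambda>k::nat. \<phi> (g [^]\<^bsub>G\<^esub> k) v)" using finite_imageD infinite_UNIV_nat by blast
    then obtain i j where ij: "i < j" "\<phi> (g [^]\<^bsub>G\<^esub> (i::nat)) v = \<phi> (g [^]\<^bsub>G\<^esub> (j::nat)) v"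
      unfolding inj_on_def by (metis nat_neq_iff)
    have "g [^]\<^bsub>G\<^esub> j = g [^]\<^bsub>G\<^esub> i \<otimes>\<^bsub>G\<^esub> g [^]\<^bsub>G\<^esub> (j - i)"
      using ij(1) g by (simp add: nat_pow_mult)
    then have "\<phi> (g [^]\<^bsub>G\<^esub> i) (\<phi> (g [^]\<^bsub>G\<^esub> (j - i)) v) = \<phi> (g [^]\<^bsub>G\<^esub> i) v"
      using mult[of "g [^]\<^bsub>G\<^esub> i" "g [^]\<^bsub>G\<^esub> (j - i)" v] g vX ij(2) by simp
    then have "\<phi> (g [^]\<^bsub>G\<^esub> (j - i)) v = v"
      using inj_onD[OF inj[of "g [^]\<^bsub>G\<^esub> i"]] g vX mem[of "g [^]\<^bsub>G\<^esub> (j - i)" v] by simp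
    then show ?thesis using v(1) ij(1) by (intro bexI[of _ v] exI[of _ "j - i"]) auto
  qed
  interpret act: square_graph_action "cc_vertices A" vadj vsq G \<phi>
  proof unfold_locales
    fix g x assume "g \<in> carrier G" "x \<in> cc_vertices A"
    then show "\<phi> g x \<in> cc_vertices A" using cubical_map_vertex cub by blast
  next
    fix g k x assume "g \<in> carrier G" "k \<in> carrier G" "x \<in> cc_vertices A"
    then show "\<phi> (g \<otimes>\<^bsub>G\<^esub> k) x = \<phi> g (\<phi> k x)" using mult vertex_X by blast
  next
    fix x assume "x \<in> cc_vertices A"
    then show "\<phi> \<one>\<^bsub>G\<^esub> x = x" using one vertex_X by blast
  next
    fix g x y assume "g \<in> carrier G" "vadj x y"
    then show "vadj (\<phi> g x) (\<phi> g y)" using cubical_map_adj cub by blast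
  next
    show "cc_vertices A \<noteq> {}" using periodic[OF one_closed] by blast
  next
    fix g assume "g \<in> carrier G"
    then show "\<exists>u\<in>cc_vertices A. \<exists>n>0. \<phi> (g [^]\<^bsub>G\<^esub> (n::nat)) u = u" by (rule periodic)
  next
    fix v N assume "v \<in> cc_vertices A" "\<And>a. a \<in> N \<Longrightarrow> vadj v a"
      "\<And>a b. a \<in> N \<Longrightarrow> b \<in> N \<Longrightarrow> a \<noteq> b \<Longrightarrow> \<exists>c. vsq v a c b"
    then show "finite N" using infinite_clique_infinite_cube assms(5) by metis
  next
    show "\<exists>S. finite S \<and> S \<subseteq> carrier G \<and> generate G S = carrier G"
      using assms(1) unfolding finitely_generated_group_def by blast
  qed
  obtain Y v N where Y: "conv Y" "act.invariant Y" "v \<in> Y" "finite N" "N \<subseteq> Y"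
    and N: "\<forall>a\<in>N. vadj v a" "\<forall>a\<in>N. \<forall>b\<in>N. a \<noteq> b \<longrightarrow> (\<exists>c. vsq v a c b)"
    and h: "\<forall>k\<in>halves. v \<in> k \<longrightarrow> \<not> Y \<subseteq> k \<longrightarrow> (\<exists>a\<in>N. k = half v a)"
    by (rule act.invariant_cube_corner)
  have YV: "Y \<subseteq> cc_vertices A" using conv_sub[OF Y(1)] .
  obtain n p w where w: "(n, p) \<in> A" "corner n w" "v = p w" "\<forall>a\<in>N. \<exists>i<n. a = p (flip {i} w)"
    by (rule clique_spans_cube[of v N]) (use Y(3,4) YV N in blast)+
  \<comment> \<open>The chart may have further directions; only those leading to \<open>N\<close>
    are kept.\<close>
  define K where "K = {i. i < n \<and> p (flip {i} w) \<in> N}"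
  have K: "K \<subseteq> {..<n}" unfolding K_def by auto
  define C where "C = p ` face n w K"
  have YC: "Y \<subseteq> C" unfolding C_def
  proof (rule spanned_subset[OF w(1,2) K YV])
    fix k assume "k \<in> halves" "p w \<in> k" "\<not> Y \<subseteq> k"
    then obtain a where a: "a \<in> N" "k = half v a" using h w(3) by blast
    then obtain i where "i < n" "a = p (flip {i} w)" using w(4) by blast
    then show "\<exists>i\<in>K. k = half (p w) (p (flip {i} w))" using a w(3) unfolding K_def by blast
  qed
  have CX: "C \<subseteq> X" unfolding C_def face_def using chart_X[OF w(1)] by blast
  \<comment> \<open>The translate of \<open>C\<close> is a cube containing \<open>Y\<close>, hence
    \<open>v\<close> and \<open>N\<close>, so by \<open>span_subset\<close> it contains the cube
    they span. The reverse inclusion will come from \<open>inv g\<close>.\<close>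
  have sub: "C \<subseteq> \<phi> g ` C" if g: "g \<in> carrier G" for g
  proof -
    obtain m q w' L \<sigma> where 1: "(m, q) \<in> A" and al: "aligned n (\<phi> g \<circ> p) w m q w' {..<n} L \<sigma>"
      by (rule cubical_map_aligned[OF cub[OF g] w(1,2)])
    have w': "corner m w'" using al unfolding aligned_def by simp
    have gC: "\<phi> g ` C = q ` face m w' (\<sigma> ` K)"
      using aligned_face[OF al K] unfolding C_def image_comp .
    have "\<phi> g ` Y = Y" using Y(2) g unfolding act.invariant_def by blast
    then have Yg: "Y \<subseteq> q ` face m w' (\<sigma> ` K)" using image_mono[OF YC, of "\<phi> g"] gC by simp
    have F: "is_cube_face m (card (\<sigma> ` K)) (face m w' (\<sigma> ` K))"
      by (rule is_cube_face_face[OF w' aligned_flip(2)[OF al K]])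
    have "p w \<in> q ` face m w' (\<sigma> ` K)" using Yg Y(3) w(3) by blast
    moreover have "p (flip {i} w) \<in> q ` face m w' (\<sigma> ` K)" if "i \<in> K" for i
      using that Y(5) Yg unfolding K_def by blast
    ultimately have "p ` face n w K \<subseteq> q ` face m w' (\<sigma> ` K)" by (rule span_subset[OF w(1) 1 w(2) K F])
    then show ?thesis using gC C_def by simp
  qed
  have inv: "\<phi> g ` C = C" if g: "g \<in> carrier G" for g
  proof
    show "C \<subseteq> \<phi> g ` C" by (rule sub[OF g])
    have "\<phi> g ` C \<subseteq> \<phi> g ` \<phi> (inv\<^bsub>G\<^esub> g) ` C" using sub[of "inv\<^bsub>G\<^esub> g"] g by (intro image_mono) simp
    also have "\<dots> \<subseteq> C"
    proof
      fix z assume "z \<in> \<phi> g ` \<phi> (inv\<^bsub>G\<^esub> g) ` C"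
      then obtain y where y: "y \<in> C" "z = \<phi> g (\<phi> (inv\<^bsub>G\<^esub> g) y)" by blast
      have "y \<in> X" using y(1) CX by blast
      then have "\<phi> (g \<otimes>\<^bsub>G\<^esub> inv\<^bsub>G\<^esub> g) y = z" using mult[OF g inv_closed[OF g]] y(2) by simp
      then have "z = y" using r_inv[OF g] one[OF \<open>y \<in> X\<close>] by simp
      then show "z \<in> C" using y(1) by simp
    qed
    finally show "\<phi> g ` C \<subseteq> C" .
  qed
  \<comment> \<open>Coordinates carry the centre of \<open>C\<close> to the centre of its image
    cube, and the image is \<open>C\<close> again.\<close>
  have "\<phi> g (p (center K w)) = p (center K w)" if g: "g \<in> carrier G" for g
  proof -
    obtain m q w' L \<sigma> where 1: "(m, q) \<in> A" and al: "aligned n (\<phi> g \<circ> p) w m q w' {..<n} L \<sigma>"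
      by (rule cubical_map_aligned[OF cub[OF g] w(1,2)])
    have w': "corner m w'" using al unfolding aligned_def by simp
    have "p ` face n w K = q ` face m w' (\<sigma> ` K)"
      using aligned_face[OF al K] inv[OF g] unfolding C_def image_comp by simp
    then have "p (center K w) = q (center (\<sigma> ` K) w')"
      by (rule center_unique[OF w(1) 1 w(2) w' K aligned_flip(2)[OF al K]])
    then show ?thesis using aligned_center[OF al K] by simp
  qed
  moreover have "p (center K w) \<in> X"
    using center_face[OF w(2) order_refl K] chart_X[OF w(1)] unfolding face_def by blast
  ultimately show ?thesis by blast
qed

end
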